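(* Suppose that $\theta,\sigma,\kappa,\lambda,\nu$ are cardinals with $\omega \le \theta \le \sigma = \sigma^{<\sigma} < \kappa = \mathrm{cf}\,\lambda < \lambda \le \nu$, that $\lambda$ is a strong limit cardinal, and that for every cardinal $\mu<\kappa$, $\mu^{<\theta} < \kappa$. Let $\mathbf{P}$ be the partial ordering for adding $\nu$ Cohen subsets of $\sigma$. Then in $V^{\mathbf P}$ (i.e., in every generic extension of the ground model $V$ by $\mathbf P$), $\lambda \rightarrow (\lambda,\ \theta+1)^2$.
   Context: The partial ordering for adding $\nu$ Cohen subsets of $\sigma$ consists of partial functions $p$ from $\nu\times\sigma$ to $\{0,1\}$ with $|\mathrm{dom}\,p|<\sigma$, ordered by extension. For a cardinal $\lambda$ and an ordinal $\zeta$, $\lambda \rightarrow (\lambda,\ \zeta)^2$ means that for every coloring $c:[\lambda]^2 \to \{\text{red},\text{green}\}$ there is either a set $X\subseteq\lambda$ of cardinality $\lambda$ with $c$ constantly red on $[X]^2$, or a set $Y\subseteq \lambda$ of order type $\zeta$ with $c$ constantly green on $[Y]^2$. All hypotheses on cardinals are evaluated in the ground model $V$. *)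

theory Defs
  imports Main
begin

unbundle cardinal_syntax

section \<open>Cardinals of the ground model\<close>

text \<open>The cardinality of the set of all functions from a proper initial segment of \<open>s\<close> to \<open>r\<close>.\<close>

definition cexp_less :: "'a rel \<Rightarrow> 'b rel \<Rightarrow> ('b \<rightharpoonup> 'a) rel"
  where "cexp_less r s = |{f. (\<exists>a \<in> Field s. dom f = underS s a) \<and> ran f \<subseteq> Field r}|"

definition has_cofinality :: "'a rel \<Rightarrow> 'b rel \<Rightarrow> bool"
  where "has_cofinality r k \<longleftrightarrow>
    (\<exists>A \<subseteq> Field r. cofinal A r \<and> |A| =o k) \<and>
    (\<forall>A \<subseteq> Field r. cofinal A r \<longrightarrow> k \<le>o |A| )"

text \<open>It is enough to let \<open>m\<close> range over cardinals on the type of \<open>r\<close>, since every cardinal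
  below \<open>r\<close> has a representative there.\<close>

definition strong_limit :: "'a rel \<Rightarrow> bool"
  where "strong_limit r \<longleftrightarrow>
    (\<forall>m :: 'a rel. Card_order m \<and> m <o r \<longrightarrow> ctwo ^c m <o r)"


section \<open>Names\<close>

text \<open>HOL has no type of all names, since that would be a proper class. An element of \<open>('i, 'p) name\<close> is a set, of size at most that of
  \<open>'i\<close>, of pairs of a name and a condition; so the type consists of the names of hereditary size at
  most the size of \<open>'i\<close>. As \<open>'i\<close> is an arbitrary type, it can be chosen to accommodate any given
  name. If \<open>\<chi>\<close> is the size of \<open>'i\<close> and there are at most \<open>\<chi>\<close> conditions, then these names denote
  exactly the elements of the generic extension whose transitive closure is, there, of size at
  most \<open>\<chi>\<close>.\<close>

datatype ('i, 'p) name = Name "'i \<Rightarrow> (('i, 'p) name \<times> 'p) option"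

fun elems :: "('i, 'p) name \<Rightarrow> (('i, 'p) name \<times> 'p) set"
  where "elems (Name f) = ran f"

text \<open>Meaningful only for sets \<open>S\<close> of size at most that of \<open>'i\<close>.\<close>

definition name_of :: "(('i, 'p) name \<times> 'p) set \<Rightarrow> ('i, 'p) name"
  where "name_of S = Name (SOME f. ran f = S)"

lemma elems_name_of:
  fixes S :: "(('i, 'p) name \<times> 'p) set"
  assumes "|S| \<le>o |UNIV :: 'i set|"
  shows "elems (name_of S) = S"
proof -
  obtain g where g: "inj_on g S" "g ` S \<subseteq> (UNIV :: 'i set)"
    using assms by (auto simp: card_of_ordLeq[symmetric])
  define f where "f i = (if i \<in> g ` S then Some (inv_into S g i) else None)" for i
  have "f i = Some x \<longleftrightarrow> x \<in> S \<and> i = g x" for i x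
    using g(1) by (auto simp: f_def inv_into_f_f)
  then have "ran f = S"
    by (auto simp: ran_def)
  then show ?thesis
    unfolding name_of_def elems.simps by (rule someI[where P = "\<lambda>f. ran f = S"])
qed

definition name_less :: "(('i, 'p) name \<times> ('i, 'p) name) set"
  where "name_less = {(z, x). \<exists>s. (z, s) \<in> elems x}"

lemma wf_name_less: "wf name_less"
proof (rule wfUNIVI)
  fix Q :: "('i, 'p) name \<Rightarrow> bool" and x
  assume step: "\<forall>x. (\<forall>y. (y, x) \<in> name_less \<longrightarrow> Q y) \<longrightarrow> Q x"
  show "Q x"
  proof (induction x)
    case (Name f)
    have "Q y" if yf: "(y, Name f) \<in> name_less" for y
    proof -
      from yf obtain s i where "f i = Some (y, s)"
        by (auto simp: name_less_def ran_def)
      then show ?thesis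
        using Name.IH[of "Some (y, s)" "(y, s)" y]
        by (metis fst_conv fsts.intros option.set_intros rangeI)
    qed
    then show ?case using step by blast
  qed
qed

text \<open>The canonical name of the ordinal represented by the position of \<open>a\<close> in the well-order \<open>r\<close>,
  where \<open>e\<close> is the largest condition.\<close>

definition elem_name :: "'p \<Rightarrow> 'a rel \<Rightarrow> 'a \<Rightarrow> ('i, 'p) name"
  where "elem_name e r = wfrec (r - Id) (\<lambda>h a. name_of {(h b, e) | b. b \<in> underS r a})"

lemma elem_name_unfold:
  assumes "Well_order r"
  shows "elem_name e r a = name_of {(elem_name e r b, e) | b. b \<in> underS r a}"
proof -
  have "wf (r - Id)"
    using assms by (simp add: well_order_on_def)
  then have "elem_name e r a = name_of {(cut (elem_name e r) (r - Id) a b, e) | b. b \<in> underS r a}"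
    unfolding elem_name_def by (subst wfrec) simp_all
  also have "{(cut (elem_name e r) (r - Id) a b, e) | b. b \<in> underS r a}
      = {(elem_name e r b, e) | b. b \<in> underS r a}"
    by (auto simp: cut_def underS_def)
  finally show ?thesis .
qed

text \<open>The canonical names of the von Neumann ordinal isomorphic to \<open>r\<close>, and of the successor of
  an ordinal.\<close>

definition ord_name :: "'p \<Rightarrow> 'a rel \<Rightarrow> ('i, 'p) name"
  where "ord_name e r = name_of {(elem_name e r a, e) | a. a \<in> Field r}"

definition succ_name :: "'p \<Rightarrow> ('i, 'p) name \<Rightarrow> ('i, 'p) name"
  where "succ_name e x = name_of (insert (x, e) (elems x))"


section \<open>Forcing\<close>

text \<open>Sentences of the forcing language are represented by the predicate ``is forced by \<open>p\<close>'',
  with names as parameters. Conditions are ordered so that \<open>le q p\<close> means that \<open>q\<close> is stronger.\<close>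

locale forcing =
  fixes P :: "'p set" and le :: "'p \<Rightarrow> 'p \<Rightarrow> bool"
begin

inductive is_name :: "('i, 'p) name \<Rightarrow> bool"
  where "(\<forall>y p. (y, p) \<in> elems x \<longrightarrow> p \<in> P \<and> is_name y) \<Longrightarrow> is_name x"

definition dense_below :: "'p \<Rightarrow> ('p \<Rightarrow> bool) \<Rightarrow> bool"
  where "dense_below p D \<longleftrightarrow> (\<forall>q \<in> P. le q p \<longrightarrow> (\<exists>r \<in> P. le r q \<and> D r))"

function fEq :: "('i, 'p) name \<Rightarrow> ('i, 'p) name \<Rightarrow> 'p \<Rightarrow> bool"  (infix "\<^bold>=" 50)
  where "(x \<^bold>= y) p \<longleftrightarrow>
    (\<forall>(z, s) \<in> elems x.
      dense_below p (\<lambda>q. le q s \<longrightarrow> (\<exists>(w, t) \<in> elems y. le q t \<and> (z \<^bold>= w) q))) \<and>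
    (\<forall>(w, t) \<in> elems y.
      dense_below p (\<lambda>q. le q t \<longrightarrow> (\<exists>(z, s) \<in> elems x. le q s \<and> (z \<^bold>= w) q)))"
  by pat_completeness auto
termination
  by (relation "inv_image name_less fst") (auto simp: wf_name_less, auto simp: name_less_def)

definition fMem :: "('i, 'p) name \<Rightarrow> ('i, 'p) name \<Rightarrow> 'p \<Rightarrow> bool"  (infix "\<^bold>\<in>" 50)
  where "(x \<^bold>\<in> y) p \<longleftrightarrow> dense_below p (\<lambda>q. \<exists>(z, s) \<in> elems y. le q s \<and> (x \<^bold>= z) q)"

definition fNot :: "('p \<Rightarrow> bool) \<Rightarrow> 'p \<Rightarrow> bool"  ("\<^bold>\<not> _" [40] 40)
  where "(\<^bold>\<not> A) p \<longleftrightarrow> (\<forall>q \<in> P. le q p \<longrightarrow> \<not> A q)"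

definition fAnd :: "('p \<Rightarrow> bool) \<Rightarrow> ('p \<Rightarrow> bool) \<Rightarrow> 'p \<Rightarrow> bool"  (infixr "\<^bold>\<and>" 35)
  where "(A \<^bold>\<and> B) p \<longleftrightarrow> A p \<and> B p"

definition fEx :: "(('i, 'p) name \<Rightarrow> 'p \<Rightarrow> bool) \<Rightarrow> 'p \<Rightarrow> bool"  (binder "\<^bold>\<exists>" 10)
  where "(\<^bold>\<exists>x. A x) p \<longleftrightarrow> dense_below p (\<lambda>q. \<exists>x. is_name x \<and> A x q)"

definition fOr :: "('p \<Rightarrow> bool) \<Rightarrow> ('p \<Rightarrow> bool) \<Rightarrow> 'p \<Rightarrow> bool"  (infixr "\<^bold>\<or>" 30)
  where "(A \<^bold>\<or> B) = (\<^bold>\<not> (\<^bold>\<not> A \<^bold>\<and> \<^bold>\<not> B))"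

definition fImp :: "('p \<Rightarrow> bool) \<Rightarrow> ('p \<Rightarrow> bool) \<Rightarrow> 'p \<Rightarrow> bool"  (infixr "\<^bold>\<longrightarrow>" 25)
  where "(A \<^bold>\<longrightarrow> B) = (\<^bold>\<not> (A \<^bold>\<and> \<^bold>\<not> B))"

definition fIff :: "('p \<Rightarrow> bool) \<Rightarrow> ('p \<Rightarrow> bool) \<Rightarrow> 'p \<Rightarrow> bool"  (infixr "\<^bold>\<longleftrightarrow>" 25)
  where "(A \<^bold>\<longleftrightarrow> B) = ((A \<^bold>\<longrightarrow> B) \<^bold>\<and> (B \<^bold>\<longrightarrow> A))"

definition fAll :: "(('i, 'p) name \<Rightarrow> 'p \<Rightarrow> bool) \<Rightarrow> 'p \<Rightarrow> bool"  (binder "\<^bold>\<forall>" 10)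
  where "(\<^bold>\<forall>x. A x) = (\<^bold>\<not> (\<^bold>\<exists>x. \<^bold>\<not> A x))"

text \<open>Truth in every generic extension.\<close>

definition holds :: "('p \<Rightarrow> bool) \<Rightarrow> bool"
  where "holds A \<longleftrightarrow> (\<forall>p \<in> P. A p)"


subsection \<open>The partition relation in the forcing language\<close>

definition fSubset :: "('i, 'p) name \<Rightarrow> ('i, 'p) name \<Rightarrow> 'p \<Rightarrow> bool"  (infix "\<^bold>\<subseteq>" 50)
  where "(x \<^bold>\<subseteq> y) = (\<^bold>\<forall>z. z \<^bold>\<in> x \<^bold>\<longrightarrow> z \<^bold>\<in> y)"

text \<open>\<open>u = {a, b}\<close>\<close>

definition fPairset :: "('i, 'p) name \<Rightarrow> ('i, 'p) name \<Rightarrow> ('i, 'p) name \<Rightarrow> 'p \<Rightarrow> bool"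
  where "fPairset u a b = (\<^bold>\<forall>z. z \<^bold>\<in> u \<^bold>\<longleftrightarrow> (z \<^bold>= a \<^bold>\<or> z \<^bold>= b))"

text \<open>\<open>w = (a, b)\<close>, the Kuratowski pair\<close>

definition fOpair :: "('i, 'p) name \<Rightarrow> ('i, 'p) name \<Rightarrow> ('i, 'p) name \<Rightarrow> 'p \<Rightarrow> bool"
  where "fOpair w a b = (\<^bold>\<exists>u. \<^bold>\<exists>v. fPairset u a a \<^bold>\<and> fPairset v a b \<^bold>\<and> fPairset w u v)"

text \<open>\<open>(a, b) \<in> f\<close>\<close>

definition fApp :: "('i, 'p) name \<Rightarrow> ('i, 'p) name \<Rightarrow> ('i, 'p) name \<Rightarrow> 'p \<Rightarrow> bool"
  where "fApp f a b = (\<^bold>\<exists>w. fOpair w a b \<^bold>\<and> w \<^bold>\<in> f)"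

text \<open>\<open>f\<close> is a function from \<open>A\<close> to \<open>B\<close>\<close>

definition fFun :: "('i, 'p) name \<Rightarrow> ('i, 'p) name \<Rightarrow> ('i, 'p) name \<Rightarrow> 'p \<Rightarrow> bool"
  where "fFun f A B =
    ((\<^bold>\<forall>w. w \<^bold>\<in> f \<^bold>\<longrightarrow> (\<^bold>\<exists>a. \<^bold>\<exists>b. a \<^bold>\<in> A \<^bold>\<and> b \<^bold>\<in> B \<^bold>\<and> fOpair w a b)) \<^bold>\<and>
     (\<^bold>\<forall>a. a \<^bold>\<in> A \<^bold>\<longrightarrow> (\<^bold>\<exists>b. fApp f a b)) \<^bold>\<and>
     (\<^bold>\<forall>a. \<^bold>\<forall>b. \<^bold>\<forall>b'. fApp f a b \<^bold>\<and> fApp f a b' \<^bold>\<longrightarrow> b \<^bold>= b'))"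

definition fBij :: "('i, 'p) name \<Rightarrow> ('i, 'p) name \<Rightarrow> ('i, 'p) name \<Rightarrow> 'p \<Rightarrow> bool"
  where "fBij f A B =
    (fFun f A B \<^bold>\<and>
     (\<^bold>\<forall>b. b \<^bold>\<in> B \<^bold>\<longrightarrow> (\<^bold>\<exists>a. fApp f a b)) \<^bold>\<and>
     (\<^bold>\<forall>a. \<^bold>\<forall>a'. \<^bold>\<forall>b. fApp f a b \<^bold>\<and> fApp f a' b \<^bold>\<longrightarrow> a \<^bold>= a'))"

definition fEquipotent :: "('i, 'p) name \<Rightarrow> ('i, 'p) name \<Rightarrow> 'p \<Rightarrow> bool"
  where "fEquipotent A B = (\<^bold>\<exists>f. fBij f A B)"

text \<open>The set of ordinals \<open>Y\<close> has order type \<open>z\<close>\<close>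

definition fOrdertype :: "('i, 'p) name \<Rightarrow> ('i, 'p) name \<Rightarrow> 'p \<Rightarrow> bool"
  where "fOrdertype Y z =
    (\<^bold>\<exists>f. fBij f z Y \<^bold>\<and>
      (\<^bold>\<forall>a. \<^bold>\<forall>b. \<^bold>\<forall>a'. \<^bold>\<forall>b'. fApp f a a' \<^bold>\<and> fApp f b b' \<^bold>\<longrightarrow> (a \<^bold>\<in> b \<^bold>\<longleftrightarrow> a' \<^bold>\<in> b')))"

text \<open>\<open>D = [A]\<^sup>2\<close>\<close>

definition fPairs :: "('i, 'p) name \<Rightarrow> ('i, 'p) name \<Rightarrow> 'p \<Rightarrow> bool"
  where "fPairs D A =
    (\<^bold>\<forall>u. u \<^bold>\<in> D \<^bold>\<longleftrightarrow>
      (\<^bold>\<exists>a. \<^bold>\<exists>b. a \<^bold>\<in> A \<^bold>\<and> b \<^bold>\<in> A \<^bold>\<and> \<^bold>\<not> (a \<^bold>= b) \<^bold>\<and> fPairset u a b))"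

text \<open>\<open>c\<close> is constantly \<open>i\<close> on \<open>[X]\<^sup>2\<close>\<close>

definition fHomogeneous ::
    "('i, 'p) name \<Rightarrow> ('i, 'p) name \<Rightarrow> ('i, 'p) name \<Rightarrow> 'p \<Rightarrow> bool"
  where "fHomogeneous c X i = (\<^bold>\<exists>D. fPairs D X \<^bold>\<and> (\<^bold>\<forall>u. u \<^bold>\<in> D \<^bold>\<longrightarrow> fApp c u i))"

text \<open>\<open>l \<rightarrow> (l, z)\<^sup>2\<close>\<close>

definition fArrow :: "('i, 'p) name \<Rightarrow> ('i, 'p) name \<Rightarrow> 'p \<Rightarrow> bool"
  where "fArrow l z =
    (\<^bold>\<forall>red. \<^bold>\<forall>green. \<^bold>\<forall>C. \<^bold>\<forall>D. \<^bold>\<forall>c.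
      \<^bold>\<not> (red \<^bold>= green) \<^bold>\<and> fPairset C red green \<^bold>\<and> fPairs D l \<^bold>\<and> fFun c D C \<^bold>\<longrightarrow>
      (\<^bold>\<exists>X. X \<^bold>\<subseteq> l \<^bold>\<and> fEquipotent X l \<^bold>\<and> fHomogeneous c X red) \<^bold>\<or>
      (\<^bold>\<exists>Y. Y \<^bold>\<subseteq> l \<^bold>\<and> fOrdertype Y z \<^bold>\<and> fHomogeneous c Y green))"

end


section \<open>Cohen forcing\<close>

text \<open>Adding \<open>n\<close> Cohen subsets of \<open>s\<close>; the largest condition is the empty function.\<close>

definition cohen :: "'n rel \<Rightarrow> 's rel \<Rightarrow> ('n \<times> 's \<rightharpoonup> bool) set"
  where "cohen n s = {p. dom p \<subseteq> Field n \<times> Field s \<and> |dom p| <o s}"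

definition extends :: "('a \<rightharpoonup> 'b) \<Rightarrow> ('a \<rightharpoonup> 'b) \<Rightarrow> bool"
  where "extends q p \<longleftrightarrow> p \<subseteq>\<^sub>m q"

end

theory Submission
  imports Defs
begin

text \<open>
  Call a pair \<open>a < b\<close> green under a condition that forces its colour to be green. By the chain
  condition, greenness of \<open>a, b\<close> is described in \<open>V\<close> by an antichain of at most \<open>\<sigma>\<close> conditions
  \<open>m a b z\<close>. Cut \<open>lam\<close> into \<open>\<kappa>\<close> pieces of regular sizes that grow so fast that every piece can be
  thinned out, without loss of size, until any two of its points \<open>a\<close> look alike to all lower
  points and to all later pieces: the conditions \<open>m y a z\<close> and \<open>m a b z'\<close> form \<open>\<Delta>\<close>-systems and agree
  or disagree in the same way. Fix \<open>\<sigma>\<close> representatives in each piece.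

  Below a given condition, build for each point \<open>b\<close> greedily a green clique of representatives from
  the lower pieces, then another one within the piece of \<open>b\<close>. If for some \<open>b\<close> this can never get
  stuck, then the generic filter yields a green set of type \<open>\<theta> + 1\<close> with top \<open>b\<close>. Otherwise some
  condition \<open>q b\<close> decides a clique that no stronger condition can enlarge. By pressing down, on
  each piece and on \<open>\<kappa>\<close> (where \<open>\<mu>\<^sup><\<^sup>\<theta> < \<kappa>\<close> bounds the number of cliques), \<open>\<kappa>\<close> many pieces have
  subsets of full size that share the first clique. Then all pairs of points \<open>b\<close> with \<open>q b\<close> in the
  generic filter are red: in a green pair \<open>a < b\<close> from different pieces, \<open>a\<close> could be replaced by
  a representative whose conditions avoid the support of \<open>q b\<close>, and this would enlarge the clique of
  \<open>b\<close>. The \<open>q b\<close> in each piece form a \<open>\<Delta>\<close>-system, so by genericity there are \<open>lam\<close> many such \<open>b\<close>.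

  In the forcing language every connective of regular open sentences is read off from density,
  and a set or bijection in the extension is given by an open relation between ground model
  objects and conditions.
\<close>

section \<open>Regular cardinals\<close>

text \<open>In the extension \<open>\<sigma>\<close> has at least \<open>lam\<close> subsets, so
  \<open>lam\<close> is no strong limit there and no counting of types is possible there. All
  counting is done in the ground model, on the conditions \<open>m a b z\<close>; the extension only
  reads off the outcome.

  A piece above \<open>D\<close> has the size of the successor of \<open>|Pow D|\<close>. This is
  regular; it exceeds the number of subsets of \<open>D\<close>, so any description of a point by a
  subset of \<open>D\<close> can be made constant; and it admits Delta-systems of sets of size
  \<open>|D|\<close>, since \<open>|Pow D|\<close> objects have only \<open>|Pow D|\<close> sets of
  at most \<open>|D|\<close> members. A piece has \<open>\<sigma>\<close> representatives because
  the support of a condition, which is smaller than \<open>\<sigma>\<close>, must be avoided; it has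
  no more because fewer than \<open>\<kappa>\<close> representatives may lie below a piece if the
  cliques among them are to be counted.

  A representative replaces a point only as seen from a later piece. Pairs inside one piece need the
  second clique, which consists of arbitrary points of the piece.\<close>

definition regular_card :: "'a rel \<Rightarrow> bool"
  where "regular_card L \<longleftrightarrow> Card_order L \<and> \<not> finite (Field L) \<and> stable L"

lemma underS_trans:
  assumes "Well_order r" "a \<in> underS r b" "b \<in> underS r c"
  shows "a \<in> underS r c"
proof -
  have "trans r" "antisym r"
    using assms(1) by (auto simp: order_on_defs)
  then show ?thesis
    using assms(2,3) by (auto simp: underS_def dest: transD antisymD)
qed

lemma underS_irrefl: "a \<notin> underS r a"
  by (auto simp: underS_def)

lemma underS_asym: "Well_order r \<Longrightarrow> a \<in> underS r b \<Longrightarrow> b \<notin> underS r a"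
  using underS_trans underS_irrefl by metis

lemma underS_total:
  assumes "Well_order r" "a \<in> Field r" "b \<in> Field r"
  shows "a = b \<or> a \<in> underS r b \<or> b \<in> underS r a"
  using assms by (auto simp: underS_def order_on_defs total_on_def)

lemma underS_FieldD: "a \<in> underS r b \<Longrightarrow> a \<in> Field r \<and> b \<in> Field r"
  by (auto simp: underS_def Field_def)

lemma wf_underS:
  assumes "Well_order r" shows "wf {(a, b). a \<in> underS r b}"
proof -
  have "{(a, b). a \<in> underS r b} = r - Id"
    by (auto simp: underS_def)
  then show ?thesis
    using assms by (simp add: well_order_on_def)
qed

lemma ex_least_underS:
  assumes "Well_order r" "x \<in> S"
  obtains m where "m \<in> S" "\<And>y. y \<in> underS r m \<Longrightarrow> y \<notin> S"
  using wfE_min[OF wf_underS[OF assms(1)] assms(2)] by auto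

lemma card_of_subset_cases:
  assumes "Card_order L" "|A| =o L" "X \<subseteq> A"
  shows "|X| <o L \<or> |X| =o L"
proof -
  have "|X| \<le>o L"
    using assms card_of_mono1 ordLeq_ordIso_trans by blast
  then show ?thesis
    by (simp add: ordLeq_iff_ordLess_or_ordIso)
qed

text \<open>The relation is not assumed to be symmetric, so maximality is stated with both
  directions. Maximal antichains are one use; in \<open>delta_system\<close> the lemma replaces a
  transfinite recursion.\<close>

lemma ex_maximal_pairwise:
  "\<exists>M \<subseteq> S. pairwise R M \<and> (\<forall>x \<in> S. (\<forall>y \<in> M. R x y \<and> R y x) \<longrightarrow> x \<in> M)"
proof -
  obtain M where M: "M \<subseteq> S \<and> pairwise R M" "\<And>X. X \<subseteq> S \<and> pairwise R X \<Longrightarrow> M \<subseteq> X \<Longrightarrow> X = M"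
  proof -
    have "\<exists>M\<in>{X. X \<subseteq> S \<and> pairwise R X}. \<forall>X\<in>{X. X \<subseteq> S \<and> pairwise R X}. M \<subseteq> X \<longrightarrow> X = M"
    proof (rule subset_Zorn')
      fix C assume C: "subset.chain {X. X \<subseteq> S \<and> pairwise R X} C"
      have "pairwise R (\<Union>C)"
        unfolding pairwise_def
      proof (intro ballI impI)
        fix x y assume "x \<in> \<Union>C" "y \<in> \<Union>C" and ne: "x \<noteq> y"
        then obtain X Y where XY: "X \<in> C" "x \<in> X" "Y \<in> C" "y \<in> Y" by blast
        then have "X \<subseteq> Y \<or> Y \<subseteq> X" "pairwise R X" "pairwise R Y"
          using C unfolding subset.chain_def by blast+
        then show "R x y"
          using XY ne unfolding pairwise_def by blast
      qed
      then show "\<Union>C \<in> {X. X \<subseteq> S \<and> pairwise R X}"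
        using C by (auto simp: subset.chain_def)
    qed
    then show thesis
      using that by auto
  qed
  have "x \<in> M" if "x \<in> S" "\<forall>y \<in> M. R x y \<and> R y x" for x
    using M(2)[of "insert x M"] M(1) that by (auto simp: pairwise_insert)
  then show ?thesis
    using M(1) by blast
qed

section \<open>Pigeonhole, boundedness and pressing down\<close>

lemma pigeonhole_regular:
  assumes L: "regular_card L" and A: "|A| =o L" and F: "|F ` A| <o L"
  shows "\<exists>t. |{a \<in> A. F a = t}| =o L"
proof (rule ccontr)
  assume "\<not> ?thesis"
  then have "|{a \<in> A. F a = t}| <o L" for t
    using card_of_subset_cases[of L A "{a \<in> A. F a = t}"] L A by (auto simp: regular_card_def)
  then have "|\<Union>t \<in> F ` A. {a \<in> A. F a = t}| <o L"
    using L F by (intro stable_UNION) (auto simp: regular_card_def)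
  also have "(\<Union>t \<in> F ` A. {a \<in> A. F a = t}) = A"
    by auto
  finally show False
    using A not_ordLess_ordIso by blast
qed

text \<open>If \<open>Y\<close> had no strict upper bound in \<open>A\<close>, the small initial
  segments given by its points would cover \<open>A\<close>. The assumption \<open>init\<close> lets
  a set inside a longer well-order be treated like a copy of \<open>L\<close>; the pieces of
  \<open>lam\<close> are such sets.\<close>

lemma bounded_of_small:
  assumes L: "regular_card L" and A: "|A| =o L" and r: "Well_order r" "A \<subseteq> Field r"
    and init: "\<And>a. a \<in> A \<Longrightarrow> |A \<inter> underS r a| <o L"
    and Y: "Y \<subseteq> A" "|Y| <o L"
  shows "\<exists>b \<in> A. Y \<subseteq> underS r b"
proof (rule ccontr)
  assume neg: "\<not> ?thesis"
  have inf: "\<not> finite (Field L)" "Card_order L"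
    using L by (auto simp: regular_card_def)
  have "|insert y (A \<inter> underS r y)| <o L" if "y \<in> A" for y
  proof -
    have "|{y}| <o L"
      using inf finite_ordLess_infinite[of "|{y}|" L] card_of_Well_order
      by (auto simp: Field_card_of card_order_on_def)
    then have "|{y} \<union> (A \<inter> underS r y)| <o L"
      using init[OF that] inf card_of_Un_ordLess_infinite_Field by blast
    then show ?thesis by simp
  qed
  then have "|\<Union>y \<in> Y. insert y (A \<inter> underS r y)| <o L"
    using L Y by (intro stable_UNION) (auto simp: regular_card_def)
  moreover have "A \<subseteq> (\<Union>y \<in> Y. insert y (A \<inter> underS r y))"
  proof
    fix b assume b: "b \<in> A"
    then obtain y where "y \<in> Y" "y \<notin> underS r b"
      using neg by blast
    then show "b \<in> (\<Union>y \<in> Y. insert y (A \<inter> underS r y))"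
      using underS_total[OF r(1), of y b] b Y r(2) by blast
  qed
  ultimately have "|A| <o L"
    using card_of_mono1 ordLeq_ordLess_trans by blast
  then show False
    using A not_ordLess_ordIso by blast
qed

lemma regular_small_bounded:
  assumes L: "regular_card L" and Y: "Y \<subseteq> Field L" "|Y| <o L"
  shows "\<exists>b \<in> Field L. Y \<subseteq> underS L b"
proof -
  have c: "Card_order L" using L by (auto simp: regular_card_def)
  show ?thesis
  proof (rule bounded_of_small[OF L card_of_Field_ordIso[OF c] _ _ _ Y])
    show "Well_order L" using c by (simp add: card_order_on_def)
    fix a assume "a \<in> Field L"
    moreover have "Field L \<inter> underS L a = underS L a"
      using underS_Field by fastforce
    ultimately show "|Field L \<inter> underS L a| <o L"
      using card_of_underS[OF c] by simp
  qed simp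
qed

text \<open>A form of Fodor's lemma which needs neither clubs nor stationary sets: closing off under a
  counterexample function \<open>\<tau>\<close> times yields a point whose set \<open>B\<close> contradicts the choice.\<close>

lemma pressing_down:
  assumes L: "regular_card L" and A: "|A| =o L" and r: "Well_order r" "A \<subseteq> Field r"
    and init: "\<And>a. a \<in> A \<Longrightarrow> |A \<inter> underS r a| <o L"
    and t: "regular_card \<tau>" "\<tau> <o L"
    and B: "\<And>a. a \<in> A \<Longrightarrow> B a \<subseteq> A \<inter> underS r a \<and> |B a| <o \<tau>"
  shows "\<exists>a0 \<in> A. |{a \<in> A. B a \<subseteq> underS r a0}| =o L"
proof (rule ccontr)
  assume neg: "\<not> ?thesis"
  note bd = bounded_of_small[OF L A r init]
  \<comment> \<open>In a counterexample each of these sets is smaller than \<open>L\<close>, hence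
    bounded in \<open>A\<close>; \<open>h a0\<close> will be a bound.\<close>
  have "\<exists>h \<in> A. {a \<in> A. B a \<subseteq> underS r a0} \<subseteq> underS r h" if "a0 \<in> A" for a0
    using neg that card_of_subset_cases[of L A "{a \<in> A. B a \<subseteq> underS r a0}"] L A
    by (intro bd) (auto simp: regular_card_def)
  then obtain h where h: "\<And>a0. a0 \<in> A \<Longrightarrow> h a0 \<in> A"
      "\<And>a0 a. a0 \<in> A \<Longrightarrow> a \<in> A \<Longrightarrow> B a \<subseteq> underS r a0 \<Longrightarrow> a \<in> underS r (h a0)"
    by (metis (no_types, lifting) mem_Collect_eq subsetD)
  have wt: "Well_order \<tau>" "Card_order \<tau>"
    using t by (auto simp: regular_card_def card_order_on_def)
  \<comment> \<open>The values \<open>f k\<close> form an increasing sequence of length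
    \<open>\<tau>\<close> in which each term also lies above the bounds \<open>h\<close> of all
    earlier terms.\<close>
  define P where "P f k x \<longleftrightarrow> k \<in> Field \<tau> \<longrightarrow>
      x \<in> A \<and> (\<forall>l \<in> underS \<tau> k. f l \<in> underS r x \<and> h (f l) \<in> underS r x)" for f k and x
  have "\<exists>f. \<forall>k. P f k (f k)"
  proof (rule dependent_wf_choice[OF wf_underS[OF wt(1)]])
    show "P f x s = P g x s" if "\<And>z. (z, x) \<in> {(a, b). a \<in> underS \<tau> b} \<Longrightarrow> f z = g z" for f g x s
      using that by (auto simp: P_def)
    fix k f assume IH: "\<And>l. (l, k) \<in> {(a, b). a \<in> underS \<tau> b} \<Longrightarrow> P f l (f l)"
    show "\<exists>x. P f k x"
    proof (cases "k \<in> Field \<tau>")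
      case True
      have fA: "f l \<in> A" if "l \<in> underS \<tau> k" for l
        using IH that underS_FieldD by (fastforce simp: P_def)
      have u: "|underS \<tau> k| <o L"
        using card_of_underS[OF wt(2) True] t(2) ordLess_transitive by blast
      have "|f ` underS \<tau> k \<union> (\<lambda>l. h (f l)) ` underS \<tau> k| <o L"
        using u L ordLeq_ordLess_trans[OF card_of_image u]
        by (intro card_of_Un_ordLess_infinite_Field) (auto simp: regular_card_def)
      then obtain b where "b \<in> A" "f ` underS \<tau> k \<union> (\<lambda>l. h (f l)) ` underS \<tau> k \<subseteq> underS r b"
        using bd[of "f ` underS \<tau> k \<union> (\<lambda>l. h (f l)) ` underS \<tau> k"] fA h(1) by blast
      then show ?thesis
        by (auto simp: P_def)
    qed (simp add: P_def)
  qed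
  then obtain f where f: "\<And>k. k \<in> Field \<tau> \<Longrightarrow> f k \<in> A"
      "\<And>k l. k \<in> Field \<tau> \<Longrightarrow> l \<in> underS \<tau> k \<Longrightarrow> f l \<in> underS r (f k) \<and> h (f l) \<in> underS r (f k)"
    unfolding P_def by blast
  have Ft: "|Field \<tau>| <o L"
    using t wt card_of_Field_ordIso ordIso_ordLess_trans by blast
  have "\<exists>b \<in> A. f ` Field \<tau> \<subseteq> underS r b"
    using f(1) ordLeq_ordLess_trans[OF card_of_image Ft] by (intro bd) auto
  then obtain b where b: "b \<in> {b \<in> A. f ` Field \<tau> \<subseteq> underS r b}"
    by blast
  \<comment> \<open>\<open>d\<close> is the supremum of the sequence in \<open>A\<close>, so every
    element of \<open>B d\<close> is at or below some term, and by regularity of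
    \<open>\<tau>\<close> all of \<open>B d\<close> lies below a single term \<open>f k0\<close>.
    Then \<open>d\<close> is below \<open>h (f k0)\<close>, which in turn is below
    \<open>d\<close>.\<close>
  obtain d where d: "d \<in> A" "f ` Field \<tau> \<subseteq> underS r d"
      and dmin: "\<And>y. y \<in> underS r d \<Longrightarrow> \<not> (y \<in> A \<and> f ` Field \<tau> \<subseteq> underS r y)"
    by (rule ex_least_underS[OF r(1) b]) blast
  have "\<exists>k \<in> Field \<tau>. x \<in> insert (f k) (underS r (f k))" if x: "x \<in> B d" for x
  proof -
    have xA: "x \<in> A" "x \<in> underS r d"
      using B[OF d(1)] x by auto
    then obtain k where "k \<in> Field \<tau>" "f k \<notin> underS r x"
      using dmin by blast
    then show ?thesis
      using underS_total[OF r(1), of x "f k"] xA f(1) r(2) by blast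
  qed
  then obtain kk where kk: "\<And>x. x \<in> B d \<Longrightarrow> kk x \<in> Field \<tau> \<and> x \<in> insert (f (kk x)) (underS r (f (kk x)))"
    by metis
  have "|kk ` B d| <o \<tau>"
    using B[OF d(1)] card_of_image ordLeq_ordLess_trans by blast
  then obtain k0 where k0: "k0 \<in> Field \<tau>" "kk ` B d \<subseteq> underS \<tau> k0"
    using regular_small_bounded[OF t(1), of "kk ` B d"] kk by blast
  have "B d \<subseteq> underS r (f k0)"
  proof
    fix x assume x: "x \<in> B d"
    then have "f (kk x) \<in> underS r (f k0)"
      using k0 f(2) by blast
    then show "x \<in> underS r (f k0)"
      using kk[OF x] underS_trans[OF r(1), of x "f (kk x)" "f k0"] by auto
  qed
  then have "d \<in> underS r (h (f k0))"
    using h(2) f(1) k0 d by blast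
  moreover obtain k1 where "k1 \<in> Field \<tau>" "{k0} \<subseteq> underS \<tau> k1"
  proof -
    have "|{k0}| <o \<tau>"
      using t finite_ordLess_infinite[of "|{k0}|" \<tau>] card_of_Well_order wt
      by (auto simp: Field_card_of regular_card_def)
    then have "\<exists>b \<in> Field \<tau>. {k0} \<subseteq> underS \<tau> b"
      using k0 by (intro regular_small_bounded[OF t(1)]) auto
    then show thesis using that by blast
  qed
  then have "h (f k0) \<in> underS r (f k1)" "f k1 \<in> underS r d"
    using f(2) d(2) by auto
  ultimately show False
    using underS_trans[OF r(1)] underS_asym[OF r(1)] by blast
qed

section \<open>Delta-systems\<close>

lemma regular_small_singleton: "regular_card L \<Longrightarrow> |{x}| <o L"
  using finite_ordLess_infinite[of "|{x}|" L] card_of_Well_order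
  by (auto simp: Field_card_of regular_card_def card_order_on_def)

lemma regular_small_Un: "regular_card L \<Longrightarrow> |A| <o L \<Longrightarrow> |B| <o L \<Longrightarrow> |A \<union> B| <o L"
  using card_of_Un_ordLess_infinite_Field by (auto simp: regular_card_def)

lemma regular_small_UN:
  "regular_card L \<Longrightarrow> |I| <o L \<Longrightarrow> (\<And>i. i \<in> I \<Longrightarrow> |A i| <o L) \<Longrightarrow> |\<Union>i \<in> I. A i| <o L"
  using stable_UNION by (auto simp: regular_card_def)

lemma small_image: "|A| <o L \<Longrightarrow> |f ` A| <o L"
  using card_of_image ordLeq_ordLess_trans by blast

lemma small_subset: "|A| <o L \<Longrightarrow> B \<subseteq> A \<Longrightarrow> |B| <o L"
  using card_of_mono1 ordLeq_ordLess_trans by blast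

text \<open>With the sets moved into \<open>L\<close>, pressing down and a pigeonhole make the part
  of \<open>C i\<close> below \<open>i\<close> a constant \<open>R\<close>. If moreover
  \<open>C i\<close> lies below \<open>j\<close> whenever \<open>i\<close> comes before
  \<open>j\<close>, two of the sets meet exactly in \<open>R\<close>. The assumption
  \<open>cnt\<close> bounds the number of candidates for \<open>R\<close>.\<close>

theorem delta_system:
  fixes L :: "'l rel" and B :: "'a \<Rightarrow> 'u set"
  assumes L: "regular_card L" and A: "|A| =o L" and t: "regular_card \<tau>" "\<tau> <o L"
    and B: "\<And>a. a \<in> A \<Longrightarrow> |B a| <o \<tau>"
    and cnt: "\<And>U :: 'l set. |U| <o L \<Longrightarrow> |{X. X \<subseteq> U \<and> |X| <o \<tau>}| <o L"
  shows "\<exists>M \<subseteq> A. |M| =o L \<and> (\<exists>R. \<forall>a \<in> M. R \<subseteq> B a \<and> (\<forall>b \<in> M. a \<noteq> b \<longrightarrow> B a \<inter> B b = R))"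
proof -
  have LC: "Card_order L" "Well_order L" "\<not> finite (Field L)"
    using L by (auto simp: regular_card_def card_order_on_def)
  have FL: "|Field L| =o L"
    using LC card_of_Field_ordIso by blast
  have "|Field L| =o |A|"
    using FL A ordIso_symmetric ordIso_transitive by blast
  then obtain f where f: "bij_betw f (Field L) A"
    using card_of_ordIso by blast
  have "|\<Union>a \<in> A. B a| \<le>o L"
  proof (rule UNION_Cinfinite_bound)
    show "|A| \<le>o L" using A ordIso_imp_ordLeq by blast
    show "\<forall>a \<in> A. |B a| \<le>o L"
      using B t ordLess_transitive ordLess_imp_ordLeq by blast
    show "Cinfinite L" using LC by (simp add: cinfinite_def)
  qed
  then have "|\<Union>a \<in> A. B a| \<le>o |Field L|"
    using FL ordIso_symmetric ordLeq_ordIso_trans by blast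
  then obtain u where u: "inj_on u (\<Union>a \<in> A. B a)" "u ` (\<Union>a \<in> A. B a) \<subseteq> Field L"
    by (metis card_of_ordLeq)
  define C where "C i = u ` B (f i)" for i
  have fA: "f i \<in> A" if "i \<in> Field L" for i
    using f that by (auto simp: bij_betw_def)
  have C: "C i \<subseteq> Field L" "|C i| <o \<tau>" if "i \<in> Field L" for i
    using fA[OF that] u B small_image unfolding C_def by fastforce+
  have init: "|Field L \<inter> underS L a| <o L" if "a \<in> Field L" for a
    using card_of_underS[OF LC(1) that] small_subset by blast
  have "C i \<inter> underS L i \<subseteq> Field L \<inter> underS L i \<and> |C i \<inter> underS L i| <o \<tau>" if "i \<in> Field L" for i
    using C[OF that] small_subset[of "C i" \<tau> "C i \<inter> underS L i"] by blast
  then obtain a0 where a0: "a0 \<in> Field L" "|{i \<in> Field L. C i \<inter> underS L i \<subseteq> underS L a0}| =o L"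
    using pressing_down[OF L FL LC(2) subset_refl init t, of "\<lambda>i. C i \<inter> underS L i"] by blast
  define X where "X = {i \<in> Field L. C i \<inter> underS L i \<subseteq> underS L a0}"
  have "|{Y. Y \<subseteq> underS L a0 \<and> |Y| <o \<tau>}| <o L"
    using a0 card_of_underS[OF LC(1)] by (intro cnt) blast
  moreover have "(\<lambda>i. C i \<inter> underS L i) ` X \<subseteq> {Y. Y \<subseteq> underS L a0 \<and> |Y| <o \<tau>}"
    using C small_subset unfolding X_def by blast
  ultimately have "|(\<lambda>i. C i \<inter> underS L i) ` X| <o L"
    using small_subset by blast
  then obtain R where R: "|{i \<in> X. C i \<inter> underS L i = R}| =o L"
    using pigeonhole_regular[OF L] a0 X_def by blast
  define X' where "X' = {i \<in> X. C i \<inter> underS L i = R}"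
  define Q where "Q i j \<longleftrightarrow> (i \<in> underS L j \<longrightarrow> C i \<subseteq> underS L j) \<and> (j \<in> underS L i \<longrightarrow> C j \<subseteq> underS L i)" for i j
  \<comment> \<open>A maximal family of indices that are far enough apart has full size: if it were
    smaller than \<open>L\<close>, it would be bounded together with all its sets, and any index of
    \<open>X'\<close> beyond the bound could be added.\<close>
  obtain M where M: "M \<subseteq> X'" "pairwise Q M" "\<And>x. x \<in> X' \<Longrightarrow> (\<forall>y \<in> M. Q x y \<and> Q y x) \<Longrightarrow> x \<in> M"
    using ex_maximal_pairwise[of X' Q] by blast
  have X'F: "X' \<subseteq> Field L" by (auto simp: X'_def X_def)
  have MoL: "|M| =o L"
  proof (rule ccontr)
    assume "\<not> |M| =o L"
    then have Ms: "|M| <o L"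
      using card_of_subset_cases[OF LC(1) R, of M] M(1) by (auto simp: X'_def)
    have "|M \<union> (\<Union>i \<in> M. C i)| <o L"
      using Ms C M(1) X'F t ordLess_transitive
      by (intro regular_small_Un regular_small_UN L) blast+
    moreover have "M \<union> (\<Union>i \<in> M. C i) \<subseteq> Field L"
      using C M(1) X'F by blast
    ultimately obtain c where c: "c \<in> Field L" "M \<union> (\<Union>i \<in> M. C i) \<subseteq> underS L c"
      using regular_small_bounded[OF L] by blast
    have "|X'| =o L" using R by (simp add: X'_def)
    then have "\<not> |X'| <o L"
      using not_ordLess_ordIso by blast
    moreover have "|{c} \<union> underS L c| <o L"
      using c card_of_underS[OF LC(1)] by (intro regular_small_Un L regular_small_singleton) blast
    ultimately obtain b where b: "b \<in> X'" "b \<noteq> c" "b \<notin> underS L c"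
      using small_subset by blast
    then have "c \<in> underS L b"
      using underS_total[OF LC(2)] c X'F by blast
    then have sub: "M \<union> (\<Union>i \<in> M. C i) \<subseteq> underS L b"
      using c underS_trans[OF LC(2)] by blast
    then have "\<forall>y \<in> M. Q b y \<and> Q y b"
      using underS_asym[OF LC(2)] unfolding Q_def by blast
    then have "b \<in> M" using M(3) b by blast
    then show False
      using sub underS_irrefl by fastforce
  qed
  have R1: "R \<subseteq> C i" if "i \<in> M" for i
    using that M(1) by (auto simp: X'_def)
  have R2: "C i \<inter> C j = R" if "i \<in> M" "j \<in> M" "i \<noteq> j" for i j
  proof -
    have aux: "C i \<inter> C j = R" if "i \<in> M" "j \<in> M" "i \<in> underS L j" for i j
    proof -
      have "i \<noteq> j" using that underS_irrefl by fastforce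
      then have "Q i j" using M(2) that by (auto simp: pairwise_def)
      then have "C i \<subseteq> underS L j" using that by (auto simp: Q_def)
      moreover have "C j \<inter> underS L j = R" using that M(1) by (auto simp: X'_def)
      ultimately show ?thesis using R1 that by blast
    qed
    show ?thesis
      using underS_total[OF LC(2), of i j] aux that M(1) X'F by blast
  qed
  have u_inj: "x = y" if "a \<in> A" "b \<in> A" "x \<in> B a" "y \<in> B b" "u x = u y" for a b x y
    using u(1) that unfolding inj_on_def by blast
  define R0 where "R0 = {x \<in> \<Union>a \<in> A. B a. u x \<in> R}"
  have MF: "M \<subseteq> Field L" using M(1) X'F by blast
  have "|f ` M| =o L"
  proof -
    have "bij_betw f M (f ` M)"
      using f MF by (meson bij_betw_subset)
    then show ?thesis
      using MoL card_of_ordIsoI ordIso_symmetric ordIso_transitive by blast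
  qed
  moreover have R0: "R0 \<subseteq> B a" if a: "a \<in> f ` M" for a
  proof
    fix x assume x: "x \<in> R0"
    obtain i where i: "i \<in> M" "a = f i" using a by blast
    have "u x \<in> C i" using x R1[OF i(1)] by (auto simp: R0_def)
    then obtain y where "y \<in> B a" "u x = u y" by (auto simp: C_def i)
    then show "x \<in> B a"
      using u_inj[of _ a x y] x fA MF i by (auto simp: R0_def)
  qed
  moreover have "B a \<inter> B b = R0" if ab: "a \<in> f ` M" "b \<in> f ` M" "a \<noteq> b" for a b
  proof -
    obtain i j where ij: "i \<in> M" "a = f i" "j \<in> M" "b = f j" using ab by blast
    then have "C i \<inter> C j = R" using R2 ab by blast
    then have "B a \<inter> B b \<subseteq> R0"
      using ij fA MF unfolding C_def R0_def by blast
    then show ?thesis using R0[OF ab(1)] R0[OF ab(2)] by blast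
  qed
  moreover have "f ` M \<subseteq> A" using fA MF by blast
  ultimately show ?thesis
    by (intro exI[of _ "f ` M"] conjI exI[of _ R0]) auto
qed

section \<open>Counting small subsets; regularity of \<open>\<sigma>\<close>, of cofinalities and of
  successors\<close>

definition small_powers :: "'l rel \<Rightarrow> 't rel \<Rightarrow> bool"
  where "small_powers L \<tau> \<longleftrightarrow> (\<forall>U \<subseteq> Field L. |U| <o L \<longrightarrow> |{X. X \<subseteq> U \<and> |X| <o \<tau>}| <o L)"

lemma ordLess_card_of_underS:
  assumes "Card_order r" "|X| <o r"
  shows "\<exists>a \<in> Field r. |X| =o |underS r a|"
proof -
  have W: "Well_order r" "Well_order |X|"
    using assms(1) card_of_Well_order by (auto simp: card_order_on_def)
  then obtain a where a: "a \<in> Field r" "|X| =o Restr r (underS r a)"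
    using ordLess_iff_ordIso_Restr assms(2) by blast
  have "Field (Restr r (underS r a)) = underS r a"
    using W(1) by (intro Field_Restr_ofilter) (simp_all add: wo_rel_def wo_rel.underS_ofilter)
  then have "|X| =o |underS r a|"
    using card_of_cong[OF a(2)] by (simp add: Field_card_of)
  then show ?thesis using a(1) by blast
qed

lemma ordLess_card_of_inj:
  fixes r :: "'a rel"
  assumes "Card_order r" "|X| <o r"
  obtains g :: "'b \<Rightarrow> 'a" where "inj_on g X" "g ` X \<subseteq> Field r"
proof -
  have "|X| \<le>o |Field r|"
    using assms card_of_Field_ordIso[of r] ordIso_symmetric ordLeq_ordIso_trans ordLess_imp_ordLeq
    by blast
  then show thesis
    using that by (metis card_of_ordLeq)
qed

lemma card_of_eq_image: "inj_on g X \<Longrightarrow> |g ` X| =o |X|"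
  using card_of_ordIsoI[of g X "g ` X"] ordIso_symmetric by (auto simp: bij_betw_def)

text \<open>\<open>small_powers\<close> speaks of subsets of \<open>Field L\<close> only, because a
  predicate cannot quantify over types; an injection carries the count to sets of any type.\<close>

lemma small_powers_transfer:
  assumes sp: "small_powers L \<tau>" and L: "Card_order L" and U: "|U| <o L"
  shows "|{X. X \<subseteq> U \<and> |X| <o \<tau>}| <o L"
proof -
  obtain g where g: "inj_on g U" "g ` U \<subseteq> Field L"
    using ordLess_card_of_inj[OF L U] .
  have "|{X. X \<subseteq> U \<and> |X| <o \<tau>}| \<le>o |{X. X \<subseteq> g ` U \<and> |X| <o \<tau>}|"
  proof (rule iffD1[OF card_of_ordLeq], intro exI[of _ "image g"] conjI)
    show "inj_on (image g) {X. X \<subseteq> U \<and> |X| <o \<tau>}"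
      using inj_on_image_Pow[OF g(1)] by (rule inj_on_subset) auto
    show "image g ` {X. X \<subseteq> U \<and> |X| <o \<tau>} \<subseteq> {X. X \<subseteq> g ` U \<and> |X| <o \<tau>}"
      using small_image by blast
  qed
  moreover have "|{X. X \<subseteq> g ` U \<and> |X| <o \<tau>}| <o L"
    using sp g(2) small_image[OF U] unfolding small_powers_def by blast
  ultimately show ?thesis
    using ordLeq_ordLess_trans by blast
qed

text \<open>A set smaller than \<open>\<theta>\<close> is enumerated along a proper initial segment
  of \<open>\<theta>\<close>, and the range of the enumeration determines the set;
  \<open>cexp_less\<close> counts the enumerations.\<close>

lemma card_of_small_subsets_le:
  fixes \<mu> :: "'a rel" and \<theta> :: "'t rel"
  assumes \<theta>: "Card_order \<theta>" and \<mu>: "Card_order \<mu>" and U: "|U| \<le>o \<mu>"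
  shows "|{X. X \<subseteq> U \<and> |X| <o \<theta>}| \<le>o cexp_less \<mu> \<theta>"
proof -
  have "|U| \<le>o |Field \<mu>|"
    using U card_of_Field_ordIso[OF \<mu>] ordIso_symmetric ordLeq_ordIso_trans by blast
  then obtain g where g: "inj_on g U" "g ` U \<subseteq> Field \<mu>"
    by (metis card_of_ordLeq)
  define F where "F = {f :: 't \<rightharpoonup> 'a. (\<exists>a \<in> Field \<theta>. dom f = underS \<theta> a) \<and> ran f \<subseteq> Field \<mu>}"
  have "\<exists>f \<in> F. ran f = g ` X" if X: "X \<subseteq> U" "|X| <o \<theta>" for X
  proof -
    obtain a where a: "a \<in> Field \<theta>" "|X| =o |underS \<theta> a|"
      using ordLess_card_of_underS[OF \<theta> X(2)] by blast
    obtain h where h: "bij_betw h (underS \<theta> a) X"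
      using a(2) card_of_ordIso[of "underS \<theta> a" X] ordIso_symmetric by blast
    define f where "f x = (if x \<in> underS \<theta> a then Some (g (h x)) else None)" for x
    have "dom f = underS \<theta> a"
      by (auto simp: f_def split: if_splits)
    moreover have "ran f = (\<lambda>x. g (h x)) ` underS \<theta> a"
      by (auto simp: f_def ran_def)
    moreover have "(\<lambda>x. g (h x)) ` underS \<theta> a = g ` X"
      using h by (auto simp: bij_betw_def)
    moreover have "g ` X \<subseteq> Field \<mu>"
      using g(2) X(1) by blast
    ultimately show ?thesis
      using a(1) by (intro bexI[of _ f]) (auto simp: F_def)
  qed
  then obtain c where c: "\<And>X. X \<subseteq> U \<Longrightarrow> |X| <o \<theta> \<Longrightarrow> c X \<in> F \<and> ran (c X) = g ` X"
    by metis
  have "inj_on c {X. X \<subseteq> U \<and> |X| <o \<theta>}"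
  proof (rule inj_onI)
    fix X Y assume XY: "X \<in> {X. X \<subseteq> U \<and> |X| <o \<theta>}" "Y \<in> {X. X \<subseteq> U \<and> |X| <o \<theta>}" "c X = c Y"
    then have "ran (c X) = g ` X" "ran (c Y) = g ` Y"
      using c by (metis (no_types, lifting) mem_Collect_eq)+
    then have "g ` X = g ` Y" using XY(3) by simp
    then show "X = Y"
      using XY inj_on_image_eq_iff[OF g(1)] by simp
  qed
  then have "|{X. X \<subseteq> U \<and> |X| <o \<theta>}| \<le>o |F|"
    using c by (intro card_of_ordLeqI) auto
  then show ?thesis
    by (simp add: cexp_less_def F_def)
qed

text \<open>The diagonal argument behind Koenig's theorem: \<open>\<sigma>\<close> raised to its cofinality exceeds \<open>\<sigma>\<close>.\<close>

lemma regular_card_of_cexp_less: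
  fixes \<sigma> :: "'s rel"
  assumes \<sigma>: "Card_order \<sigma>" "natLeq \<le>o \<sigma>" and e: "\<sigma> =o cexp_less \<sigma> \<sigma>"
  shows "regular_card \<sigma>"
proof -
  have inf: "\<not> finite (Field \<sigma>)"
    using \<sigma> natLeq_ordLeq_cinfinite unfolding cinfinite_def
    by (metis card_of_Field_ordIso card_of_Field_natLeq card_of_ordLeq_infinite cinfinite_def
        cinfinite_mono natLeq_cinfinite)
  have W: "Well_order \<sigma>" using \<sigma>(1) by (simp add: card_order_on_def)
  define F where "F = {f :: 's \<rightharpoonup> 's. (\<exists>a \<in> Field \<sigma>. dom f = underS \<sigma> a) \<and> ran f \<subseteq> Field \<sigma>}"
  have "|Field \<sigma>| =o |F|"
    using e \<sigma>(1) card_of_Field_ordIso ordIso_transitive unfolding cexp_less_def F_def by blast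
  then obtain en where en: "bij_betw en (Field \<sigma>) F"
    using card_of_ordIso by blast
  have "regularCard \<sigma>"
    unfolding regularCard_def
  proof (intro allI impI)
    fix X assume X: "X \<subseteq> Field \<sigma> \<and> cofinal X \<sigma>"
    show "|X| =o \<sigma>"
    proof (rule ccontr)
      assume "\<not> |X| =o \<sigma>"
      then have "|X| <o \<sigma>"
        using card_of_subset_cases[OF \<sigma>(1) card_of_Field_ordIso[OF \<sigma>(1)], of X] X by blast
      then obtain a where a: "a \<in> Field \<sigma>" "|X| =o |underS \<sigma> a|"
        using ordLess_card_of_underS[OF \<sigma>(1)] by blast
      obtain g where g: "bij_betw g (underS \<sigma> a) X"
        using a(2) card_of_ordIso[of "underS \<sigma> a" X] ordIso_symmetric by blast
      \<comment> \<open>The functions listed before \<open>g k\<close> take fewer than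
        \<open>\<sigma>\<close> values at \<open>k\<close>. A value \<open>v k\<close> missed by all
        of them, for each \<open>k\<close>, gives a function that differs from every listed one,
        because \<open>X\<close> is cofinal.\<close>
      have "\<exists>v \<in> Field \<sigma>. \<forall>i \<in> underS \<sigma> (g k). en i k \<noteq> Some v" if k: "k \<in> underS \<sigma> a" for k
      proof (rule ccontr)
        assume "\<not> ?thesis"
        then have "Field \<sigma> \<subseteq> (\<lambda>i. the (en i k)) ` underS \<sigma> (g k)"
          by (force simp: image_iff)
        moreover have "|underS \<sigma> (g k)| <o \<sigma>"
          using g k X by (intro card_of_underS[OF \<sigma>(1)]) (auto simp: bij_betw_def)
        ultimately have "|Field \<sigma>| <o \<sigma>"
          using small_image small_subset by blast
        then show False
          using card_of_Field_ordIso[OF \<sigma>(1)] not_ordLess_ordIso by blast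
      qed
      then obtain v where v: "\<And>k. k \<in> underS \<sigma> a \<Longrightarrow> v k \<in> Field \<sigma>"
          "\<And>k i. k \<in> underS \<sigma> a \<Longrightarrow> i \<in> underS \<sigma> (g k) \<Longrightarrow> en i k \<noteq> Some (v k)"
        by metis
      define f where "f k = (if k \<in> underS \<sigma> a then Some (v k) else None)" for k
      have "dom f = underS \<sigma> a" "ran f \<subseteq> Field \<sigma>"
        using v(1) by (auto simp: f_def ran_def split: if_splits)
      then have "f \<in> F" using a(1) by (auto simp: F_def)
      then obtain i where i: "i \<in> Field \<sigma>" "f = en i"
        using en by (auto simp: bij_betw_def)
      then obtain b where "b \<in> X" "i \<noteq> b" "(i, b) \<in> \<sigma>"
        using X by (auto simp: cofinal_def)
      then obtain k where "k \<in> underS \<sigma> a" "i \<in> underS \<sigma> (g k)"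
        using g by (auto simp: bij_betw_def underS_def)
      then show False
        using v(2) i(2) by (metis f_def)
    qed
  qed
  then show ?thesis
    using \<sigma>(1) inf regularCard_stable by (auto simp: regular_card_def)
qed

text \<open>A short cofinal subset of \<open>\<kappa>\<close> would cut a cofinal sequence of
  \<open>lam\<close> into fewer than \<open>\<kappa>\<close> parts with fewer than
  \<open>\<kappa>\<close> terms each. Every part is bounded, and so is the set of the bounds. The
  enumeration \<open>e\<close> need not be increasing, which is why each part receives a bound
  \<open>u x\<close> of its own.\<close>

lemma regular_card_cofinality:
  fixes lam :: "'l rel" and \<kappa> :: "'k rel"
  assumes lam: "Card_order lam" and \<kappa>: "Card_order \<kappa>" "natLeq \<le>o \<kappa>" and cf: "has_cofinality lam \<kappa>"
  shows "regular_card \<kappa>"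
proof -
  have inf: "\<not> finite (Field \<kappa>)"
    using \<kappa> natLeq_ordLeq_cinfinite unfolding cinfinite_def
    by (metis card_of_Field_ordIso card_of_Field_natLeq card_of_ordLeq_infinite cinfinite_def
        cinfinite_mono natLeq_cinfinite)
  have W: "Well_order lam" "Well_order \<kappa>" using lam \<kappa>(1) by (simp_all add: card_order_on_def)
  obtain A where A: "A \<subseteq> Field lam" "cofinal A lam" "|A| =o \<kappa>"
      and least: "\<And>B. B \<subseteq> Field lam \<Longrightarrow> cofinal B lam \<Longrightarrow> \<kappa> \<le>o |B|"
    using cf by (auto simp: has_cofinality_def)
  have bdd: "\<exists>u \<in> Field lam. \<forall>b \<in> B. \<not> u \<in> underS lam b" if B: "B \<subseteq> Field lam" "|B| <o \<kappa>" for B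
  proof -
    have "\<not> cofinal B lam"
      using least[OF B(1)] B(2) not_ordLess_ordLeq by blast
    then show ?thesis
      by (auto simp: cofinal_def underS_def)
  qed
  have "|Field \<kappa>| =o |A|"
    using A(3) \<kappa>(1) card_of_Field_ordIso ordIso_symmetric ordIso_transitive by blast
  then obtain e where e: "bij_betw e (Field \<kappa>) A"
    using card_of_ordIso by blast
  have "regularCard \<kappa>"
    unfolding regularCard_def
  proof (intro allI impI)
    fix X assume X: "X \<subseteq> Field \<kappa> \<and> cofinal X \<kappa>"
    show "|X| =o \<kappa>"
    proof (rule ccontr)
      assume "\<not> |X| =o \<kappa>"
      then have Xs: "|X| <o \<kappa>"
        using card_of_subset_cases[OF \<kappa>(1) card_of_Field_ordIso[OF \<kappa>(1)], of X] X by blast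
      have *: "\<exists>u \<in> Field lam. \<forall>b \<in> e ` underS \<kappa> x. \<not> u \<in> underS lam b" if "x \<in> X" for x
      proof (rule bdd)
        show "e ` underS \<kappa> x \<subseteq> Field lam"
        proof
          fix b assume "b \<in> e ` underS \<kappa> x"
          then obtain i where "b = e i" "i \<in> Field \<kappa>"
            using underS_FieldD by fastforce
          then show "b \<in> Field lam"
            using bij_betwE[OF e] A(1) by blast
        qed
        show "|e ` underS \<kappa> x| <o \<kappa>"
          using card_of_underS[OF \<kappa>(1)] X that by (intro small_image) auto
      qed
      define u where "u x = (SOME u. u \<in> Field lam \<and> (\<forall>b \<in> e ` underS \<kappa> x. \<not> u \<in> underS lam b))" for x
      have "u x \<in> Field lam \<and> (\<forall>b \<in> e ` underS \<kappa> x. \<not> u x \<in> underS lam b)" if "x \<in> X" for x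
        using *[OF that] unfolding u_def Bex_def by (rule someI_ex)
      then have u: "u x \<in> Field lam" "\<And>i. i \<in> underS \<kappa> x \<Longrightarrow> u x \<notin> underS lam (e i)"
        if "x \<in> X" for x
        using that by blast+
      obtain w where w: "w \<in> Field lam" "\<And>x. x \<in> X \<Longrightarrow> w \<notin> underS lam (u x)"
        using bdd[of "u ` X"] u(1) small_image[OF Xs] by blast
      obtain a where a: "a \<in> A" "w \<in> underS lam a"
        using A(2) w(1) by (auto simp: cofinal_def underS_def)
      obtain i where i: "i \<in> Field \<kappa>" "a = e i"
        using e a(1) by (auto simp: bij_betw_def)
      obtain x where x: "x \<in> X" "i \<in> underS \<kappa> x"
        using X i(1) by (auto simp: cofinal_def underS_def)
      have "u x \<notin> underS lam a" using u(2) x i by blast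
      then have "a = u x \<or> a \<in> underS lam (u x)"
        using underS_total[OF W(1), of a "u x"] a(1) A(1) u(1) x(1) by blast
      then show False
        using w(2)[OF x(1)] a(2) underS_trans[OF W(1)] by blast
    qed
  qed
  then show ?thesis
    using \<kappa>(1) inf regularCard_stable by (auto simp: regular_card_def)
qed

lemma cofinality_bounded:
  fixes lam :: "'l rel" and \<kappa> :: "'k rel"
  assumes lam: "Card_order lam" "\<not> finite (Field lam)" and cf: "has_cofinality lam \<kappa>"
    and B: "B \<subseteq> Field lam" "|B| <o \<kappa>"
  shows "\<exists>u \<in> Field lam. B \<subseteq> underS lam u"
proof -
  have W: "Well_order lam" using lam(1) by (simp add: card_order_on_def)
  have "\<not> cofinal B lam"
    using cf B not_ordLess_ordLeq by (auto simp: has_cofinality_def)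
  then obtain u where u: "u \<in> Field lam" "\<And>b. b \<in> B \<Longrightarrow> u \<notin> underS lam b"
    by (auto simp: cofinal_def underS_def)
  \<comment> \<open>Failing to be cofinal gives only a weak bound \<open>u\<close>; a strict one
    exists because an infinite cardinal has no last element.\<close>
  obtain v where "v \<in> Field lam" "u \<noteq> v" "(u, v) \<in> lam"
    using infinite_Card_order_limit[OF lam u(1)] by blast
  then have v: "v \<in> Field lam" "u \<in> underS lam v"
    by (auto simp: underS_def)
  have "b \<in> underS lam v" if "b \<in> B" for b
    using underS_total[OF W, of b u] u that B(1) v underS_trans[OF W] by blast
  then show ?thesis using v(1) by blast
qed

lemma regular_card_cardSuc:
  assumes "Card_order r" "\<not> finite (Field r)"
  shows "regular_card (cardSuc r)"
proof -
  have "Cinfinite (cardSuc r)"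
    using assms by (intro Cinfinite_cardSuc) (auto simp: cinfinite_def)
  then show ?thesis
    using infinite_cardSuc_regularCard[OF assms(2,1)] regularCard_stable
    by (auto simp: regular_card_def cinfinite_def)
qed

text \<open>A set smaller than \<open>cardSuc \<sigma>\<close> has at most \<open>\<sigma>\<close>
  elements, and the assumption on \<open>cexp_less\<close> leaves it at most \<open>\<sigma>\<close>
  subsets smaller than \<open>\<sigma>\<close>. This is the counting behind the chain
  condition.\<close>

lemma small_powers_cardSuc:
  fixes \<sigma> :: "'s rel"
  assumes \<sigma>: "Card_order \<sigma>" and e: "\<sigma> =o cexp_less \<sigma> \<sigma>"
  shows "small_powers (cardSuc \<sigma>) \<sigma>"
  unfolding small_powers_def
proof (intro allI impI)
  fix U assume "U \<subseteq> Field (cardSuc \<sigma>)" "|U| <o cardSuc \<sigma>"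
  then have "|U| \<le>o \<sigma>"
    using cardSuc_ordLeq_ordLess[OF \<sigma> card_of_Card_order] by blast
  then have "|{X. X \<subseteq> U \<and> |X| <o \<sigma>}| \<le>o \<sigma>"
    using card_of_small_subsets_le[OF \<sigma> \<sigma>] e ordIso_symmetric ordLeq_ordIso_trans by blast
  then show "|{X. X \<subseteq> U \<and> |X| <o \<sigma>}| <o cardSuc \<sigma>"
    using cardSuc_greater[OF \<sigma>] ordLeq_ordLess_trans by blast
qed

lemma card_of_Pow_mono: "|A| \<le>o |B| \<Longrightarrow> |Pow A| \<le>o |Pow B|"
  by (metis card_of_ordLeq image_Pow_mono inj_on_image_Pow)

lemma card_of_Pow_eqI: "|A| =o |B| \<Longrightarrow> |Pow A| =o |Pow B|"
  by (simp add: card_of_Pow_mono ordIso_iff_ordLeq)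

text \<open>This is the identity that \<open>|Pow D|\<close> to the power \<open>|D|\<close> is
  \<open>|Pow D|\<close>: at most \<open>|D|\<close> many subsets of \<open>D\<close> are the rows
  of one subset of \<open>D \<times> D\<close>. It admits Delta-systems of sets of size
  \<open>|D|\<close> over \<open>cardSuc |Pow D|\<close> many indices.\<close>

lemma small_powers_cardSuc_Pow:
  fixes D :: "'d set"
  assumes D: "\<not> finite D"
  shows "small_powers (cardSuc |Pow D| ) (cardSuc |D| )"
  unfolding small_powers_def
proof (intro allI impI)
  fix U :: "'d set set set" assume "|U| <o cardSuc |Pow D|"
  then have "|U| \<le>o |Pow D|"
    using cardSuc_ordLeq_ordLess[OF card_of_Card_order card_of_Card_order] by blast
  then obtain g where g: "inj_on g U" "g ` U \<subseteq> Pow D"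
    by (metis card_of_ordLeq)
  have "\<exists>h. h ` D = X" if X: "X \<noteq> {}" "|X| <o cardSuc |D|" for X :: "'d set set set"
  proof -
    have "|X| \<le>o |D|"
      using X cardSuc_ordLeq_ordLess[OF card_of_Card_order card_of_Card_order] by blast
    then show ?thesis
      using card_of_ordLeq2[OF X(1)] by blast
  qed
  then obtain h where h: "\<And>X. X \<noteq> {} \<Longrightarrow> |X| <o cardSuc |D| \<Longrightarrow> h X ` D = (X :: 'd set set set)"
    by metis
  define c where "c X = {(d, y). d \<in> D \<and> y \<in> g (h X d)}" for X
  \<comment> \<open>The empty set is not an image of \<open>D\<close>; it is added back as a single
    extra element at the end.\<close>
  let ?S = "{X. X \<subseteq> U \<and> |X| <o cardSuc |D| \<and> X \<noteq> {}}"
  have sub: "h X d \<in> U" if "X \<in> ?S" "d \<in> D" for X d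
    using h[of X] that by blast
  have "inj_on c ?S"
  proof (rule inj_onI)
    fix X Y assume XY: "X \<in> ?S" "Y \<in> ?S" "c X = c Y"
    have "h X d = h Y d" if d: "d \<in> D" for d
    proof -
      have "g (h X d) = {y. (d, y) \<in> c X}" "g (h Y d) = {y. (d, y) \<in> c Y}"
        using d by (auto simp: c_def)
      then have "g (h X d) = g (h Y d)" using XY(3) by simp
      then show ?thesis
        by (rule inj_onD[OF g(1) _ sub[OF XY(1) d] sub[OF XY(2) d]])
    qed
    then have "h X ` D = h Y ` D"
      by (rule image_cong[OF refl])
    moreover have "h X ` D = X" "h Y ` D = Y"
      using h XY(1,2) by auto
    ultimately show "X = Y" by simp
  qed
  moreover have "c ` ?S \<subseteq> Pow (D \<times> D)"
  proof -
    have "y \<in> D" if "X \<in> ?S" "d \<in> D" "y \<in> g (h X d)" for X d y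
      using sub[OF that(1,2)] g(2) that(3) by blast
    then show ?thesis by (auto simp: c_def)
  qed
  ultimately have "|?S| \<le>o |Pow (D \<times> D)|"
    by (intro card_of_ordLeqI) auto
  also have "|Pow (D \<times> D)| =o |Pow D|"
    using D by (intro card_of_Pow_eqI card_of_Times_same_infinite)
  finally have 1: "|?S| <o cardSuc |Pow D|"
    using cardSuc_greater[OF card_of_Card_order] ordLeq_ordLess_trans by blast
  have reg: "regular_card (cardSuc |Pow D| )"
    using D by (intro regular_card_cardSuc) (auto simp: Field_card_of card_of_card_order_on)
  have "|{{}} \<union> ?S| <o cardSuc |Pow D|"
    using 1 by (intro regular_small_Un reg regular_small_singleton)
  then show "|{X. X \<subseteq> U \<and> |X| <o cardSuc |D| }| <o cardSuc |Pow D|"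
    by (rule small_subset) auto
qed

section \<open>Cohen conditions\<close>

definition agree :: "('a \<rightharpoonup> 'b) \<Rightarrow> ('a \<rightharpoonup> 'b) \<Rightarrow> bool"
  where "agree p q \<longleftrightarrow> (\<forall>x \<in> dom p \<inter> dom q. p x = q x)"

text \<open>The union of a family of conditions. Where members overlap, one of them is chosen to
  supply the value, so the domain is the union of the domains even without agreement.\<close>

definition Glue :: "('a \<rightharpoonup> 'b) set \<Rightarrow> 'a \<rightharpoonup> 'b"
  where "Glue S = (\<lambda>x. if \<exists>p \<in> S. x \<in> dom p then (SOME p. p \<in> S \<and> x \<in> dom p) x else None)"

lemma agree_refl: "agree p p"
  by (simp add: agree_def)

lemma agree_sym: "agree p q \<Longrightarrow> agree q p"
  by (auto simp: agree_def)

lemma agree_if_le: "p \<subseteq>\<^sub>m r \<Longrightarrow> q \<subseteq>\<^sub>m r \<Longrightarrow> agree p q"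
  by (auto simp: agree_def map_le_def)

lemma agree_mono: "agree p q \<Longrightarrow> p' \<subseteq>\<^sub>m p \<Longrightarrow> q' \<subseteq>\<^sub>m q \<Longrightarrow> agree p' q'"
  unfolding agree_def map_le_def by (metis IntD1 IntD2 IntI domIff)

lemma dom_Glue: "dom (Glue S) = (\<Union>p \<in> S. dom p)"
proof -
  have "Glue S x \<noteq> None \<longleftrightarrow> (\<exists>p \<in> S. x \<in> dom p)" for x
  proof (cases "\<exists>p \<in> S. x \<in> dom p")
    case True
    then have "\<exists>p. p \<in> S \<and> x \<in> dom p" by blast
    then have "(SOME p. p \<in> S \<and> x \<in> dom p) \<in> S \<and> x \<in> dom (SOME p. p \<in> S \<and> x \<in> dom p)"
      by (rule someI_ex)
    then show ?thesis using True by (auto simp: Glue_def)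
  qed (auto simp: Glue_def)
  then show ?thesis by (auto simp: dom_def)
qed

lemma le_Glue:
  assumes "\<And>p q. p \<in> S \<Longrightarrow> q \<in> S \<Longrightarrow> agree p q" "p \<in> S"
  shows "p \<subseteq>\<^sub>m Glue S"
  unfolding map_le_def
proof
  fix x assume x: "x \<in> dom p"
  then have "\<exists>p. p \<in> S \<and> x \<in> dom p" using assms(2) by blast
  then have s: "(SOME p. p \<in> S \<and> x \<in> dom p) \<in> S \<and> x \<in> dom (SOME p. p \<in> S \<and> x \<in> dom p)"
    by (rule someI_ex)
  then have "p x = (SOME p. p \<in> S \<and> x \<in> dom p) x"
    using assms(1)[OF assms(2), of "SOME p. p \<in> S \<and> x \<in> dom p"] x unfolding agree_def by blast
  then show "p x = Glue S x"
    using x assms(2) by (auto simp: Glue_def)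
qed

lemma big_minus_small:
  assumes "|M| =o L" "|S| <o L"
  obtains a where "a \<in> M" "a \<notin> S"
proof -
  have "\<not> M \<subseteq> S"
  proof
    assume "M \<subseteq> S"
    then have "|M| <o L" using assms(2) small_subset by metis
    then show False using assms(1) not_ordLess_ordIso by metis
  qed
  then show thesis using that by auto
qed

text \<open>The values agree on the root because the set of points of the root with value
  \<open>True\<close> is made constant.\<close>

lemma delta_system_conditions:
  fixes L :: "'l rel" and q :: "'a \<Rightarrow> ('u \<rightharpoonup> bool)"
  assumes L: "regular_card L" and A: "|A| =o L" and t: "regular_card \<tau>" "\<tau> <o L"
    and q: "\<And>a. a \<in> A \<Longrightarrow> |dom (q a)| <o \<tau>"
    and sp: "small_powers L \<tau>"
  shows "\<exists>M \<subseteq> A. |M| =o L \<and> (\<exists>r. \<forall>a \<in> M. r \<subseteq>\<^sub>m q a \<and>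
    (\<forall>b \<in> M. a \<noteq> b \<longrightarrow> dom (q a) \<inter> dom (q b) = dom r))"
proof -
  have LC: "Card_order L" using L by (simp add: regular_card_def)
  have "|{X. X \<subseteq> U \<and> |X| <o \<tau>}| <o L" if "|U| <o L" for U :: "'l set"
    using small_powers_transfer[OF sp LC that] .
  then have "\<exists>M \<subseteq> A. |M| =o L \<and> (\<exists>R. \<forall>a \<in> M. R \<subseteq> dom (q a) \<and>
      (\<forall>b \<in> M. a \<noteq> b \<longrightarrow> dom (q a) \<inter> dom (q b) = R))"
    using q by (intro delta_system[OF L A t]) auto
  then obtain M R where M: "M \<subseteq> A" "|M| =o L"
      and RR: "\<forall>a \<in> M. R \<subseteq> dom (q a) \<and> (\<forall>b \<in> M. a \<noteq> b \<longrightarrow> dom (q a) \<inter> dom (q b) = R)"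
    by (elim exE conjE) (rule that)
  have R: "a \<in> M \<Longrightarrow> R \<subseteq> dom (q a)"
      "a \<in> M \<Longrightarrow> b \<in> M \<Longrightarrow> a \<noteq> b \<Longrightarrow> dom (q a) \<inter> dom (q b) = R" for a b
    using RR by auto
  obtain a0 where a0: "a0 \<in> M"
    using big_minus_small[OF M(2) regular_small_singleton[OF L]] .
  then have Rs: "|R| <o \<tau>"
    using R(1) q M(1) small_subset by blast
  have "|{X. X \<subseteq> R \<and> |X| <o \<tau>}| <o L"
    using Rs t(2) ordLess_transitive by (intro small_powers_transfer[OF sp LC]) blast
  moreover have "(\<lambda>a. {x \<in> R. q a x = Some True}) ` M \<subseteq> {X. X \<subseteq> R \<and> |X| <o \<tau>}"
    using small_subset[OF Rs] by auto
  ultimately have "|(\<lambda>a. {x \<in> R. q a x = Some True}) ` M| <o L"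
    by (rule small_subset)
  from pigeonhole_regular[OF L M(2) this]
  obtain T where T: "|{a \<in> M. {x \<in> R. q a x = Some True} = T}| =o L"
    by (elim exE) (rule that)
  define M' where "M' = {a \<in> M. {x \<in> R. q a x = Some True} = T}"
  define r where "r = (\<lambda>x. if x \<in> R then Some (x \<in> T) else None)"
  have r: "dom r = R" by (auto simp: r_def split: if_splits)
  have "r \<subseteq>\<^sub>m q a" if a: "a \<in> M'" for a
    unfolding map_le_def
  proof
    fix x assume x: "x \<in> dom r"
    then have "x \<in> R" by (simp add: r)
    moreover have "a \<in> M" "{x \<in> R. q a x = Some True} = T" using a by (auto simp: M'_def)
    moreover obtain v where "q a x = Some v" using calculation R(1) by blast
    ultimately show "r x = q a x" by (cases v) (auto simp: r_def)
  qed
  moreover have "\<forall>a \<in> M'. \<forall>b \<in> M'. a \<noteq> b \<longrightarrow> dom (q a) \<inter> dom (q b) = dom r"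
    using R(2) r by (auto simp: M'_def)
  ultimately show ?thesis
    using T M(1) by (intro exI[of _ M']) (auto simp: M'_def)
qed

locale cohen_forcing =
  fixes \<sigma> :: "'s rel" and \<nu> :: "'n rel"
  assumes sigma_card: "Card_order \<sigma>" and sigma_inf: "natLeq \<le>o \<sigma>"
    and sigma_exp: "\<sigma> =o cexp_less \<sigma> \<sigma>"
begin

abbreviation "P \<equiv> cohen \<nu> \<sigma>"

lemma sigma_regular: "regular_card \<sigma>"
  using regular_card_of_cexp_less sigma_card sigma_inf sigma_exp by blast

text \<open>Regularity of \<open>\<sigma>\<close> keeps the union small. Together with
  \<open>le_Glue\<close> this gives a common extension of fewer than \<open>\<sigma>\<close>
  conditions that agree in pairs. That is more than closure under chains, and
  \<open>red_pair\<close> needs it in this strength.\<close>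

lemma Glue_in_P:
  assumes "S \<subseteq> P" "|S| <o \<sigma>"
  shows "Glue S \<in> P"
proof -
  have "|\<Union>p \<in> S. dom p| <o \<sigma>"
    using assms by (intro regular_small_UN[OF sigma_regular]) (auto simp: cohen_def)
  then show ?thesis
    using assms(1) by (auto simp: cohen_def dom_Glue)
qed

lemma common_extension:
  assumes "p \<in> P" "q \<in> P" "agree p q"
  obtains r where "r \<in> P" "p \<subseteq>\<^sub>m r" "q \<subseteq>\<^sub>m r" "dom r = dom p \<union> dom q"
proof
  have "|{p} \<union> {q}| <o \<sigma>"
    by (intro regular_small_Un regular_small_singleton sigma_regular)
  then show "Glue {p, q} \<in> P"
    using assms by (intro Glue_in_P) (auto simp: insert_commute)
  have "\<And>x y. x \<in> {p, q} \<Longrightarrow> y \<in> {p, q} \<Longrightarrow> agree x y"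
    using assms(3) agree_sym agree_refl by auto
  then show "p \<subseteq>\<^sub>m Glue {p, q}" "q \<subseteq>\<^sub>m Glue {p, q}"
    by (auto intro: le_Glue)
qed (simp add: dom_Glue)

lemma submap_in_P: "q \<in> P \<Longrightarrow> p \<subseteq>\<^sub>m q \<Longrightarrow> p \<in> P"
  using map_le_implies_dom_le small_subset by (fastforce simp: cohen_def)

text \<open>From \<open>cardSuc \<sigma>\<close> many conditions one can extract a Delta-system
  whose members all extend one condition on the root; any two of its members agree.\<close>

lemma antichain_small:
  assumes M: "M \<subseteq> P" "pairwise (\<lambda>p q. \<not> agree p q) M"
  shows "|M| \<le>o \<sigma>"
proof (rule ccontr)
  assume "\<not> |M| \<le>o \<sigma>"
  have W: "Well_order \<sigma>" using sigma_card by (simp add: card_order_on_def)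
  have "\<sigma> <o |M|"
    using \<open>\<not> |M| \<le>o \<sigma>\<close> W card_of_Well_order not_ordLeq_iff_ordLess by blast
  then have cM: "cardSuc \<sigma> \<le>o |M|"
    using cardSuc_least[OF sigma_card card_of_Card_order] by blast
  define L where "L = cardSuc \<sigma>"
  have inf: "\<not> finite (Field \<sigma>)" using sigma_regular by (simp add: regular_card_def)
  have L: "regular_card L"
    unfolding L_def by (intro regular_card_cardSuc sigma_card inf)
  then have LC: "Card_order L" by (simp add: regular_card_def)
  have "|Field L| \<le>o |M|"
    using cM card_of_Field_ordIso[OF LC] ordIso_ordLeq_trans unfolding L_def by blast
  then obtain g where g: "inj_on g (Field L)" "g ` Field L \<subseteq> M"
    by (metis card_of_ordLeq)
  have gL: "|g ` Field L| =o L"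
    using card_of_eq_image[OF g(1)] card_of_Field_ordIso[OF LC] ordIso_transitive by blast
  have "\<exists>N \<subseteq> g ` Field L. |N| =o L \<and> (\<exists>r. \<forall>a \<in> N. r \<subseteq>\<^sub>m a \<and>
      (\<forall>b \<in> N. a \<noteq> b \<longrightarrow> dom a \<inter> dom b = dom r))"
  proof (rule delta_system_conditions[OF L gL sigma_regular, where q = "\<lambda>a. a"])
    show "\<sigma> <o L" using cardSuc_greater[OF sigma_card] by (simp add: L_def)
    show "|dom a| <o \<sigma>" if "a \<in> g ` Field L" for a
      using that g(2) M(1) by (auto simp: cohen_def)
    show "small_powers L \<sigma>"
      using small_powers_cardSuc[OF sigma_card sigma_exp] by (simp add: L_def)
  qed
  then obtain N r where N: "N \<subseteq> g ` Field L" "|N| =o L" and rr: "\<forall>a \<in> N. r \<subseteq>\<^sub>m a \<and>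
      (\<forall>b \<in> N. a \<noteq> b \<longrightarrow> dom a \<inter> dom b = dom r)"
    by (elim exE conjE) (rule that)
  have r: "a \<in> N \<Longrightarrow> r \<subseteq>\<^sub>m a" "a \<in> N \<Longrightarrow> b \<in> N \<Longrightarrow> a \<noteq> b \<Longrightarrow> dom a \<inter> dom b = dom r" for a b
    using rr by auto
  obtain a where a: "a \<in> N"
    using big_minus_small[OF N(2) regular_small_singleton[OF L]] .
  obtain b where b: "b \<in> N" "b \<notin> {a}"
    using big_minus_small[OF N(2) regular_small_singleton[OF L]] .
  have "agree a b"
    using r(1)[OF a] r(1)[OF b(1)] r(2)[OF a b(1)] b(2) unfolding agree_def map_le_def
    by (metis singletonI)
  moreover have "\<not> agree a b"
    using M(2) N(1) g(2) a b unfolding pairwise_def by (metis singletonI subsetD)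
  ultimately show False by blast
qed

text \<open>Choose a maximal antichain in the domain of \<open>E\<close>, and one value for each of its members.\<close>

lemma mixing:
  assumes "\<And>x p. E x p \<Longrightarrow> p \<in> P"
  shows "\<exists>H. (\<forall>x p q. H x p \<longrightarrow> q \<in> P \<longrightarrow> p \<subseteq>\<^sub>m q \<longrightarrow> H x q) \<and>
    (\<forall>x y p. H x p \<longrightarrow> H y p \<longrightarrow> x = y) \<and>
    (\<forall>x p. H x p \<longrightarrow> p \<in> P \<and> (\<exists>m \<in> P. E x m \<and> m \<subseteq>\<^sub>m p)) \<and>
    (\<forall>p \<in> P. (\<exists>x q. E x q \<and> p \<subseteq>\<^sub>m q) \<longrightarrow> (\<exists>x q. H x q \<and> p \<subseteq>\<^sub>m q))"
proof -
  obtain M where M: "M \<subseteq> {p. \<exists>x. E x p}" "pairwise (\<lambda>p q. \<not> agree p q) M"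
      "\<And>p. (\<exists>x. E x p) \<Longrightarrow> (\<forall>q \<in> M. \<not> agree p q \<and> \<not> agree q p) \<Longrightarrow> p \<in> M"
    using ex_maximal_pairwise[of "{p. \<exists>x. E x p}" "\<lambda>p q. \<not> agree p q"] by auto
  define v where "v m = (SOME x. E x m)" for m
  have v: "E (v m) m" if "m \<in> M" for m
    using M(1) that unfolding v_def by (auto intro: someI)
  define H where "H x p \<longleftrightarrow> p \<in> P \<and> (\<exists>m \<in> M. v m = x \<and> m \<subseteq>\<^sub>m p)" for x p
  have "H x q" if "H x p" "q \<in> P" "p \<subseteq>\<^sub>m q" for x p q
    using that map_le_trans unfolding H_def by blast
  moreover have "x = y" if h: "H x p" "H y p" for x y p
  proof -
    obtain m n where mn: "m \<in> M" "v m = x" "m \<subseteq>\<^sub>m p" "n \<in> M" "v n = y" "n \<subseteq>\<^sub>m p"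
      using h unfolding H_def by blast
    then have "agree m n" using agree_if_le by blast
    then have "m = n" using M(2) mn unfolding pairwise_def by blast
    then show ?thesis using mn by simp
  qed
  moreover have "p \<in> P \<and> (\<exists>m \<in> P. E x m \<and> m \<subseteq>\<^sub>m p)" if "H x p" for x p
    using that v assms unfolding H_def by blast
  moreover have "\<exists>x q. H x q \<and> p \<subseteq>\<^sub>m q" if p: "p \<in> P" and e: "E x q" "p \<subseteq>\<^sub>m q" for p x q
  proof -
    have q: "q \<in> P" using assms e(1) .
    obtain m where m: "m \<in> M" "agree q m"
      using M(3)[of q] e(1) agree_sym agree_refl by blast
    have "m \<in> P" using m(1) v assms by blast
    obtain r where r: "r \<in> P" "q \<subseteq>\<^sub>m r" "m \<subseteq>\<^sub>m r"
      using common_extension[OF q \<open>m \<in> P\<close> m(2)] .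
    have "H (v m) r" using m(1) r by (auto simp: H_def)
    moreover have "p \<subseteq>\<^sub>m r" using map_le_trans[OF e(2) r(2)] .
    ultimately show ?thesis by blast
  qed
  ultimately show ?thesis
    by (intro exI[of _ H]) blast
qed

text \<open>The chain condition allows a maximal antichain to be listed, with repetitions, along
  \<open>\<sigma>\<close>, so that the antichains of all pairs share one index set. The flag
  \<open>ok\<close> tells whether \<open>E\<close> holds anywhere; if not, the list is filled with
  the empty condition.\<close>

lemma enumerated_antichain:
  assumes "\<And>p. E p \<Longrightarrow> p \<in> P"
  shows "\<exists>(ok :: bool) (m :: 's \<Rightarrow> _). (\<forall>z. m z \<in> P) \<and> (ok \<longrightarrow> (\<forall>z. E (m z))) \<and>
    (\<forall>p. E p \<longrightarrow> ok \<and> (\<exists>z \<in> Field \<sigma>. agree p (m z)))"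
proof (cases "\<exists>p. E p")
  case True
  obtain M where M: "M \<subseteq> {p. E p}" "pairwise (\<lambda>p q. \<not> agree p q) M"
      "\<And>p. E p \<Longrightarrow> (\<forall>q \<in> M. \<not> agree p q \<and> \<not> agree q p) \<Longrightarrow> p \<in> M"
    using ex_maximal_pairwise[of "{p. E p}" "\<lambda>p q. \<not> agree p q"] by auto
  have Mne: "M \<noteq> {}"
    using M(3) True by blast
  have "|M| \<le>o \<sigma>"
    using M(1,2) assms by (intro antichain_small) auto
  then have "|M| \<le>o |Field \<sigma>|"
    using card_of_Field_ordIso[OF sigma_card] ordIso_symmetric ordLeq_ordIso_trans by blast
  then obtain m0 where m0: "m0 ` Field \<sigma> = M"
    by (metis card_of_ordLeq2[OF Mne])
  obtain c where c: "c \<in> M" using Mne by blast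
  define m where "m z = (if z \<in> Field \<sigma> then m0 z else c)" for z
  have mM: "m z \<in> M" for z using m0 c by (auto simp: m_def)
  have "\<exists>z \<in> Field \<sigma>. agree p (m z)" if Ep: "E p" for p
  proof -
    obtain q where "q \<in> M" "agree p q"
      using M(3)[OF Ep] agree_sym agree_refl by blast
    then show ?thesis
      using m0 by (auto simp: m_def)
  qed
  then show ?thesis
    using mM M(1) assms by (intro exI[of _ True] exI[of _ m]) blast
next
  case False
  have "Map.empty \<in> P"
    using regular_small_singleton[OF sigma_regular] small_subset by (fastforce simp: cohen_def)
  then show ?thesis
    using False by (intro exI[of _ False] exI[of _ "\<lambda>_. Map.empty"]) auto
qed

end

section \<open>Green sequences and their greedy construction\<close>

locale cohen_coloring = cohen_forcing \<sigma> \<nu> for \<sigma> :: "'s rel" and \<nu> :: "'n rel" +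
  fixes lam :: "'l rel" and \<theta> :: "'t rel" and Gr :: "'l \<Rightarrow> 'l \<Rightarrow> ('n \<times> 's \<rightharpoonup> bool) \<Rightarrow> bool"
  assumes lam_card: "Card_order lam"
    and theta_card: "Card_order \<theta>" and theta_le: "\<theta> \<le>o \<sigma>"
    and Gr_P: "Gr a b p \<Longrightarrow> p \<in> P"
    and Gr_open: "Gr a b p \<Longrightarrow> q \<in> P \<Longrightarrow> p \<subseteq>\<^sub>m q \<Longrightarrow> Gr a b q"
begin

lemma lam_wo: "Well_order lam" and theta_wo: "Well_order \<theta>"
  using lam_card theta_card by (simp_all add: card_order_on_def)

text \<open>\<open>H\<close> acts as a name, below \<open>p\<close>, for an increasing green
  sequence of length \<open>\<theta>\<close> under \<open>b\<close>; \<open>H \<xi> a q\<close>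
  means that \<open>q\<close> decides the entry at \<open>\<xi>\<close> to be \<open>a\<close>. With
  \<open>b\<close> on top this is a green set of type \<open>\<theta> + 1\<close>.\<close>

definition green_system :: "'l \<Rightarrow> ('n \<times> 's \<rightharpoonup> bool) \<Rightarrow> ('t \<Rightarrow> 'l \<Rightarrow> ('n \<times> 's \<rightharpoonup> bool) \<Rightarrow> bool) \<Rightarrow> bool"
  where "green_system b p H \<longleftrightarrow>
    (\<forall>\<xi> a q. H \<xi> a q \<longrightarrow> q \<in> P \<and> a \<in> underS lam b \<and> Gr a b q) \<and>
    (\<forall>\<xi> a q r. H \<xi> a q \<longrightarrow> r \<in> P \<longrightarrow> q \<subseteq>\<^sub>m r \<longrightarrow> H \<xi> a r) \<and>
    (\<forall>\<xi> a a' q. H \<xi> a q \<longrightarrow> H \<xi> a' q \<longrightarrow> a = a') \<and>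
    (\<forall>\<xi> \<in> Field \<theta>. \<forall>q \<in> P. p \<subseteq>\<^sub>m q \<longrightarrow> (\<exists>r a. q \<subseteq>\<^sub>m r \<and> H \<xi> a r)) \<and>
    (\<forall>\<xi> \<xi>' a a' q. H \<xi> a q \<longrightarrow> H \<xi>' a' q \<longrightarrow> \<xi> \<in> underS \<theta> \<xi>' \<longrightarrow> a \<in> underS lam a' \<and> Gr a a' q)"

text \<open>Here \<open>f\<close> is a green clique with top \<open>b\<close>, built greedily until no further point
  of \<open>C\<close> can be added by any extension of the condition.\<close>

lemma greedy:
  assumes C: "C \<subseteq> underS lam b" and q0: "q0 \<in> P"
    and no: "\<And>H. \<not> green_system b q0 H"
  shows "\<exists>r f. r \<in> P \<and> q0 \<subseteq>\<^sub>m r \<and> f \<subseteq> C \<and> |f| <o \<theta> \<and> (\<forall>y \<in> f. Gr y b r) \<and>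
    (\<forall>r' a. r' \<in> P \<longrightarrow> r \<subseteq>\<^sub>m r' \<longrightarrow> a \<in> C \<longrightarrow> f \<subseteq> underS lam a \<longrightarrow>
      \<not> ((\<forall>y \<in> f. Gr y a r') \<and> Gr a b r'))"
proof -
  define E where "E f a r \<longleftrightarrow> r \<in> P \<and> a \<in> C \<and> (\<forall>y \<in> ran f. y \<in> underS lam a \<and> Gr y a r) \<and> Gr a b r"
    for f :: "'t \<rightharpoonup> 'l" and a r
  \<comment> \<open>Mixing lets the next point after \<open>f\<close> depend on the generic filter
    and still keeps it unique under each condition.\<close>
  have "\<forall>f. \<exists>H. (\<forall>x p q. H x p \<longrightarrow> q \<in> P \<longrightarrow> p \<subseteq>\<^sub>m q \<longrightarrow> H x q) \<and>
      (\<forall>x y p. H x p \<longrightarrow> H y p \<longrightarrow> x = y) \<and>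
      (\<forall>x p. H x p \<longrightarrow> p \<in> P \<and> (\<exists>m \<in> P. E f x m \<and> m \<subseteq>\<^sub>m p)) \<and>
      (\<forall>p \<in> P. (\<exists>x q. E f x q \<and> p \<subseteq>\<^sub>m q) \<longrightarrow> (\<exists>x q. H x q \<and> p \<subseteq>\<^sub>m q))"
    by (intro allI mixing) (simp add: E_def)
  from choice[OF this] obtain H where H: "\<forall>f. (\<forall>x p q. H f x p \<longrightarrow> q \<in> P \<longrightarrow> p \<subseteq>\<^sub>m q \<longrightarrow> H f x q) \<and>
      (\<forall>x y p. H f x p \<longrightarrow> H f y p \<longrightarrow> x = y) \<and>
      (\<forall>x p. H f x p \<longrightarrow> p \<in> P \<and> (\<exists>m \<in> P. E f x m \<and> m \<subseteq>\<^sub>m p)) \<and>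
      (\<forall>p \<in> P. (\<exists>x q. E f x q \<and> p \<subseteq>\<^sub>m q) \<longrightarrow> (\<exists>x q. H f x q \<and> p \<subseteq>\<^sub>m q))"
    by (elim exE) (rule that)
  have H_open: "H f a q" if "H f a p" "q \<in> P" "p \<subseteq>\<^sub>m q" for f a p q
    using H that by blast
  have H_fun: "a = a'" if "H f a p" "H f a' p" for f a a' p
    using H that by blast
  have H_P: "p \<in> P" if "H f a p" for f a p
    using H that by blast
  have H_E: "E f a p" if Hp: "H f a p" for f a p
  proof -
    obtain m where m: "E f a m" "m \<subseteq>\<^sub>m p" using H Hp by blast
    then show ?thesis
      using H_P[OF Hp] Gr_open[OF _ H_P[OF Hp] m(2)] unfolding E_def by blast
  qed
  have H_dense: "\<exists>a q. H f a q \<and> p \<subseteq>\<^sub>m q" if "p \<in> P" "E f a q" "p \<subseteq>\<^sub>m q" for f a p q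
    using H that by blast
  \<comment> \<open>\<open>Gen q f\<close> says that, according to \<open>q\<close>, each entry of
    \<open>f\<close> is the point chosen after the entries before it. As the choice is unique, two
    such sequences agree on their common part.\<close>
  define Gen where "Gen q f \<longleftrightarrow> q \<in> P \<and> (\<forall>\<eta> a. f \<eta> = Some a \<longrightarrow> H (f |` underS \<theta> \<eta>) a q)" for q f
  have Gen_open: "Gen r f" if "Gen q f" "r \<in> P" "q \<subseteq>\<^sub>m r" for q f r
    using that H_open unfolding Gen_def by blast
  have Gen_eq: "f \<eta> = f' \<eta>" if f: "Gen q f" "dom f = underS \<theta> \<xi>"
      and f': "Gen q f'" "dom f' = underS \<theta> \<xi>'" and "\<eta> \<in> underS \<theta> \<xi>" "\<eta> \<in> underS \<theta> \<xi>'"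
    for q f f' \<xi> \<xi>' \<eta>
    using that(5,6)
  proof (induction \<eta> rule: wf_induct_rule[OF wf_underS[OF theta_wo]])
    case (1 \<eta>)
    have "f l = f' l" if l: "l \<in> underS \<theta> \<eta>" for l
      using 1 l underS_trans[OF theta_wo l] by simp
    then have e: "f |` underS \<theta> \<eta> = f' |` underS \<theta> \<eta>"
      by (auto simp: restrict_map_def)
    obtain a a' where aa: "f \<eta> = Some a" "f' \<eta> = Some a'"
      using f(2) f'(2) 1 by (metis domD)
    then have "H (f |` underS \<theta> \<eta>) a q" "H (f' |` underS \<theta> \<eta>) a' q"
      using f(1) f'(1) unfolding Gen_def by blast+
    then show ?case
      using e aa H_fun by metis
  qed
  show ?thesis
  proof (cases "\<forall>q f. Gen q f \<longrightarrow> q0 \<subseteq>\<^sub>m q \<longrightarrow> (\<exists>\<xi> \<in> Field \<theta>. dom f = underS \<theta> \<xi>) \<longrightarrow>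
      (\<exists>a r. H f a r \<and> q \<subseteq>\<^sub>m r)")
    case True
    define G where "G \<xi> a q \<longleftrightarrow> \<xi> \<in> Field \<theta> \<and> (\<exists>f. dom f = underS \<theta> \<xi> \<and> Gen q f \<and> H f a q)" for \<xi> a q
    have "green_system b q0 G"
      unfolding green_system_def
    proof (intro conjI allI impI ballI)
      fix \<xi> a q assume g: "G \<xi> a q"
      then obtain f where f: "H f a q" by (auto simp: G_def)
      show "q \<in> P" "a \<in> underS lam b" "Gr a b q"
        using H_E[OF f] C by (auto simp: E_def)
    next
      fix \<xi> a q r assume "G \<xi> a q" "r \<in> P" "q \<subseteq>\<^sub>m r"
      then show "G \<xi> a r"
        using Gen_open H_open unfolding G_def by blast
    next
      fix \<xi> a a' q assume g: "G \<xi> a q" "G \<xi> a' q"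
      then obtain f f' where f: "dom f = underS \<theta> \<xi>" "Gen q f" "H f a q"
          and f': "dom f' = underS \<theta> \<xi>" "Gen q f'" "H f' a' q"
        unfolding G_def by blast
      have "f = f'"
      proof
        fix l show "f l = f' l"
        proof (cases "l \<in> underS \<theta> \<xi>")
          case True
          then show ?thesis using Gen_eq[OF f(2,1) f'(2,1)] by blast
        next
          case False
          then show ?thesis using f(1) f'(1) by (metis domIff)
        qed
      qed
      then show "a = a'" using H_fun f f' by blast
    next
      fix \<xi> \<xi>' a a' q assume g: "G \<xi> a q" "G \<xi>' a' q" and less: "\<xi> \<in> underS \<theta> \<xi>'"
      then obtain f f' where f: "dom f = underS \<theta> \<xi>" "Gen q f" "H f a q"
          and f': "dom f' = underS \<theta> \<xi>'" "Gen q f'" "H f' a' q"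
        unfolding G_def by blast
      have sub: "underS \<theta> \<xi> \<subseteq> underS \<theta> \<xi>'"
        using less underS_trans[OF theta_wo] by blast
      have e: "f' |` underS \<theta> \<xi> = f"
      proof
        fix l show "(f' |` underS \<theta> \<xi>) l = f l"
        proof (cases "l \<in> underS \<theta> \<xi>")
          case True
          then show ?thesis using Gen_eq[OF f(2,1) f'(2,1)] sub by auto
        next
          case False
          then show ?thesis using f(1) by (metis domIff restrict_out)
        qed
      qed
      obtain c where c: "f' \<xi> = Some c" using f'(1) less by (metis domD)
      then have "H (f' |` underS \<theta> \<xi>) c q" using f'(2) unfolding Gen_def by blast
      then have "c = a" using e f(3) H_fun by metis
      then have "a \<in> ran f'" using c by (auto simp: ran_def)
      then show "a \<in> underS lam a'" "Gr a a' q"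
        using H_E[OF f'(3)] unfolding E_def by blast+
    next
      fix \<xi> q assume \<xi>: "\<xi> \<in> Field \<theta>" and q: "q \<in> P" "q0 \<subseteq>\<^sub>m q"
      define fn where "fn g \<eta> = (\<lambda>l. if l \<in> underS \<theta> \<eta> then Some (snd (g l)) else None)"
        for g :: "'t \<Rightarrow> ('n \<times> 's \<rightharpoonup> bool) \<times> 'l" and \<eta>
      \<comment> \<open>Density of the entry at \<open>\<xi>\<close>: the sequence is decided one
        index after the other along a chain of conditions extending \<open>q\<close>, each stage
        being a pair of a condition and a point. The union of the earlier conditions is a condition
        because \<open>\<theta> \<le>o \<sigma>\<close>.\<close>
      define Q where "Q g \<eta> x \<longleftrightarrow> (\<eta> \<in> Field \<theta> \<longrightarrow> fst x \<in> P \<and> q \<subseteq>\<^sub>m fst x \<and>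
          (\<forall>l \<in> underS \<theta> \<eta>. fst (g l) \<subseteq>\<^sub>m fst x) \<and> Gen (fst x) (fn g \<eta>) \<and> H (fn g \<eta>) (snd x) (fst x))"
        for g \<eta> x
      have "\<exists>g. \<forall>\<eta>. Q g \<eta> (g \<eta>)"
      proof (rule dependent_wf_choice[OF wf_underS[OF theta_wo]])
        fix f g :: "'t \<Rightarrow> ('n \<times> 's \<rightharpoonup> bool) \<times> 'l" and x s
        assume e: "\<And>z. (z, x) \<in> {(a, b). a \<in> underS \<theta> b} \<Longrightarrow> f z = g z"
        then have "fn f x = fn g x" by (auto simp: fn_def)
        then show "Q f x s = Q g x s" using e by (auto simp: Q_def)
      next
        fix \<eta> g assume "\<And>l. (l, \<eta>) \<in> {(a, b). a \<in> underS \<theta> b} \<Longrightarrow> Q g l (g l)"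
        then have IH: "fst (g l) \<in> P" "q \<subseteq>\<^sub>m fst (g l)"
            "\<And>k. k \<in> underS \<theta> l \<Longrightarrow> fst (g k) \<subseteq>\<^sub>m fst (g l)" "H (fn g l) (snd (g l)) (fst (g l))"
          if "l \<in> underS \<theta> \<eta>" for l
          using that underS_FieldD[OF that] unfolding Q_def by auto
        show "\<exists>x. Q g \<eta> x"
        proof (cases "\<eta> \<in> Field \<theta>")
          case True\<eta>: True
          define S where "S = {q} \<union> (\<lambda>l. fst (g l)) ` underS \<theta> \<eta>"
          have ag: "agree x y" if "x \<in> S" "y \<in> S" for x y
          proof -
            have "x \<subseteq>\<^sub>m y \<or> y \<subseteq>\<^sub>m x"
            proof -
              have "fst (g l) \<subseteq>\<^sub>m fst (g k) \<or> fst (g k) \<subseteq>\<^sub>m fst (g l)"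
                if "l \<in> underS \<theta> \<eta>" "k \<in> underS \<theta> \<eta>" for l k
                using underS_total[OF theta_wo, of l k] IH(3) that underS_FieldD by fastforce
              then show ?thesis using that IH(2) unfolding S_def by auto
            qed
            then show ?thesis
              using agree_if_le[of x y y] agree_if_le[of x x y] by auto
          qed
          have "|underS \<theta> \<eta>| <o \<sigma>"
            using card_of_underS[OF theta_card True\<eta>] theta_le ordLess_ordLeq_trans by blast
          then have "|S| <o \<sigma>"
            unfolding S_def
            by (intro regular_small_Un regular_small_singleton sigma_regular small_image)
          moreover have "S \<subseteq> P" using q IH(1) by (auto simp: S_def)
          ultimately have sP: "Glue S \<in> P" by (intro Glue_in_P)
          have sle: "x \<subseteq>\<^sub>m Glue S" if "x \<in> S" for x
            using le_Glue[OF ag that] by simp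
          have "Gen (Glue S) (fn g \<eta>)"
            unfolding Gen_def
          proof (intro conjI sP allI impI)
            fix l a assume l: "fn g \<eta> l = Some a"
            then have ll: "l \<in> underS \<theta> \<eta>" "a = snd (g l)" by (auto simp: fn_def split: if_splits)
            have "fn g \<eta> |` underS \<theta> l = fn g l"
              using underS_trans[OF theta_wo _ ll(1)] by (auto simp: fn_def restrict_map_def)
            moreover have "fst (g l) \<subseteq>\<^sub>m Glue S" using ll(1) by (intro sle) (auto simp: S_def)
            ultimately show "H (fn g \<eta> |` underS \<theta> l) a (Glue S)"
              using H_open[OF IH(4)[OF ll(1)] sP] ll(2) by simp
          qed
          moreover have "q0 \<subseteq>\<^sub>m Glue S"
            using sle[of q] q(2) map_le_trans by (auto simp: S_def)
          moreover have "dom (fn g \<eta>) = underS \<theta> \<eta>" by (auto simp: fn_def split: if_splits)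
          ultimately obtain a r where ar: "H (fn g \<eta>) a r" "Glue S \<subseteq>\<^sub>m r"
            using True True\<eta> by blast
          have "Gen r (fn g \<eta>)"
            using Gen_open[OF \<open>Gen (Glue S) (fn g \<eta>)\<close> H_P[OF ar(1)] ar(2)] .
          moreover have "x \<subseteq>\<^sub>m r" if "x \<in> S" for x
            using sle[OF that] ar(2) map_le_trans by blast
          ultimately have "Q g \<eta> (r, a)"
            using ar(1) H_P[OF ar(1)] by (auto simp: Q_def S_def)
          then show ?thesis by blast
        qed (simp add: Q_def)
      qed
      then obtain g where "Q g \<xi> (g \<xi>)" by blast
      moreover have "dom (fn g \<xi>) = underS \<theta> \<xi>" by (auto simp: fn_def split: if_splits)
      ultimately show "\<exists>r a. q \<subseteq>\<^sub>m r \<and> G \<xi> a r"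
        using \<xi> unfolding Q_def G_def by blast
    qed
    then show ?thesis using no by blast
  next
    case False
    \<comment> \<open>No extension of \<open>q\<close> chooses a next point after \<open>f\<close>.
      Since the choice is dense wherever a next point is possible at all, no extension of
      \<open>q\<close> admits one.\<close>
    then obtain q f \<xi> where q: "Gen q f" "q0 \<subseteq>\<^sub>m q" and \<xi>: "\<xi> \<in> Field \<theta>" "dom f = underS \<theta> \<xi>"
        and stuck: "\<And>a r. H f a r \<Longrightarrow> \<not> q \<subseteq>\<^sub>m r"
      by blast
    have qP: "q \<in> P" using q(1) by (simp add: Gen_def)
    have mem: "y \<in> C \<and> Gr y b q" if y: "y \<in> ran f" for y
    proof -
      obtain l where "f l = Some y" using y by (auto simp: ran_def)
      then have "H (f |` underS \<theta> l) y q" using q(1) unfolding Gen_def by blast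
      then show ?thesis using H_E unfolding E_def by blast
    qed
    have "ran f \<subseteq> (\<lambda>l. the (f l)) ` dom f"
      by (force simp: ran_def image_iff)
    then have "|ran f| <o \<theta>"
      using small_subset[OF small_image[OF card_of_underS[OF theta_card \<xi>(1)]]] \<xi>(2) by metis
    moreover have "\<not> ((\<forall>y \<in> ran f. Gr y a r') \<and> Gr a b r')"
      if "r' \<in> P" "q \<subseteq>\<^sub>m r'" "a \<in> C" "ran f \<subseteq> underS lam a" for r' a
      using H_dense[OF qP, of f a r'] stuck that unfolding E_def by blast
    ultimately show ?thesis
      using qP q(2) mem by (intro exI[of _ q] exI[of _ "ran f"]) auto
  qed
qed

end

section \<open>Pieces of a strong limit cardinal\<close>

lemma ctwo_cexp_card_of: "ctwo ^c |D| =o |Pow D|"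
  using card_of_Pow_Func[of D] ordIso_symmetric
  by (auto simp: cexp_def ctwo_def Field_card_of)

lemma strong_limit_Pow:
  fixes lam :: "'l rel" and D :: "'d set"
  assumes lam: "Card_order lam" "strong_limit lam" and D: "|D| <o lam"
  shows "|Pow D| <o lam"
proof -
  obtain g where g: "inj_on g D" "g ` D \<subseteq> Field lam"
    using ordLess_card_of_inj[OF lam(1) D] .
  have "ctwo ^c |g ` D| <o lam"
    using lam(2) small_image[OF D] card_of_Card_order unfolding strong_limit_def by blast
  then have "|Pow (g ` D)| <o lam"
    using ctwo_cexp_card_of ordIso_symmetric ordIso_ordLess_trans by blast
  moreover have "|Pow D| \<le>o |Pow (g ` D)|"
    using card_of_eq_image[OF g(1)] ordIso_symmetric ordIso_imp_ordLeq
    by (intro card_of_Pow_mono) blast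
  ultimately show ?thesis
    using ordLeq_ordLess_trans by blast
qed

text \<open>The segment has not only the size but the order type of \<open>L\<close>, so that its
  own initial segments are smaller than \<open>L\<close>; pressing down on the pieces depends on
  this.\<close>

lemma ordLess_initial_segment:
  fixes lam :: "'l rel"
  assumes lam: "Card_order lam" and L: "Card_order L" "L <o lam"
  obtains a where "a \<in> Field lam" "|underS lam a| =o L" "\<And>x. x \<in> underS lam a \<Longrightarrow> |underS lam x| <o L"
proof -
  have W: "Well_order lam" "Well_order L" using lam L by (simp_all add: card_order_on_def)
  then obtain a where a: "a \<in> Field lam" "L =o Restr lam (underS lam a)"
    using ordLess_iff_ordIso_Restr L(2) by blast
  define R where "R = Restr lam (underS lam a)"
  have F: "Field R = underS lam a"
    using W(1) unfolding R_def
    by (intro Field_Restr_ofilter) (simp_all add: wo_rel_def wo_rel.underS_ofilter)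
  have RC: "Card_order R"
    using Card_order_ordIso[OF L(1)] a(2) ordIso_symmetric R_def by blast
  have RL: "R =o L" using a(2) ordIso_symmetric R_def by blast
  have "|underS lam a| =o R" using card_of_Field_ordIso[OF RC] F by simp
  then have "|underS lam a| =o L" using RL ordIso_transitive by blast
  moreover have "|underS lam x| <o L" if x: "x \<in> underS lam a" for x
  proof -
    have "underS lam x \<subseteq> underS R x"
      using x underS_trans[OF W(1) _ x] by (auto simp: R_def underS_def)
    moreover have "|underS R x| <o R"
      using x F by (intro card_of_underS[OF RC]) simp
    ultimately have "|underS lam x| <o R" using small_subset by blast
    then show ?thesis using RL ordLess_ordIso_trans by blast
  qed
  ultimately show thesis using that a(1) by blast
qed

text \<open>Each piece begins beyond its cut point and ends before all later cut points. Strong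
  limitness keeps two successive power sets of an initial segment below \<open>lam\<close>, and the
  successor of the first power set fits under the second.\<close>

lemma pieces_exist:
  fixes lam :: "'l rel" and \<kappa> :: "'k rel"
  assumes lam: "Card_order lam" "strong_limit lam" and \<kappa>: "regular_card \<kappa>" "\<kappa> <o lam"
    and cf: "has_cofinality lam \<kappa>"
  shows "\<exists>(d :: 'k \<Rightarrow> 'l) I.
    (\<forall>k \<in> Field \<kappa>. d k \<in> Field lam \<and> \<kappa> \<le>o |underS lam (d k)| \<and> I k \<subseteq> Field lam \<and>
      |I k| =o cardSuc |Pow (underS lam (d k))| \<and>
      (\<forall>a \<in> I k. |I k \<inter> underS lam a| <o cardSuc |Pow (underS lam (d k))| ) \<and>
      I k \<inter> underS lam (d k) = {} \<and>
      (\<forall>j \<in> underS \<kappa> k. I j \<subseteq> underS lam (d k) \<and> d j \<in> underS lam (d k))) \<and>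
    (\<forall>x \<in> Field lam. \<exists>k \<in> Field \<kappa>. x \<in> underS lam (d k))"
proof -
  have W: "Well_order lam" "Well_order \<kappa>" and \<kappa>c: "Card_order \<kappa>" "\<not> finite (Field \<kappa>)"
    using lam \<kappa> by (auto simp: card_order_on_def regular_card_def)
  have laminf: "\<not> finite (Field lam)"
    using card_of_ordLeq_infinite[of "Field \<kappa>" "Field lam"] \<kappa>c(2) \<kappa>(2)
      card_of_Field_ordIso[OF \<kappa>c(1)] card_of_Field_ordIso[OF lam(1)]
    by (meson ordIso_ordLeq_trans ordIso_symmetric ordLeq_ordIso_trans ordLess_imp_ordLeq)
  have J: "\<exists>I d'. I \<subseteq> Field lam \<and> d' \<in> Field lam \<and> I \<subseteq> underS lam d' \<and>
      |I| =o cardSuc |Pow (underS lam d)| \<and>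
      (\<forall>a \<in> I. |I \<inter> underS lam a| <o cardSuc |Pow (underS lam d)| ) \<and> I \<inter> underS lam d = {}"
    if d: "d \<in> Field lam" and big: "\<kappa> \<le>o |underS lam d|" for d
  proof -
    define D where "D = underS lam d"
    have Dinf: "\<not> finite D"
      using card_of_ordLeq_infinite[of "Field \<kappa>" D] \<kappa>c card_of_Field_ordIso[OF \<kappa>c(1)] big
        ordIso_ordLeq_trans unfolding D_def by blast
    define L where "L = cardSuc |Pow D|"
    have LC: "Card_order L" by (simp add: L_def cardSuc_Card_order card_of_Card_order)
    have Lreg: "regular_card L"
      using Dinf unfolding L_def
      by (intro regular_card_cardSuc) (auto simp: Field_card_of card_of_card_order_on)
    have "|D| <o lam" using card_of_underS[OF lam(1) d] by (simp add: D_def)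
    then have "|Pow (Pow D)| <o lam"
      by (intro strong_limit_Pow lam)
    moreover have "L \<le>o |Pow (Pow D)|"
      unfolding L_def by (intro cardSuc_least card_of_Card_order card_of_Pow)
    ultimately have "L <o lam" using ordLeq_ordLess_trans by blast
    then obtain a where a: "a \<in> Field lam" "|underS lam a| =o L"
        "\<And>x. x \<in> underS lam a \<Longrightarrow> |underS lam x| <o L"
      using ordLess_initial_segment[OF lam(1) LC] by metis
    \<comment> \<open>Removing \<open>D\<close>, which is smaller than \<open>L\<close>, does not
      change the size, and it makes the piece disjoint from the segment below
      \<open>d\<close>.\<close>
    define I where "I = underS lam a - D"
    have DL: "|D| <o L"
      using card_of_Pow[of D] cardSuc_greater[OF card_of_Card_order] ordLess_transitive
      unfolding L_def by blast
    have "|I| =o L"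
    proof (rule ccontr)
      assume "\<not> |I| =o L"
      then have "|I| <o L"
        using card_of_subset_cases[OF LC a(2), of I] by (auto simp: I_def)
      then have "|I \<union> D| <o L" using DL by (intro regular_small_Un Lreg)
      then have "|underS lam a| <o L" by (rule small_subset) (auto simp: I_def)
      then show False using a(2) not_ordLess_ordIso by blast
    qed
    moreover have "|I \<inter> underS lam x| <o L" if "x \<in> I" for x
      using a(3)[of x] that small_subset unfolding I_def by blast
    moreover have "I \<subseteq> Field lam" using underS_Field2[OF a(1)] by (auto simp: I_def)
    ultimately show ?thesis
      using a(1) by (intro exI[of _ I] exI[of _ a]) (auto simp: I_def L_def D_def)
  qed
  \<comment> \<open>The first component is a piece over \<open>d\<close>, the second a point beyond
    that piece.\<close>
  define JJ where "JJ d = (SOME Ie. fst Ie \<subseteq> Field lam \<and> snd Ie \<in> Field lam \<and> fst Ie \<subseteq> underS lam (snd Ie) \<and>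
      |fst Ie| =o cardSuc |Pow (underS lam d)| \<and>
      (\<forall>a \<in> fst Ie. |fst Ie \<inter> underS lam a| <o cardSuc |Pow (underS lam d)| ) \<and> fst Ie \<inter> underS lam d = {})" for d
  have JJ: "fst (JJ d) \<subseteq> Field lam \<and> snd (JJ d) \<in> Field lam \<and> fst (JJ d) \<subseteq> underS lam (snd (JJ d)) \<and>
      |fst (JJ d)| =o cardSuc |Pow (underS lam d)| \<and>
      (\<forall>a \<in> fst (JJ d). |fst (JJ d) \<inter> underS lam a| <o cardSuc |Pow (underS lam d)| ) \<and>
      fst (JJ d) \<inter> underS lam d = {}"
    if d: "d \<in> Field lam" "\<kappa> \<le>o |underS lam d|" for d
    unfolding JJ_def by (rule someI_ex) (use J[OF d] in auto)
  obtain A where A: "A \<subseteq> Field lam" "cofinal A lam" "|A| =o \<kappa>"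
    using cf by (auto simp: has_cofinality_def)
  have "|Field \<kappa>| =o |A|"
    using A(3) card_of_Field_ordIso[OF \<kappa>c(1)] ordIso_symmetric ordIso_transitive by blast
  then obtain e where e: "bij_betw e (Field \<kappa>) A"
    using card_of_ordIso by blast
  obtain u where u: "u \<in> Field lam" "|underS lam u| =o \<kappa>"
    using ordLess_initial_segment[OF lam(1) \<kappa>c(1) \<kappa>(2)] by metis
  \<comment> \<open>A cut point goes above \<open>u\<close>, so that at least
    \<open>\<kappa>\<close> points lie below it; above \<open>e k\<close>, so that the cut points
    are cofinal; and above all earlier cut points and the ends of their pieces.\<close>
  define Q where "Q d k x \<longleftrightarrow> (k \<in> Field \<kappa> \<longrightarrow> x \<in> Field lam \<and> u \<in> underS lam x \<and> e k \<in> underS lam x \<and>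
      (\<forall>j \<in> underS \<kappa> k. d j \<in> underS lam x \<and> snd (JJ (d j)) \<in> underS lam x))" for d k x
  have big: "\<kappa> \<le>o |underS lam x|" if "u \<in> underS lam x" for x
  proof -
    have "underS lam u \<subseteq> underS lam x" using that underS_trans[OF W(1)] by blast
    then have "|underS lam u| \<le>o |underS lam x|" by (rule card_of_mono1)
    then show ?thesis using u(2) ordIso_symmetric ordIso_ordLeq_trans by blast
  qed
  have "\<exists>d. \<forall>k. Q d k (d k)"
  proof (rule dependent_wf_choice[OF wf_underS[OF W(2)]])
    show "Q f x s = Q g x s" if "\<And>z. (z, x) \<in> {(a, b). a \<in> underS \<kappa> b} \<Longrightarrow> f z = g z" for f g x s
      using that by (auto simp: Q_def)
    fix k d assume "\<And>j. (j, k) \<in> {(a, b). a \<in> underS \<kappa> b} \<Longrightarrow> Q d j (d j)"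
    then have IH: "d j \<in> Field lam" "u \<in> underS lam (d j)" if "j \<in> underS \<kappa> k" for j
      using that underS_FieldD[OF that] by (auto simp: Q_def)
    show "\<exists>x. Q d k x"
    proof (cases "k \<in> Field \<kappa>")
      case True
      define B where "B = ({u} \<union> {e k}) \<union> (d ` underS \<kappa> k \<union> (\<lambda>j. snd (JJ (d j))) ` underS \<kappa> k)"
      have "|B| <o \<kappa>"
        using card_of_underS[OF \<kappa>c(1) True] unfolding B_def
        by (intro regular_small_Un \<kappa>(1) regular_small_singleton small_image)
      moreover have "snd (JJ (d j)) \<in> Field lam" if "j \<in> underS \<kappa> k" for j
        using JJ[OF IH(1)[OF that] big[OF IH(2)[OF that]]] by blast
      moreover have "e k \<in> Field lam" using bij_betwE[OF e] True A(1) by blast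
      ultimately obtain x where x: "x \<in> Field lam" "B \<subseteq> underS lam x"
        using cofinality_bounded[OF lam(1) laminf cf, of B] u(1) IH(1) unfolding B_def by blast
      then have "Q d k x" by (auto simp: Q_def B_def)
      then show ?thesis ..
    qed (simp add: Q_def)
  qed
  then obtain d where "\<forall>k. Q d k (d k)" ..
  then have d: "d k \<in> Field lam" "u \<in> underS lam (d k)" "e k \<in> underS lam (d k)"
      "\<And>j. j \<in> underS \<kappa> k \<Longrightarrow> d j \<in> underS lam (d k) \<and> snd (JJ (d j)) \<in> underS lam (d k)"
    if "k \<in> Field \<kappa>" for k
    using that unfolding Q_def by blast+
  define I where "I k = fst (JJ (d k))" for k
  have I: "I k \<subseteq> Field lam \<and> snd (JJ (d k)) \<in> Field lam \<and> I k \<subseteq> underS lam (snd (JJ (d k))) \<and>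
      |I k| =o cardSuc |Pow (underS lam (d k))| \<and>
      (\<forall>a \<in> I k. |I k \<inter> underS lam a| <o cardSuc |Pow (underS lam (d k))| ) \<and>
      I k \<inter> underS lam (d k) = {}"
    if "k \<in> Field \<kappa>" for k
    using JJ[OF d(1)[OF that] big[OF d(2)[OF that]]] by (simp add: I_def)
  have "I j \<subseteq> underS lam (d k)" if k: "k \<in> Field \<kappa>" and j: "j \<in> underS \<kappa> k" for k j
  proof -
    have "I j \<subseteq> underS lam (snd (JJ (d j)))" using I underS_FieldD[OF j] by blast
    then show ?thesis
      using d(4)[OF k j] underS_trans[OF W(1)] by blast
  qed
  moreover have "\<exists>k \<in> Field \<kappa>. x \<in> underS lam (d k)" if x: "x \<in> Field lam" for x
  proof -
    obtain a where a: "a \<in> A" "x \<in> underS lam a"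
      using A(2) x by (auto simp: cofinal_def underS_def)
    then obtain k where k: "k \<in> Field \<kappa>" "a = e k"
      using e by (auto simp: bij_betw_def)
    then show ?thesis using d(3)[OF k(1)] a(2) underS_trans[OF W(1)] by blast
  qed
  ultimately show ?thesis
    using d I big by (intro exI[of _ d] exI[of _ I]) (simp add: subset_iff)
qed

text \<open>Subsets of \<open>X\<close> number at most \<open>|Pow D|\<close>, which is less than
  the size of \<open>A\<close>, so one of them is taken as a value on a set of full size. Data to be
  made constant are therefore coded as subsets of a fixed set of size at most
  \<open>|D|\<close>.\<close>

lemma thin:
  assumes D: "\<not> finite D" and A: "|A| =o cardSuc |Pow D|" and F: "\<And>a. a \<in> A \<Longrightarrow> F a \<subseteq> X"
    and X: "|X| \<le>o |D|"
  obtains A' where "A' \<subseteq> A" "|A'| =o cardSuc |Pow D|" "\<And>a b. a \<in> A' \<Longrightarrow> b \<in> A' \<Longrightarrow> F a = F b"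
proof -
  have L: "regular_card (cardSuc |Pow D| )"
    using D by (intro regular_card_cardSuc) (auto simp: Field_card_of card_of_card_order_on)
  have "|Pow X| <o cardSuc |Pow D|"
    using card_of_Pow_mono[OF X] cardSuc_greater[OF card_of_Card_order] ordLeq_ordLess_trans
    by blast
  then have "|F ` A| <o cardSuc |Pow D|"
    by (rule small_subset) (use F in blast)
  from pigeonhole_regular[OF L A this]
  obtain t where t: "|{a \<in> A. F a = t}| =o cardSuc |Pow D|" by (elim exE) (rule that)
  show thesis by (rule that[OF _ t]) auto
qed

lemma card_of_Times_le: "\<not> finite D \<Longrightarrow> |A| \<le>o |D| \<Longrightarrow> |B| \<le>o |D| \<Longrightarrow> |A \<times> B| \<le>o |D|"
  using card_of_Times_ordLeq_infinite_Field[of "|D|" A B]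
  by (simp add: Field_card_of card_of_card_order_on)

lemma card_of_UN_le: "\<not> finite D \<Longrightarrow> |I| \<le>o |D| \<Longrightarrow> (\<And>i. i \<in> I \<Longrightarrow> |A i| \<le>o |D| ) \<Longrightarrow> |\<Union>i \<in> I. A i| \<le>o |D|"
  using UNION_Cinfinite_bound[of I "|D|" A]
  by (simp add: Field_card_of card_of_card_order_on cinfinite_def)

lemma card_of_Un_le: "\<not> finite D \<Longrightarrow> |A| \<le>o |D| \<Longrightarrow> |B| \<le>o |D| \<Longrightarrow> |A \<union> B| \<le>o |D|"
  using Un_Cinfinite_bound[of A "|D|" B]
  by (simp add: Field_card_of card_of_card_order_on cinfinite_def)

lemma card_of_subset_le: "|B| \<le>o |D| \<Longrightarrow> A \<subseteq> B \<Longrightarrow> |A| \<le>o |D|"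
  using card_of_mono1 ordLeq_transitive by blast

lemma card_of_image_le: "|B| \<le>o |D| \<Longrightarrow> |f ` B| \<le>o |D|"
  using card_of_image ordLeq_transitive by blast

lemma not_subset_small:
  assumes "|X| =o \<kappa>" "regular_card \<kappa>" "k \<in> Field \<kappa>" "X \<subseteq> Field \<kappa>"
  obtains j where "j \<in> X" "k \<in> underS \<kappa> j"
proof -
  have c: "Card_order \<kappa>" "Well_order \<kappa>"
    using assms(2) by (auto simp: regular_card_def card_order_on_def)
  have "|{k} \<union> underS \<kappa> k| <o \<kappa>"
    by (intro regular_small_Un regular_small_singleton assms(2) card_of_underS[OF c(1) assms(3)])
  then obtain j where "j \<in> X" "j \<notin> {k} \<union> underS \<kappa> k"
    by (rule big_minus_small[OF assms(1)])
  then show thesis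
    using underS_total[OF c(2), of k j] assms(3,4) that by blast
qed

section \<open>Homogeneous and canonical pieces\<close>

locale core = cohen_forcing \<sigma> \<nu> for \<sigma> :: "'s rel" and \<nu> :: "'n rel" +
  fixes lam :: "'l rel" and \<kappa> :: "'k rel" and \<theta> :: "'t rel"
    and m :: "'l \<Rightarrow> 'l \<Rightarrow> 's \<Rightarrow> ('n \<times> 's \<rightharpoonup> bool)" and ok :: "'l \<Rightarrow> 'l \<Rightarrow> bool"
    and d :: "'k \<Rightarrow> 'l" and I :: "'k \<Rightarrow> 'l set"
  assumes lam_card: "Card_order lam"
    and kappa_regular: "regular_card \<kappa>" and sigma_less: "\<sigma> <o \<kappa>"
    and theta_card: "Card_order \<theta>" and theta_le: "\<theta> \<le>o \<sigma>"
    and theta_exp: "\<And>\<mu> :: 'k rel. Card_order \<mu> \<Longrightarrow> \<mu> <o \<kappa> \<Longrightarrow> cexp_less \<mu> \<theta> <o \<kappa>"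
    and m_P: "m a b z \<in> P"
    and d_Field: "k \<in> Field \<kappa> \<Longrightarrow> d k \<in> Field lam"
    and kappa_le: "k \<in> Field \<kappa> \<Longrightarrow> \<kappa> \<le>o |underS lam (d k)|"
    and I_Field: "k \<in> Field \<kappa> \<Longrightarrow> I k \<subseteq> Field lam"
    and I_card: "k \<in> Field \<kappa> \<Longrightarrow> |I k| =o cardSuc |Pow (underS lam (d k))|"
    and I_initial: "k \<in> Field \<kappa> \<Longrightarrow> a \<in> I k \<Longrightarrow> |I k \<inter> underS lam a| <o cardSuc |Pow (underS lam (d k))|"
    and I_above: "k \<in> Field \<kappa> \<Longrightarrow> I k \<inter> underS lam (d k) = {}"
    and I_below: "j \<in> underS \<kappa> k \<Longrightarrow> I j \<subseteq> underS lam (d k)"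
    and d_mono: "j \<in> underS \<kappa> k \<Longrightarrow> d j \<in> underS lam (d k)"
    and d_cofinal: "x \<in> Field lam \<Longrightarrow> \<exists>k \<in> Field \<kappa>. x \<in> underS lam (d k)"
begin

abbreviation "K \<equiv> Field \<kappa>"
abbreviation "S \<equiv> Field \<sigma>"
abbreviation "D k \<equiv> underS lam (d k)"
abbreviation "L k \<equiv> cardSuc |Pow (D k)|"

lemma kappa_card: "Card_order \<kappa>" and kappa_wo: "Well_order \<kappa>" and lam_wo: "Well_order lam"
  using kappa_regular lam_card by (auto simp: regular_card_def card_order_on_def)

lemma K_le: "k \<in> K \<Longrightarrow> |K| \<le>o |D k|"
  using kappa_le card_of_Field_ordIso[OF kappa_card] ordIso_ordLeq_trans by blast

lemma S_le: "k \<in> K \<Longrightarrow> |S| \<le>o |D k|"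
  using kappa_le sigma_less card_of_Field_ordIso[OF sigma_card] ordIso_ordLeq_trans
    ordLess_imp_ordLeq ordLeq_transitive by blast

lemma D_inf: "k \<in> K \<Longrightarrow> \<not> finite (D k)"
  using card_of_ordLeq_infinite[OF K_le] kappa_regular by (auto simp: regular_card_def)

lemma L_regular: "k \<in> K \<Longrightarrow> regular_card (L k)"
  using D_inf by (intro regular_card_cardSuc) (auto simp: Field_card_of card_of_card_order_on)

lemma small_imp_le_D: "k \<in> K \<Longrightarrow> |X| <o \<sigma> \<Longrightarrow> |X| \<le>o |D k|"
  using S_le card_of_Field_ordIso[OF sigma_card] ordIso_symmetric ordLess_ordIso_trans
    ordLess_imp_ordLeq ordLeq_transitive by blast

lemma dom_small: "p \<in> P \<Longrightarrow> |dom p| <o \<sigma>"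
  by (simp add: cohen_def)

lemma bool_le: "k \<in> K \<Longrightarrow> |UNIV :: bool set| \<le>o |D k|"
  using D_inf finite_ordLess_infinite[of "|UNIV :: bool set|" "|D k|"]
  by (simp add: Field_card_of card_of_well_order_on ordLess_imp_ordLeq)

definition T :: "'k \<Rightarrow> 'l \<Rightarrow> ('n \<times> 's) set"
  where "T k b = (\<Union>a \<in> D k. \<Union>z \<in> S. dom (m a b z))"

lemma T_le: "k \<in> K \<Longrightarrow> |T k b| \<le>o |D k|"
  unfolding T_def
  by (intro card_of_UN_le D_inf card_of_refl[THEN ordIso_imp_ordLeq] S_le small_imp_le_D dom_small m_P)

text \<open>The supports \<open>T k b\<close> wander with \<open>b\<close> over all coordinates of
  the forcing. Moving each of them into \<open>D k\<close> makes the data of different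
  \<open>b\<close> comparable and turns \<open>F1\<close> into a subset of one fixed set of size at
  most \<open>|D k|\<close>.\<close>

definition kb :: "'k \<Rightarrow> 'l \<Rightarrow> 'n \<times> 's \<Rightarrow> 'l"
  where "kb k b = (SOME g. inj_on g (T k b) \<and> g ` T k b \<subseteq> D k)"

lemma kb_inj:
  assumes "k \<in> K" shows "inj_on (kb k b) (T k b) \<and> kb k b ` T k b \<subseteq> D k"
proof -
  have "\<exists>g. inj_on g (T k b) \<and> g ` T k b \<subseteq> D k"
    using T_le[OF assms, of b] by (metis card_of_ordLeq)
  then show ?thesis unfolding kb_def by (rule someI_ex)
qed

text \<open>The behaviour of the point \<open>b\<close> of the \<open>k\<close>-th piece relative to the points below the piece,
  with the supports of the conditions transported along \<open>kb\<close>.\<close>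

definition F1 :: "'k \<Rightarrow> 'l \<Rightarrow> ('l \<times> 's \<times> 'l \<times> bool) set"
  where "F1 k b = {(a, z, w, v). a \<in> D k \<and> z \<in> S \<and> (\<exists>x \<in> T k b. kb k b x = w \<and> m a b z x = Some v)}"

definition F2 :: "'k \<Rightarrow> 'l \<Rightarrow> ('l \<times> 'l \<times> 's \<times> 's) set"
  where "F2 k b = {(y, a, z, z'). y \<in> D k \<and> a \<in> D k \<and> z \<in> S \<and> z' \<in> S \<and> agree (m y a z) (m a b z')}"

definition F3 :: "'k \<Rightarrow> 'l \<Rightarrow> 'l set"
  where "F3 k b = {a \<in> D k. ok a b}"

lemma F1_iff:
  assumes "k \<in> K" "a \<in> D k" "z \<in> S" "x \<in> T k b"
  shows "(a, z, kb k b x, v) \<in> F1 k b \<longleftrightarrow> m a b z x = Some v"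
  using assms kb_inj[of k b] unfolding F1_def inj_on_def by blast

definition homogeneous :: "'k \<Rightarrow> 'l set \<Rightarrow> bool"
  where "homogeneous k A \<longleftrightarrow> A \<subseteq> I k \<and> |A| =o L k \<and>
    (\<forall>b \<in> A. \<forall>b' \<in> A. F1 k b = F1 k b' \<and> F2 k b = F2 k b' \<and> F3 k b = F3 k b')"

lemma ex_homogeneous:
  assumes k: "k \<in> K"
  shows "\<exists>A. homogeneous k A"
proof -
  note inf = D_inf[OF k]
  note le = card_of_refl[THEN ordIso_imp_ordLeq] S_le[OF k] bool_le[OF k]
  obtain A where A: "A \<subseteq> I k" "|A| =o L k" "\<And>a b. a \<in> A \<Longrightarrow> b \<in> A \<Longrightarrow> F1 k a = F1 k b"
  proof -
    have F1s: "F1 k a \<subseteq> D k \<times> S \<times> D k \<times> UNIV" for a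
      using kb_inj[OF k] by (auto simp: F1_def)
    show thesis
    proof (rule thin[OF inf I_card[OF k] F1s])
      show "|D k \<times> S \<times> D k \<times> (UNIV :: bool set)| \<le>o |D k|"
        by (intro card_of_Times_le inf le)
    qed (rule that)
  qed
  obtain A' where A': "A' \<subseteq> A" "|A'| =o L k" "\<And>a b. a \<in> A' \<Longrightarrow> b \<in> A' \<Longrightarrow> F2 k a = F2 k b"
  proof (rule thin[OF inf A(2)])
    show "F2 k a \<subseteq> D k \<times> D k \<times> S \<times> S" for a
      unfolding F2_def by blast
    show "|D k \<times> D k \<times> S \<times> S| \<le>o |D k|"
      by (intro card_of_Times_le inf le)
  qed (rule that)
  obtain A'' where A'': "A'' \<subseteq> A'" "|A''| =o L k" "\<And>a b. a \<in> A'' \<Longrightarrow> b \<in> A'' \<Longrightarrow> F3 k a = F3 k b"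
  proof (rule thin[OF inf A'(2)])
    show "F3 k a \<subseteq> D k" for a
      unfolding F3_def by blast
    show "|D k| \<le>o |D k|"
      by (intro le)
  qed (rule that)
  have sub: "A'' \<subseteq> A'" "A'' \<subseteq> A" "A'' \<subseteq> I k"
    using A(1) A'(1) A''(1) by auto
  have "F1 k b = F1 k b' \<and> F2 k b = F2 k b' \<and> F3 k b = F3 k b'" if "b \<in> A''" "b' \<in> A''" for b b'
    by (intro conjI A(3) A'(3) A''(3)) (use sub that in auto)
  then have "homogeneous k A''"
    unfolding homogeneous_def by (intro conjI[OF sub(3)] conjI[OF A''(2)] ballI)
  then show ?thesis ..
qed

definition A1 :: "'k \<Rightarrow> 'l set"
  where "A1 k = (SOME A. homogeneous k A)"

lemma A1_homogeneous: "k \<in> K \<Longrightarrow> homogeneous k (A1 k)"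
  unfolding A1_def using ex_homogeneous by (rule someI_ex)

text \<open>By homogeneity \<open>rep j\<close> has the same data \<open>F1\<close>,
  \<open>F2\<close> and \<open>F3\<close> as every other point of \<open>A1 j\<close>. A lower piece
  can therefore be thinned out against a single point of each later piece. That makes at most
  \<open>\<kappa>\<close> requirements, and \<open>\<kappa>\<close> is at most \<open>|D i|\<close>
  for every piece \<open>i\<close>.\<close>

definition rep :: "'k \<Rightarrow> 'l"
  where "rep k = (SOME b. b \<in> A1 k)"

lemma rep_in_A1:
  assumes k: "k \<in> K" shows "rep k \<in> A1 k"
proof -
  obtain a where "a \<in> A1 k"
    using big_minus_small[OF _ regular_small_singleton[OF L_regular[OF k]], of "A1 k"] A1_homogeneous[OF k]
    by (metis homogeneous_def)
  then show ?thesis unfolding rep_def by (rule someI)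
qed

text \<open>What must be controlled when the point \<open>a\<close> of the \<open>i\<close>-th piece is replaced by another
  one: its conditions with lower points, and those with the points of the later pieces.\<close>

definition Bset :: "'k \<Rightarrow> 'l \<Rightarrow> ('n \<times> 's + 'k \<times> 'l) set"
  where "Bset i a = Inl ` T i a \<union> Inr ` {(j, w). i \<in> underS \<kappa> j \<and> (\<exists>z v. (a, z, w, v) \<in> F1 j (rep j))}"

text \<open>\<open>G1\<close> and \<open>G2\<close> fix the values of the conditions on the root
  \<open>R\<close>; \<open>G3\<close> and \<open>G4\<close> fix which of the conditions agree with
  each other; \<open>G5\<close> and \<open>G6\<close> fix the flags \<open>ok\<close>.\<close>

definition G1 :: "'k \<Rightarrow> ('n \<times> 's + 'k \<times> 'l) set \<Rightarrow> 'l \<Rightarrow> _"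
  where "G1 i R a = {(y, z, s, v). y \<in> D i \<and> z \<in> S \<and> s \<in> R \<and> (\<exists>x. s = Inl x \<and> m y a z x = Some v)}"

definition G2 :: "'k \<Rightarrow> ('n \<times> 's + 'k \<times> 'l) set \<Rightarrow> 'l \<Rightarrow> _"
  where "G2 i R a = {(z, s, v). z \<in> S \<and> s \<in> R \<and>
    (\<exists>j w. s = Inr (j, w) \<and> i \<in> underS \<kappa> j \<and> (a, z, w, v) \<in> F1 j (rep j))}"

definition G3 :: "'k \<Rightarrow> 'l \<Rightarrow> _"
  where "G3 i a = {(y, y', z, z'). y \<in> D i \<and> y' \<in> D i \<and> z \<in> S \<and> z' \<in> S \<and> agree (m y a z) (m y' a z')}"

definition G4 :: "'k \<Rightarrow> 'l \<Rightarrow> _"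
  where "G4 i a = {(j, y, z, z'). i \<in> underS \<kappa> j \<and> y \<in> D i \<and> z \<in> S \<and> z' \<in> S \<and> (y, a, z, z') \<in> F2 j (rep j)}"

definition G5 :: "'k \<Rightarrow> 'l \<Rightarrow> _"
  where "G5 i a = {y \<in> D i. ok y a}"

definition G6 :: "'k \<Rightarrow> 'l \<Rightarrow> _"
  where "G6 i a = {j. i \<in> underS \<kappa> j \<and> a \<in> F3 j (rep j)}"

lemma Bset_le:
  assumes i: "i \<in> K"
  shows "|Bset i a| \<le>o |D i|"
proof -
  note inf = D_inf[OF i]
  have "{(j, w). i \<in> underS \<kappa> j \<and> (\<exists>z v. (a, z, w, v) \<in> F1 j (rep j))} \<subseteq>
      (\<Union>j \<in> K. \<Union>z \<in> S. (\<lambda>x. (j, kb j (rep j) x)) ` dom (m a (rep j) z))"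
    using underS_FieldD by (fastforce simp: F1_def)
  moreover have "|\<Union>j \<in> K. \<Union>z \<in> S. (\<lambda>x. (j, kb j (rep j) x)) ` dom (m a (rep j) z)| \<le>o |D i|"
    by (intro card_of_UN_le inf K_le[OF i] S_le[OF i] card_of_image_le small_imp_le_D[OF i] dom_small m_P)
  ultimately show ?thesis
    unfolding Bset_def
    by (intro card_of_Un_le inf card_of_image_le T_le[OF i]) (rule card_of_subset_le)
qed

definition canonical :: "'k \<Rightarrow> 'l set \<Rightarrow> bool"
  where "canonical i A \<longleftrightarrow> A \<subseteq> A1 i \<and> |A| =o L i \<and> (\<exists>R. \<forall>a \<in> A. R \<subseteq> Bset i a \<and> (\<forall>b \<in> A.
    (a \<noteq> b \<longrightarrow> Bset i a \<inter> Bset i b = R) \<and> G1 i R a = G1 i R b \<and> G2 i R a = G2 i R b \<and>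
    G3 i a = G3 i b \<and> G4 i a = G4 i b \<and> G5 i a = G5 i b \<and> G6 i a = G6 i b))"

text \<open>The Delta-system precedes the thinnings because \<open>G1\<close> and \<open>G2\<close>
  refer to its root, and a subset of a Delta-system keeps the root. The sets \<open>Bset i a\<close>
  may have size \<open>|D i|\<close>, hence the bound \<open>cardSuc |D i|\<close>.\<close>

lemma ex_canonical:
  assumes i: "i \<in> K"
  shows "\<exists>A. canonical i A"
proof -
  note inf = D_inf[OF i]
  note le = card_of_refl[THEN ordIso_imp_ordLeq] S_le[OF i] bool_le[OF i] K_le[OF i]
  have LC: "Card_order (L i)" by (simp add: cardSuc_Card_order card_of_Card_order)
  have t: "regular_card (cardSuc |D i| )"
    using inf by (intro regular_card_cardSuc) (auto simp: Field_card_of card_of_card_order_on)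
  have tl: "cardSuc |D i| <o L i"
  proof -
    have "cardSuc |D i| \<le>o |Pow (D i)|"
      by (intro cardSuc_least card_of_Card_order card_of_Pow)
    then show ?thesis
      using cardSuc_greater[OF card_of_Card_order] ordLeq_ordLess_trans by blast
  qed
  have A1c: "|A1 i| =o L i" using A1_homogeneous[OF i] by (simp add: homogeneous_def)
  have Bs: "|Bset i a| <o cardSuc |D i|" for a
    using Bset_le[OF i] cardSuc_greater[OF card_of_Card_order] ordLeq_ordLess_trans by blast
  have "\<exists>M \<subseteq> A1 i. |M| =o L i \<and> (\<exists>R. \<forall>a \<in> M. R \<subseteq> Bset i a \<and> (\<forall>b \<in> M. a \<noteq> b \<longrightarrow> Bset i a \<inter> Bset i b = R))"
    by (intro delta_system[OF L_regular[OF i] A1c t tl] Bs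
        small_powers_transfer[OF small_powers_cardSuc_Pow[OF inf] LC])
  then obtain A R where A: "A \<subseteq> A1 i" "|A| =o L i"
      and R: "\<forall>a \<in> A. R \<subseteq> Bset i a \<and> (\<forall>b \<in> A. a \<noteq> b \<longrightarrow> Bset i a \<inter> Bset i b = R)"
    by (elim exE conjE) (rule that)
  obtain a0 where a0: "a0 \<in> A"
    by (rule big_minus_small[OF A(2) regular_small_singleton[OF L_regular[OF i]]])
  have Rle: "|R| \<le>o |D i|"
    by (rule card_of_subset_le[OF Bset_le[OF i, of a0]]) (use R a0 in blast)
  obtain A1' where 1: "A1' \<subseteq> A" "|A1'| =o L i" "\<And>a b. a \<in> A1' \<Longrightarrow> b \<in> A1' \<Longrightarrow> G1 i R a = G1 i R b"
  proof -
    have G1s: "G1 i R a \<subseteq> D i \<times> S \<times> R \<times> UNIV" for a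
      unfolding G1_def by blast
    show thesis
    proof (rule thin[OF inf A(2) G1s])
      show "|D i \<times> S \<times> R \<times> (UNIV :: bool set)| \<le>o |D i|"
        by (intro card_of_Times_le inf le Rle)
    qed (rule that)
  qed
  obtain A2' where 2: "A2' \<subseteq> A1'" "|A2'| =o L i" "\<And>a b. a \<in> A2' \<Longrightarrow> b \<in> A2' \<Longrightarrow> G2 i R a = G2 i R b"
  proof (rule thin[OF inf 1(2)])
    show "G2 i R a \<subseteq> S \<times> R \<times> UNIV" for a
      unfolding G2_def by blast
    show "|S \<times> R \<times> (UNIV :: bool set)| \<le>o |D i|"
      by (intro card_of_Times_le inf le Rle)
  qed (rule that)
  obtain A3' where 3: "A3' \<subseteq> A2'" "|A3'| =o L i" "\<And>a b. a \<in> A3' \<Longrightarrow> b \<in> A3' \<Longrightarrow> G3 i a = G3 i b"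
  proof (rule thin[OF inf 2(2)])
    show "G3 i a \<subseteq> D i \<times> D i \<times> S \<times> S" for a
      unfolding G3_def by blast
    show "|D i \<times> D i \<times> S \<times> S| \<le>o |D i|"
      by (intro card_of_Times_le inf le)
  qed (rule that)
  obtain A4' where 4: "A4' \<subseteq> A3'" "|A4'| =o L i" "\<And>a b. a \<in> A4' \<Longrightarrow> b \<in> A4' \<Longrightarrow> G4 i a = G4 i b"
  proof (rule thin[OF inf 3(2)])
    show "G4 i a \<subseteq> K \<times> D i \<times> S \<times> S" for a
      using underS_FieldD unfolding G4_def by fastforce
    show "|K \<times> D i \<times> S \<times> S| \<le>o |D i|"
      by (intro card_of_Times_le inf le)
  qed (rule that)
  obtain A5' where 5: "A5' \<subseteq> A4'" "|A5'| =o L i" "\<And>a b. a \<in> A5' \<Longrightarrow> b \<in> A5' \<Longrightarrow> G5 i a = G5 i b"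
  proof (rule thin[OF inf 4(2)])
    show "G5 i a \<subseteq> D i" for a
      unfolding G5_def by blast
    show "|D i| \<le>o |D i|"
      by (intro le)
  qed (rule that)
  obtain A6' where 6: "A6' \<subseteq> A5'" "|A6'| =o L i" "\<And>a b. a \<in> A6' \<Longrightarrow> b \<in> A6' \<Longrightarrow> G6 i a = G6 i b"
  proof (rule thin[OF inf 5(2)])
    show "G6 i a \<subseteq> K" for a
      using underS_FieldD unfolding G6_def by fastforce
    show "|K| \<le>o |D i|"
      by (intro le)
  qed (rule that)
  have sub: "A6' \<subseteq> A5'" "A6' \<subseteq> A4'" "A6' \<subseteq> A3'" "A6' \<subseteq> A2'" "A6' \<subseteq> A1'" "A6' \<subseteq> A" "A6' \<subseteq> A1 i"
    using A(1) 1(1) 2(1) 3(1) 4(1) 5(1) 6(1) by auto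
  have Ra: "R \<subseteq> Bset i a \<and> (\<forall>b \<in> A6'. (a \<noteq> b \<longrightarrow> Bset i a \<inter> Bset i b = R) \<and>
      G1 i R a = G1 i R b \<and> G2 i R a = G2 i R b \<and>
      G3 i a = G3 i b \<and> G4 i a = G4 i b \<and> G5 i a = G5 i b \<and> G6 i a = G6 i b)"
    if a: "a \<in> A6'" for a
  proof (intro conjI ballI)
    fix b assume b: "b \<in> A6'"
    show "G1 i R a = G1 i R b" by (rule 1(3)) (use sub a b in auto)
    show "G2 i R a = G2 i R b" by (rule 2(3)) (use sub a b in auto)
    show "G3 i a = G3 i b" by (rule 3(3)) (use sub a b in auto)
    show "G4 i a = G4 i b" by (rule 4(3)) (use sub a b in auto)
    show "G5 i a = G5 i b" by (rule 5(3)) (use sub a b in auto)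
    show "G6 i a = G6 i b" by (rule 6(3)) (use sub a b in auto)
  qed (use R sub(6) a in auto)
  have "canonical i A6'"
    unfolding canonical_def
    by (intro conjI[OF sub(7)] conjI[OF 6(2)] exI[of _ R]) (rule ballI, rule Ra)
  then show ?thesis ..
qed

text \<open>Outside the root the sets \<open>Bset i c\<close> are disjoint, so fewer than
  \<open>\<sigma>\<close> coordinates of \<open>q\<close> cannot spoil all points of
  \<open>Z\<close>: some \<open>c\<close> meets \<open>q\<close> only in the root. There its
  conditions take the same values as those of \<open>a\<close>, by \<open>G1\<close> and
  \<open>G2\<close>, so what agreed with \<open>q\<close> still does. The other conclusions come
  from \<open>G3\<close> to \<open>G6\<close>.\<close>

lemma canonical_swap:
  assumes A: "canonical i A" and ij: "i \<in> underS \<kappa> j" and b: "b \<in> A1 j"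
    and a: "a \<in> A" and Z: "Z \<subseteq> A" "\<not> |Z| <o \<sigma>" and q: "q \<in> P"
  obtains c where "c \<in> Z"
    "\<And>y. y \<in> D i \<Longrightarrow> ok y c = ok y a" "ok c b = ok a b"
    "\<And>y z. y \<in> D i \<Longrightarrow> z \<in> S \<Longrightarrow> agree q (m y a z) \<Longrightarrow> agree q (m y c z)"
    "\<And>z. z \<in> S \<Longrightarrow> agree q (m a b z) \<Longrightarrow> agree q (m c b z)"
    "\<And>y y' z z'. y \<in> D i \<Longrightarrow> y' \<in> D i \<Longrightarrow> z \<in> S \<Longrightarrow> z' \<in> S \<Longrightarrow>
      agree (m y a z) (m y' a z') \<Longrightarrow> agree (m y c z) (m y' c z')"
    "\<And>y z z'. y \<in> D i \<Longrightarrow> z \<in> S \<Longrightarrow> z' \<in> S \<Longrightarrow>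
      agree (m y a z) (m a b z') \<Longrightarrow> agree (m y c z) (m c b z')"
proof -
  have i: "i \<in> K" and j: "j \<in> K" using underS_FieldD[OF ij] by auto
  obtain R where R: "\<And>a. a \<in> A \<Longrightarrow> R \<subseteq> Bset i a"
      "\<And>a b. a \<in> A \<Longrightarrow> b \<in> A \<Longrightarrow> a \<noteq> b \<Longrightarrow> Bset i a \<inter> Bset i b = R"
      "\<And>a b. a \<in> A \<Longrightarrow> b \<in> A \<Longrightarrow> G1 i R a = G1 i R b \<and> G2 i R a = G2 i R b \<and>
        G3 i a = G3 i b \<and> G4 i a = G4 i b \<and> G5 i a = G5 i b \<and> G6 i a = G6 i b"
    using A unfolding canonical_def by metis
  have AI: "A \<subseteq> I i" and AD: "A \<subseteq> D j"
    using A A1_homogeneous[OF i] I_below[OF ij] unfolding canonical_def homogeneous_def by auto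
  have Dij: "D i \<subseteq> D j"
    using d_mono[OF ij] underS_trans[OF lam_wo] by blast
  have F: "F1 j (rep j) = F1 j b" "F2 j (rep j) = F2 j b" "F3 j (rep j) = F3 j b"
    using A1_homogeneous[OF j, unfolded homogeneous_def] rep_in_A1[OF j] b by blast+
  \<comment> \<open>Two copies of the support of \<open>q\<close>: as it stands, to be compared with
    the conditions for lower points, and moved along \<open>kb j b\<close>, to be compared with the
    conditions for \<open>b\<close>.\<close>
  define N :: "('n \<times> 's + 'k \<times> 'l) set" where "N = Inl ` dom q \<union> (\<lambda>x. Inr (j, kb j b x)) ` dom q"
  have Ns: "|N| <o \<sigma>"
    unfolding N_def by (intro regular_small_Un sigma_regular small_image dom_small q)
  have "\<exists>c \<in> Z. Bset i c \<inter> N \<subseteq> R"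
  proof (rule ccontr)
    assume neg: "\<not> ?thesis"
    have "\<exists>n. n \<in> Bset i c \<inter> N - R" if "c \<in> Z" for c
      using neg that by blast
    then obtain n where n: "\<And>c. c \<in> Z \<Longrightarrow> n c \<in> Bset i c \<inter> N - R" by metis
    have "inj_on n Z"
    proof (rule inj_onI, rule ccontr)
      fix c c' assume cc: "c \<in> Z" "c' \<in> Z" "n c = n c'" "c \<noteq> c'"
      then have "n c \<in> Bset i c \<inter> Bset i c'" "n c \<notin> R"
        using n[OF cc(1)] n[OF cc(2)] cc(3) by auto
      then show False using R(2) cc Z(1) by blast
    qed
    moreover have "n ` Z \<subseteq> N" using n by blast
    ultimately have "|Z| \<le>o |N|" by (intro card_of_ordLeqI) auto
    then show False using Ns Z(2) ordLeq_ordLess_trans by blast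
  qed
  then obtain c where c: "c \<in> Z" "Bset i c \<inter> N \<subseteq> R" by blast
  have cA: "c \<in> A" using c(1) Z(1) by blast
  note G = R(3)[OF cA a]
  show thesis
  proof (rule that[OF c(1)])
    show "ok y c = ok y a" if "y \<in> D i" for y
      using G that unfolding G5_def by blast
    show "ok c b = ok a b"
    proof -
      have "j \<in> G6 i c \<longleftrightarrow> j \<in> G6 i a" using G by simp
      moreover have "c \<in> D j" "a \<in> D j" using cA a AD by auto
      ultimately show ?thesis
        using ij by (simp only: G6_def F(3) mem_Collect_eq) (simp add: F3_def)
    qed
    show "agree q (m y c z)" if yz: "y \<in> D i" "z \<in> S" and ag: "agree q (m y a z)" for y z
      unfolding agree_def
    proof
      fix x assume x: "x \<in> dom q \<inter> dom (m y c z)"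
      then obtain v where v: "m y c z x = Some v" by blast
      have "Inl x \<in> Bset i c" using x yz by (auto simp: Bset_def T_def)
      moreover have "Inl x \<in> N" using x by (auto simp: N_def)
      ultimately have "Inl x \<in> R" using c(2) by blast
      then have "(y, z, Inl x, v) \<in> G1 i R c" using yz v by (cases x) (simp add: G1_def)
      then have "(y, z, Inl x, v) \<in> G1 i R a" using G by simp
      then have "m y a z x = Some v" unfolding G1_def by blast
      then show "q x = m y c z x" using ag x v unfolding agree_def by (metis Int_iff domI)
    qed
    show "agree q (m c b z)" if z: "z \<in> S" and ag: "agree q (m a b z)" for z
      unfolding agree_def
    proof
      fix x assume x: "x \<in> dom q \<inter> dom (m c b z)"
      then obtain v where v: "m c b z x = Some v" by blast
      have xT: "x \<in> T j b" using x z cA AD by (auto simp: T_def)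
      have cF: "(c, z, kb j b x, v) \<in> F1 j (rep j)"
        using F1_iff[OF j _ z xT] v cA AD F by blast
      then have "Inr (j, kb j b x) \<in> Bset i c" using ij by (auto simp: Bset_def)
      moreover have "Inr (j, kb j b x) \<in> N" using x by (auto simp: N_def)
      ultimately have "Inr (j, kb j b x) \<in> R" using c(2) by blast
      then have "(z, Inr (j, kb j b x), v) \<in> G2 i R c" using z ij cF by (simp add: G2_def)
      then have "(z, Inr (j, kb j b x), v) \<in> G2 i R a" using G by simp
      then have "(a, z, kb j b x, v) \<in> F1 j b" using F by (simp add: G2_def)
      then have "m a b z x = Some v" using F1_iff[OF j _ z xT] a AD by blast
      then show "q x = m c b z x" using ag x v unfolding agree_def by (metis Int_iff domI)
    qed
    show "agree (m y c z) (m y' c z')"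
      if "y \<in> D i" "y' \<in> D i" "z \<in> S" "z' \<in> S" "agree (m y a z) (m y' a z')" for y y' z z'
    proof -
      have "(y, y', z, z') \<in> G3 i a" using that by (simp add: G3_def)
      then have "(y, y', z, z') \<in> G3 i c" using G by simp
      then show ?thesis by (simp add: G3_def)
    qed
    show "agree (m y c z) (m c b z')"
      if "y \<in> D i" "z \<in> S" "z' \<in> S" "agree (m y a z) (m a b z')" for y z z'
    proof -
      have "(y, a, z, z') \<in> F2 j b" using that a AD Dij by (auto simp: F2_def)
      then have "(j, y, z, z') \<in> G4 i a" using that ij F(2) by (simp add: G4_def)
      then have "(j, y, z, z') \<in> G4 i c" using G by simp
      then have "(y, c, z, z') \<in> F2 j b" using F(2) by (simp add: G4_def)
      then show ?thesis by (simp add: F2_def)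
    qed
  qed
qed

section \<open>Representatives of the pieces\<close>

definition A :: "'k \<Rightarrow> 'l set"
  where "A k = (SOME X. canonical k X)"

lemma A_canonical: "k \<in> K \<Longrightarrow> canonical k (A k)"
  unfolding A_def using ex_canonical by (rule someI_ex)

lemma A_sub: "k \<in> K \<Longrightarrow> A k \<subseteq> A1 k" and A_card: "k \<in> K \<Longrightarrow> |A k| =o L k"
  using A_canonical unfolding canonical_def by blast+

lemma A_I: "k \<in> K \<Longrightarrow> A k \<subseteq> I k"
  using A_sub A1_homogeneous unfolding homogeneous_def by blast

lemma S_less_L: "k \<in> K \<Longrightarrow> |S| <o L k"
  using S_le card_of_Pow cardSuc_greater[OF card_of_Card_order] ordLess_transitive
    ordLeq_ordLess_trans by metis

text \<open>The size \<open>\<sigma>\<close> is large enough for \<open>canonical_swap\<close> and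
  small enough for \<open>Zl_small\<close>.\<close>

definition Z :: "'k \<Rightarrow> 'l set"
  where "Z k = (SOME X. X \<subseteq> A k \<and> |X| =o \<sigma>)"

lemma Z_subset:
  assumes k: "k \<in> K"
  shows "Z k \<subseteq> A k \<and> |Z k| =o \<sigma>"
proof -
  have "|S| \<le>o |A k|"
    using S_less_L[OF k] A_card[OF k] ordIso_symmetric ordLess_ordIso_trans ordLess_imp_ordLeq by metis
  then obtain g where g: "inj_on g S" "g ` S \<subseteq> A k"
    by (metis card_of_ordLeq)
  have "|g ` S| =o \<sigma>"
    using card_of_eq_image[OF g(1)] card_of_Field_ordIso[OF sigma_card] by (rule ordIso_transitive)
  then have "\<exists>X. X \<subseteq> A k \<and> |X| =o \<sigma>" using g(2) by metis
  then show ?thesis unfolding Z_def by (rule someI_ex)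
qed

lemma Z_big: "k \<in> K \<Longrightarrow> \<not> |Z k| <o \<sigma>"
  using Z_subset not_ordLess_ordIso by metis

definition Zl :: "'k \<Rightarrow> 'l set"
  where "Zl k = (\<Union>i \<in> underS \<kappa> k. Z i)"

lemma Zl_D: "k \<in> K \<Longrightarrow> Zl k \<subseteq> D k"
proof -
  have "Z i \<subseteq> D k" if "i \<in> underS \<kappa> k" for i
    using Z_subset A_I I_below[OF that] underS_FieldD[OF that] by (meson order_trans)
  then show ?thesis by (auto simp: Zl_def)
qed

section \<open>Stuck cliques, made uniform on each piece\<close>

lemma D_below_I:
  assumes k: "k \<in> K" and x: "x \<in> D k" and b: "b \<in> I k"
  shows "x \<in> underS lam b"
proof -
  have "b \<notin> D k" using I_above[OF k] b by blast
  then have "b = d k \<or> d k \<in> underS lam b"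
    using underS_total[OF lam_wo, of b "d k"] I_Field[OF k] d_Field[OF k] b by blast
  then show ?thesis using x underS_trans[OF lam_wo x] by auto
qed

text \<open>Being forced green is replaced by extending a listed condition, so that greenness of
  several pairs at once reduces to agreement of conditions \<open>m\<close>. With the antichains
  chosen in \<open>theorem3\<close>, every condition that forces green has an extension with
  \<open>Grm\<close>.\<close>

definition Grm :: "'l \<Rightarrow> 'l \<Rightarrow> ('n \<times> 's \<rightharpoonup> bool) \<Rightarrow> bool"
  where "Grm a b q \<longleftrightarrow> q \<in> P \<and> ok a b \<and> (\<exists>z \<in> S. m a b z \<subseteq>\<^sub>m q)"

sublocale col: cohen_coloring \<sigma> \<nu> lam \<theta> Grm
proof
  show "Grm a b q" if "Grm a b p" "q \<in> P" "p \<subseteq>\<^sub>m q" for a b p q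
    using that map_le_trans unfolding Grm_def by blast
qed (simp_all add: lam_card theta_card theta_le Grm_def)

text \<open>\<open>f1\<close> is a maximal clique among the representatives below the piece of \<open>b\<close>, and
  \<open>f2\<close> one within that piece.\<close>

definition stuck :: "'k \<Rightarrow> 'l \<Rightarrow> ('n \<times> 's \<rightharpoonup> bool) \<Rightarrow> 'l set \<Rightarrow> 'l set \<Rightarrow> bool"
  where "stuck k b q f1 f2 \<longleftrightarrow> q \<in> P \<and>
    (f1 \<subseteq> Zl k \<and> |f1| <o \<theta> \<and> (\<forall>y \<in> f1. Grm y b q) \<and>
      (\<forall>r a. r \<in> P \<longrightarrow> q \<subseteq>\<^sub>m r \<longrightarrow> a \<in> Zl k \<longrightarrow> f1 \<subseteq> underS lam a \<longrightarrow>
        \<not> ((\<forall>y \<in> f1. Grm y a r) \<and> Grm a b r))) \<and>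
    (f2 \<subseteq> A k \<inter> underS lam b \<and> |f2| <o \<theta> \<and> (\<forall>y \<in> f2. Grm y b q) \<and>
      (\<forall>r a. r \<in> P \<longrightarrow> q \<subseteq>\<^sub>m r \<longrightarrow> a \<in> A k \<inter> underS lam b \<longrightarrow> f2 \<subseteq> underS lam a \<longrightarrow>
        \<not> ((\<forall>y \<in> f2. Grm y a r) \<and> Grm a b r)))"

text \<open>\<open>greedy\<close> is applied twice, the second time below the condition found by the
  first. This is sound because being stuck is inherited by all extensions of a condition.\<close>

lemma ex_stuck:
  assumes p: "p \<in> P" and no: "\<And>b q H. q \<in> P \<Longrightarrow> p \<subseteq>\<^sub>m q \<Longrightarrow> \<not> col.green_system b q H"
    and k: "k \<in> K" and b: "b \<in> I k"
  shows "\<exists>q f1 f2. p \<subseteq>\<^sub>m q \<and> stuck k b q f1 f2"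
proof -
  have "Zl k \<subseteq> underS lam b"
    using Zl_D[OF k] D_below_I[OF k _ b] by blast
  from col.greedy[OF this p no[OF p map_le_refl]] obtain q1 f1 where q1: "q1 \<in> P" "p \<subseteq>\<^sub>m q1"
      and f1: "f1 \<subseteq> Zl k" "|f1| <o \<theta>" "\<forall>y \<in> f1. Grm y b q1"
        "\<forall>r a. r \<in> P \<longrightarrow> q1 \<subseteq>\<^sub>m r \<longrightarrow> a \<in> Zl k \<longrightarrow> f1 \<subseteq> underS lam a \<longrightarrow>
          \<not> ((\<forall>y \<in> f1. Grm y a r) \<and> Grm a b r)"
    by (elim exE conjE) (rule that)
  have "A k \<inter> underS lam b \<subseteq> underS lam b" by blast
  from col.greedy[OF this q1(1) no[OF q1]] obtain q f2 where q: "q \<in> P" "q1 \<subseteq>\<^sub>m q"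
      and f2: "f2 \<subseteq> A k \<inter> underS lam b" "|f2| <o \<theta>" "\<forall>y \<in> f2. Grm y b q"
        "\<forall>r a. r \<in> P \<longrightarrow> q \<subseteq>\<^sub>m r \<longrightarrow> a \<in> A k \<inter> underS lam b \<longrightarrow> f2 \<subseteq> underS lam a \<longrightarrow>
          \<not> ((\<forall>y \<in> f2. Grm y a r) \<and> Grm a b r)"
    by (elim exE conjE) (rule that)
  have "p \<subseteq>\<^sub>m q" using map_le_trans[OF q1(2) q(2)] .
  moreover have "\<forall>y \<in> f1. Grm y b q" using f1(3) col.Gr_open q by blast
  moreover have "\<forall>r a. r \<in> P \<longrightarrow> q \<subseteq>\<^sub>m r \<longrightarrow> a \<in> Zl k \<longrightarrow> f1 \<subseteq> underS lam a \<longrightarrow>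
      \<not> ((\<forall>y \<in> f1. Grm y a r) \<and> Grm a b r)"
    using f1(4) map_le_trans[OF q(2)] by blast
  ultimately show ?thesis
    unfolding stuck_def using q(1) f1(1,2) f2 by (intro exI[of _ q] exI[of _ f1] exI[of _ f2] conjI)
qed

definition thinned :: "'k \<Rightarrow> 'l set \<Rightarrow> ('l \<Rightarrow> ('n \<times> 's \<rightharpoonup> bool)) \<Rightarrow> ('n \<times> 's \<rightharpoonup> bool) \<Rightarrow> 'l set \<Rightarrow> 'l set \<Rightarrow> bool"
  where "thinned k B q r f1 f2 \<longleftrightarrow> B \<subseteq> A k \<and> |B| =o L k \<and> (\<forall>b \<in> B. stuck k b (q b) f1 f2 \<and> r \<subseteq>\<^sub>m q b \<and>
    (\<forall>b' \<in> B. b \<noteq> b' \<longrightarrow> dom (q b) \<inter> dom (q b') = dom r))"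

text \<open>The clique \<open>f1\<close> lies in \<open>D k\<close> and is made constant by
  \<open>thin\<close>. The clique \<open>f2\<close> ranges over the whole piece, which has too many
  subsets for that; pressing down first confines it below one point \<open>a0\<close>, where the
  small subsets can be counted.\<close>

lemma ex_thinned:
  assumes p: "p \<in> P" and no: "\<And>b q H. q \<in> P \<Longrightarrow> p \<subseteq>\<^sub>m q \<Longrightarrow> \<not> col.green_system b q H"
    and k: "k \<in> K"
  shows "\<exists>B q r f1 f2. thinned k B q r f1 f2 \<and> p \<subseteq>\<^sub>m r"
proof -
  note inf = D_inf[OF k]
  define \<tau> where "\<tau> = cardSuc |D k|"
  have t: "regular_card \<tau>" "\<tau> <o L k"
  proof -
    show "regular_card \<tau>"
      using inf unfolding \<tau>_def
      by (intro regular_card_cardSuc) (auto simp: Field_card_of card_of_card_order_on)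
    have "\<tau> \<le>o |Pow (D k)|"
      unfolding \<tau>_def by (intro cardSuc_least card_of_Card_order card_of_Pow)
    then show "\<tau> <o L k"
      using cardSuc_greater[OF card_of_Card_order] ordLeq_ordLess_trans by metis
  qed
  have s_t: "|X| <o \<tau>" if "|X| <o \<sigma>" for X :: "'x set"
    using small_imp_le_D[OF k that] cardSuc_greater[OF card_of_Card_order] ordLeq_ordLess_trans
    unfolding \<tau>_def by metis
  have sp: "small_powers (L k) \<tau>"
    using small_powers_cardSuc_Pow[OF inf] by (simp add: \<tau>_def)
  have LC: "Card_order (L k)" by (simp add: cardSuc_Card_order card_of_Card_order)
  have "\<forall>b. \<exists>t. b \<in> A k \<longrightarrow> p \<subseteq>\<^sub>m fst t \<and> stuck k b (fst t) (fst (snd t)) (snd (snd t))"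
    using ex_stuck[OF p no k] A_I[OF k] by (metis fst_conv snd_conv subsetD)
  from choice[OF this] obtain t where t0: "\<forall>b. b \<in> A k \<longrightarrow>
      p \<subseteq>\<^sub>m fst (t b) \<and> stuck k b (fst (t b)) (fst (snd (t b))) (snd (snd (t b)))"
    by (elim exE) (rule that)
  define q where "q b = fst (t b)" for b
  define f1 where "f1 b = fst (snd (t b))" for b
  define f2 where "f2 b = snd (snd (t b))" for b
  have st: "p \<subseteq>\<^sub>m q b" "stuck k b (q b) (f1 b) (f2 b)" if "b \<in> A k" for b
    using t0 that by (simp_all add: q_def f1_def f2_def)
  have f2: "f2 b \<subseteq> A k \<inter> underS lam b" "|f2 b| <o \<tau>" if "b \<in> A k" for b
    using st(2)[OF that] s_t[OF ordLess_ordLeq_trans[OF _ theta_le]] unfolding stuck_def by blast+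
  have "\<exists>a0 \<in> A k. |{a \<in> A k. f2 a \<subseteq> underS lam a0}| =o L k"
  proof (rule pressing_down[OF L_regular[OF k] A_card[OF k] lam_wo _ _ t])
    show "A k \<subseteq> Field lam" using A_I[OF k] I_Field[OF k] by blast
    show "|A k \<inter> underS lam a| <o L k" if "a \<in> A k" for a
      by (rule small_subset[OF I_initial[OF k, of a]]) (use A_I[OF k] that in auto)
  qed (use f2 in auto)
  then obtain a0 where a0: "a0 \<in> A k" "|{a \<in> A k. f2 a \<subseteq> underS lam a0}| =o L k"
    by (elim bexE) (rule that)
  define X where "X = {a \<in> A k. f2 a \<subseteq> underS lam a0}"
  have XL: "|X| =o L k" using a0(2) by (simp add: X_def)
  have "|A k \<inter> underS lam a0| <o L k"
    by (rule small_subset[OF I_initial[OF k, of a0]]) (use A_I[OF k] a0(1) in auto)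
  then have "|{Y. Y \<subseteq> A k \<inter> underS lam a0 \<and> |Y| <o \<tau>}| <o L k"
    by (rule small_powers_transfer[OF sp LC])
  then have "|f2 ` X| <o L k"
    by (rule small_subset) (use f2 in \<open>auto simp: X_def\<close>)
  from pigeonhole_regular[OF L_regular[OF k] XL this]
  obtain g2 where g2: "|{a \<in> X. f2 a = g2}| =o L k" by (elim exE) (rule that)
  have f1: "f1 b \<subseteq> D k" if "b \<in> {a \<in> X. f2 a = g2}" for b
    using st(2)[of b] that Zl_D[OF k] unfolding stuck_def X_def by blast
  obtain Y where Y: "Y \<subseteq> {a \<in> X. f2 a = g2}" "|Y| =o L k" "\<And>a b. a \<in> Y \<Longrightarrow> b \<in> Y \<Longrightarrow> f1 a = f1 b"
  proof (rule thin[OF inf g2])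
    show "f1 b \<subseteq> D k" if "b \<in> {a \<in> X. f2 a = g2}" for b
      using that by (rule f1)
    show "|D k| \<le>o |D k|" by (rule card_of_refl[THEN ordIso_imp_ordLeq])
  qed (rule that)
  have YA: "Y \<subseteq> A k" using Y(1) by (auto simp: X_def)
  have qs: "|dom (q b)| <o \<tau>" if "b \<in> Y" for b
  proof -
    have "q b \<in> P" using st(2)[of b] that YA unfolding stuck_def by blast
    then show ?thesis by (intro s_t dom_small)
  qed
  have "\<exists>B \<subseteq> Y. |B| =o L k \<and> (\<exists>r. \<forall>a \<in> B. r \<subseteq>\<^sub>m q a \<and>
      (\<forall>b \<in> B. a \<noteq> b \<longrightarrow> dom (q a) \<inter> dom (q b) = dom r))"
    by (rule delta_system_conditions[OF L_regular[OF k] Y(2) t qs sp])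
  then obtain B r where B: "B \<subseteq> Y" "|B| =o L k" and r: "\<forall>a \<in> B. r \<subseteq>\<^sub>m q a \<and>
      (\<forall>b \<in> B. a \<noteq> b \<longrightarrow> dom (q a) \<inter> dom (q b) = dom r)"
    by (elim exE conjE) (rule that)
  obtain b0 where b0: "b0 \<in> B"
    by (rule big_minus_small[OF B(2) regular_small_singleton[OF L_regular[OF k]]])
  obtain b1 where b1: "b1 \<in> B" "b1 \<notin> {b0}"
    by (rule big_minus_small[OF B(2) regular_small_singleton[OF L_regular[OF k]]])
  have BA: "B \<subseteq> A k" using B(1) YA by blast
  have fs: "f1 b = f1 b0" "f2 b = g2" if "b \<in> B" for b
  proof -
    show "f1 b = f1 b0" by (rule Y(3)) (use that b0 B(1) in auto)
    show "f2 b = g2" using that B(1) Y(1) by auto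
  qed
  have "stuck k b (q b) (f1 b0) g2" if "b \<in> B" for b
    using st(2)[of b] fs[OF that] that BA by auto
  then have "thinned k B q r (f1 b0) g2"
    unfolding thinned_def using BA B(2) r by simp
  \<comment> \<open>Two different conditions of the Delta-system extend \<open>p\<close>, and their
    domains meet exactly in the domain of \<open>r\<close>.\<close>
  moreover have "p \<subseteq>\<^sub>m r"
    unfolding map_le_def
  proof
    fix x assume x: "x \<in> dom p"
    have le: "p \<subseteq>\<^sub>m q b0" "p \<subseteq>\<^sub>m q b1" using st(1) BA b0 b1(1) by auto
    then have "x \<in> dom (q b0) \<inter> dom (q b1)"
      using x map_le_implies_dom_le by blast
    moreover have "dom (q b0) \<inter> dom (q b1) = dom r" using r b0 b1 by auto
    ultimately have "x \<in> dom r" by simp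
    moreover have "r \<subseteq>\<^sub>m q b0" using r b0 by blast
    ultimately show "p x = r x" using le(1) x by (simp add: map_le_def)
  qed
  ultimately show ?thesis by blast
qed

section \<open>One clique for \<open>\<kappa>\<close> many pieces\<close>

lemma Zl_small: "k \<in> K \<Longrightarrow> |Zl k| <o \<kappa>"
  unfolding Zl_def
proof (rule regular_small_UN[OF kappa_regular])
  assume k: "k \<in> K"
  show "|underS \<kappa> k| <o \<kappa>" by (rule card_of_underS[OF kappa_card k])
  fix i assume "i \<in> underS \<kappa> k"
  then have "i \<in> K" using underS_FieldD by metis
  then show "|Z i| <o \<kappa>"
    using Z_subset sigma_less ordIso_ordLess_trans by metis
qed

lemma small_subsets_Zl:
  assumes k: "k \<in> K"
  shows "|{f. f \<subseteq> Zl k \<and> |f| <o \<theta>}| <o \<kappa>"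
proof -
  obtain g where g: "inj_on g (Zl k)" "g ` Zl k \<subseteq> K"
    using ordLess_card_of_inj[OF kappa_card Zl_small[OF k]] .
  have c: "Card_order |g ` Zl k|" by (rule card_of_Card_order)
  have "|Zl k| \<le>o |g ` Zl k|"
    using card_of_eq_image[OF g(1)] ordIso_symmetric ordIso_imp_ordLeq by metis
  then have "|{f. f \<subseteq> Zl k \<and> |f| <o \<theta>}| \<le>o cexp_less |g ` Zl k| \<theta>"
    by (rule card_of_small_subsets_le[OF theta_card c])
  moreover have "cexp_less |g ` Zl k| \<theta> <o \<kappa>"
    by (rule theta_exp[OF c small_image[OF Zl_small[OF k]]])
  ultimately show ?thesis by (rule ordLeq_ordLess_trans)
qed

text \<open>Pressing down is applied to the indices of the pieces that \<open>f k\<close> meets, a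
  set of fewer than \<open>\<sigma>\<close> indices below \<open>k\<close>. Afterwards all remaining
  cliques consist of representatives below one fixed piece, and \<open>theta_exp\<close> leaves
  fewer than \<open>\<kappa>\<close> possibilities.\<close>

lemma ex_common_clique:
  assumes f: "\<And>k. k \<in> K \<Longrightarrow> f k \<subseteq> Zl k \<and> |f k| <o \<theta>"
  shows "\<exists>X g. X \<subseteq> K \<and> |X| =o \<kappa> \<and> (\<forall>k \<in> X. f k = g)"
proof -
  have "\<exists>i. i \<in> underS \<kappa> k \<and> y \<in> Z i" if "k \<in> K" "y \<in> f k" for k y
    using f[OF that(1)] that(2) unfolding Zl_def by blast
  then obtain ix where ix: "\<And>k y. k \<in> K \<Longrightarrow> y \<in> f k \<Longrightarrow> ix k y \<in> underS \<kappa> k \<and> y \<in> Z (ix k y)"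
    by metis
  note KK = card_of_Field_ordIso[OF kappa_card]
  have "\<exists>a0 \<in> K. |{a \<in> K. ix a ` f a \<subseteq> underS \<kappa> a0}| =o \<kappa>"
  proof (rule pressing_down[OF kappa_regular KK kappa_wo subset_refl _ sigma_regular sigma_less])
    show "|K \<inter> underS \<kappa> a| <o \<kappa>" if "a \<in> K" for a
      using card_of_underS[OF kappa_card that] by (rule small_subset) auto
    show "ix a ` f a \<subseteq> K \<inter> underS \<kappa> a \<and> |ix a ` f a| <o \<sigma>" if "a \<in> K" for a
    proof
      show "ix a ` f a \<subseteq> K \<inter> underS \<kappa> a"
        using ix[OF that] underS_FieldD by fastforce
      show "|ix a ` f a| <o \<sigma>"
        using f[OF that] ordLess_ordLeq_trans[OF _ theta_le] by (intro small_image) blast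
    qed
  qed
  then obtain k0 where k0: "k0 \<in> K" "|{a \<in> K. ix a ` f a \<subseteq> underS \<kappa> k0}| =o \<kappa>"
    by (elim bexE) (rule that)
  define X where "X = {a \<in> K. ix a ` f a \<subseteq> underS \<kappa> k0}"
  have XK: "|X| =o \<kappa>" using k0(2) by (simp add: X_def)
  have "f ` X \<subseteq> {f. f \<subseteq> Zl k0 \<and> |f| <o \<theta>}"
  proof
    fix h assume "h \<in> f ` X"
    then obtain k where k: "k \<in> K" "ix k ` f k \<subseteq> underS \<kappa> k0" "h = f k"
      by (auto simp: X_def)
    have "y \<in> Zl k0" if "y \<in> f k" for y
    proof -
      have "ix k y \<in> underS \<kappa> k0" using k(2) that by auto
      then show ?thesis using ix[OF k(1) that] by (auto simp: Zl_def)
    qed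
    then show "h \<in> {f. f \<subseteq> Zl k0 \<and> |f| <o \<theta>}"
      using f[OF k(1)] k(3) by auto
  qed
  then have "|f ` X| <o \<kappa>"
    by (rule small_subset[OF small_subsets_Zl[OF k0(1)]])
  from pigeonhole_regular[OF kappa_regular XK this]
  obtain g where "|{a \<in> X. f a = g}| =o \<kappa>" by (elim exE) (rule that)
  then show ?thesis
    by (intro exI[of _ "{a \<in> X. f a = g}"] exI[of _ g]) (auto simp: X_def)
qed

text \<open>The heart of the proof: a green pair \<open>a\<close>, \<open>b\<close> from different pieces could be
  moved to a pair \<open>c\<close>, \<open>b\<close> with \<open>c\<close> a representative, and then \<open>c\<close> would
  extend the maximal clique of \<open>b\<close>.\<close>

lemma red_pair:
  assumes 1: "thinned i B q r f f2" and 2: "thinned j B' q' r' f f2'"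
    and i: "i \<in> K" and j: "j \<in> K" and a: "a \<in> B" and b: "b \<in> B'" and ab: "a \<in> underS lam b"
    and same: "i = j \<Longrightarrow> B = B' \<and> q = q' \<and> f2 = f2'"
    and s: "q a \<subseteq>\<^sub>m s" "q' b \<subseteq>\<^sub>m s"
  shows "\<not> Grm a b s"
proof
  assume g: "Grm a b s"
  then have sP: "s \<in> P" by (simp add: Grm_def)
  have aA: "a \<in> A i" and sa: "stuck i a (q a) f f2"
    using 1 a by (auto simp: thinned_def)
  have bA: "b \<in> A j" and sb: "stuck j b (q' b) f f2'"
    using 2 b by (auto simp: thinned_def)
  have qa: "q a \<in> P" and qb: "q' b \<in> P" using sa sb by (simp_all add: stuck_def)
  consider "i = j" | "j \<in> underS \<kappa> i" | "i \<in> underS \<kappa> j"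
    using underS_total[OF kappa_wo i j] by blast
  then show False
  proof cases
    \<comment> \<open>Both points share the second clique \<open>f2'\<close>. It lies below
      \<open>a\<close> and is green with \<open>a\<close>, so \<open>a\<close> itself would enlarge
      the clique of \<open>b\<close>.\<close>
    case 1
    then have e: "f2 = f2'" using same by blast
    have "f2' \<subseteq> underS lam a" "\<forall>y \<in> f2'. Grm y a (q a)"
      using sa unfolding stuck_def e by blast+
    moreover have "\<forall>y \<in> f2'. Grm y a s"
      using calculation(2) col.Gr_open[OF _ sP s(1)] by blast
    moreover have "a \<in> A j \<inter> underS lam b" using aA ab 1 by blast
    ultimately show False
      using sb g sP s(2) unfolding stuck_def by blast
  next
    \<comment> \<open>Impossible: everything below \<open>b\<close> lies below the whole later piece
      of \<open>a\<close>.\<close>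
    case 2
    have "b \<in> D i" using I_below[OF 2] bA A_I[OF j] by blast
    then have "a \<in> D i" using ab underS_trans[OF lam_wo] by blast
    then show False using I_above[OF i] aA A_I[OF i] by blast
  next
    case 3
    have bA1: "b \<in> A1 j" using bA A_sub[OF j] by blast
    have fD: "f \<subseteq> D i" and ga: "\<forall>y \<in> f. Grm y a (q a)" and fs: "|f| <o \<theta>"
      using sa Zl_D[OF i] unfolding stuck_def by blast+
    obtain \<zeta> where \<zeta>: "\<And>y. y \<in> f \<Longrightarrow> ok y a \<and> \<zeta> y \<in> S \<and> m y a (\<zeta> y) \<subseteq>\<^sub>m q a"
      using ga unfolding Grm_def by metis
    obtain z where z: "ok a b" "z \<in> S" "m a b z \<subseteq>\<^sub>m s" using g unfolding Grm_def by blast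
    have my: "m y a (\<zeta> y) \<subseteq>\<^sub>m s" if "y \<in> f" for y
      using \<zeta>[OF that] s(1) map_le_trans by blast
    obtain c where c: "c \<in> Z i"
        "\<And>y. y \<in> D i \<Longrightarrow> ok y c = ok y a" "ok c b = ok a b"
        "\<And>y z. y \<in> D i \<Longrightarrow> z \<in> S \<Longrightarrow> agree (q' b) (m y a z) \<Longrightarrow> agree (q' b) (m y c z)"
        "\<And>z. z \<in> S \<Longrightarrow> agree (q' b) (m a b z) \<Longrightarrow> agree (q' b) (m c b z)"
        "\<And>y y' z z'. y \<in> D i \<Longrightarrow> y' \<in> D i \<Longrightarrow> z \<in> S \<Longrightarrow> z' \<in> S \<Longrightarrow>
          agree (m y a z) (m y' a z') \<Longrightarrow> agree (m y c z) (m y' c z')"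
        "\<And>y z z'. y \<in> D i \<Longrightarrow> z \<in> S \<Longrightarrow> z' \<in> S \<Longrightarrow>
          agree (m y a z) (m a b z') \<Longrightarrow> agree (m y c z) (m c b z')"
      by (rule canonical_swap[OF A_canonical[OF i] 3 bA1 aA _ Z_big[OF i] qb]) (use Z_subset[OF i] in blast, rule that)
    \<comment> \<open>With \<open>a\<close> in place of \<open>c\<close>, all these conditions are
      extended by \<open>s\<close> and so agree in pairs; \<open>canonical_swap\<close> transfers
      each of these agreements. Hence their union is a condition, and under it \<open>c\<close>
      enlarges the clique \<open>f\<close> of \<open>b\<close>.\<close>
    define R where "R = ({q' b} \<union> {m c b z}) \<union> (\<lambda>y. m y c (\<zeta> y)) ` f"
    have y1: "agree (q' b) (m c b z)"
      by (intro c(5) z agree_if_le[OF s(2) z(3)])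
    have y2: "agree (q' b) (m y c (\<zeta> y))" if "y \<in> f" for y
      using that fD \<zeta>[OF that] by (intro c(4) agree_if_le[OF s(2) my]) auto
    have y3: "agree (m y c (\<zeta> y)) (m c b z)" if "y \<in> f" for y
      using that fD \<zeta>[OF that] z(2) by (intro c(7) agree_if_le[OF my z(3)]) auto
    have y4: "agree (m y c (\<zeta> y)) (m y' c (\<zeta> y'))" if "y \<in> f" "y' \<in> f" for y y'
      using that fD \<zeta>[OF that(1)] \<zeta>[OF that(2)] by (intro c(6) agree_if_le[OF my my]) auto
    have ag: "agree x y" if "x \<in> R" "y \<in> R" for x y
      using that y1 y2 y3 y4 agree_sym agree_refl unfolding R_def by blast
    have "|f| <o \<sigma>" using fs theta_le by (rule ordLess_ordLeq_trans)
    then have "|R| <o \<sigma>"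
      unfolding R_def by (intro regular_small_Un sigma_regular regular_small_singleton small_image)
    moreover have "R \<subseteq> P" using qb m_P by (auto simp: R_def)
    ultimately have GP: "Glue R \<in> P" by (intro Glue_in_P)
    have le: "x \<subseteq>\<^sub>m Glue R" if "x \<in> R" for x
      by (rule le_Glue[OF ag that])
    have "\<forall>y \<in> f. Grm y c (Glue R)"
    proof
      fix y assume y: "y \<in> f"
      have "m y c (\<zeta> y) \<subseteq>\<^sub>m Glue R" using y by (intro le) (auto simp: R_def)
      then show "Grm y c (Glue R)"
        using GP \<zeta>[OF y] c(2)[of y] y fD unfolding Grm_def by blast
    qed
    moreover have "Grm c b (Glue R)"
    proof -
      have "m c b z \<subseteq>\<^sub>m Glue R" by (intro le) (auto simp: R_def)
      then show ?thesis using GP z c(3) unfolding Grm_def by blast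
    qed
    moreover have "q' b \<subseteq>\<^sub>m Glue R" by (intro le) (auto simp: R_def)
    moreover have "c \<in> Zl j" using c(1) 3 by (auto simp: Zl_def)
    moreover have "f \<subseteq> underS lam c"
      using fD D_below_I[OF i, of _ c] c(1) Z_subset[OF i] A_I[OF i] by blast
    ultimately show False
      using sb GP unfolding stuck_def by blast
  qed
qed

text \<open>\<open>H\<close> acts as a name, below \<open>p\<close>, for an injection of
  \<open>lam\<close> into \<open>lam\<close> with red range; \<open>H x b q\<close> means that
  \<open>q\<close> decides the value at \<open>x\<close> to be \<open>b\<close>. Unlike a green
  sequence it need not be increasing, since only the size of the range matters.\<close>

definition red_system :: "('n \<times> 's \<rightharpoonup> bool) \<Rightarrow> ('l \<Rightarrow> 'l \<Rightarrow> ('n \<times> 's \<rightharpoonup> bool) \<Rightarrow> bool) \<Rightarrow> bool"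
  where "red_system p H \<longleftrightarrow>
    (\<forall>x b q. H x b q \<longrightarrow> q \<in> P \<and> x \<in> Field lam \<and> b \<in> Field lam) \<and>
    (\<forall>x b q r. H x b q \<longrightarrow> r \<in> P \<longrightarrow> q \<subseteq>\<^sub>m r \<longrightarrow> H x b r) \<and>
    (\<forall>x b b' q. H x b q \<longrightarrow> H x b' q \<longrightarrow> b = b') \<and>
    (\<forall>x y b q. H x b q \<longrightarrow> H y b q \<longrightarrow> x = y) \<and>
    (\<forall>x \<in> Field lam. \<forall>q \<in> P. p \<subseteq>\<^sub>m q \<longrightarrow> (\<exists>r b. q \<subseteq>\<^sub>m r \<and> H x b r)) \<and>
    (\<forall>x y a b q. H x a q \<longrightarrow> H y b q \<longrightarrow> a \<in> underS lam b \<longrightarrow> \<not> Grm a b q)"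

text \<open>Otherwise the conditions that disagree with a whole tail of the roots are dense below
  every extension of \<open>p\<close>. A maximal antichain of such conditions has at most
  \<open>\<sigma>\<close> members, so by regularity of \<open>\<kappa>\<close> one tail serves for
  all of them. A root in that tail extends \<open>p\<close> but agrees with no member, which
  contradicts maximality.\<close>

lemma ex_generic_roots:
  assumes X: "X \<subseteq> K" "|X| =o \<kappa>" and p: "p \<in> P" and r: "\<And>j. j \<in> X \<Longrightarrow> r j \<in> P \<and> p \<subseteq>\<^sub>m r j"
  shows "\<exists>p' \<in> P. p \<subseteq>\<^sub>m p' \<and> (\<forall>q \<in> P. p' \<subseteq>\<^sub>m q \<longrightarrow> (\<forall>k \<in> K. \<exists>j \<in> X. k \<in> underS \<kappa> j \<and> agree (r j) q))"
proof (rule ccontr)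
  assume neg: "\<not> ?thesis"
  define bad where "bad = {q \<in> P. \<exists>k \<in> K. \<forall>j \<in> X. k \<in> underS \<kappa> j \<longrightarrow> \<not> agree (r j) q}"
  have neg': "\<exists>q \<in> bad. p' \<subseteq>\<^sub>m q" if "p' \<in> P" "p \<subseteq>\<^sub>m p'" for p'
    using neg that unfolding bad_def by blast
  obtain M where M: "M \<subseteq> bad" "pairwise (\<lambda>p q. \<not> agree p q) M"
      "\<And>q. q \<in> bad \<Longrightarrow> (\<forall>m \<in> M. \<not> agree q m \<and> \<not> agree m q) \<Longrightarrow> q \<in> M"
    using ex_maximal_pairwise[of bad "\<lambda>p q. \<not> agree p q"] by auto
  have "|M| \<le>o \<sigma>"
    using M(1,2) by (intro antichain_small) (auto simp: bad_def)
  then have Ms: "|M| <o \<kappa>" using sigma_less by (rule ordLeq_ordLess_trans)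
  have "\<forall>q. \<exists>k. q \<in> M \<longrightarrow> k \<in> K \<and> (\<forall>j \<in> X. k \<in> underS \<kappa> j \<longrightarrow> \<not> agree (r j) q)"
    using M(1) unfolding bad_def by blast
  from choice[OF this] obtain g where
      g: "\<forall>q. q \<in> M \<longrightarrow> g q \<in> K \<and> (\<forall>j \<in> X. g q \<in> underS \<kappa> j \<longrightarrow> \<not> agree (r j) q)"
    by (elim exE) (rule that)
  have "\<exists>k \<in> K. g ` M \<subseteq> underS \<kappa> k"
    using g by (intro regular_small_bounded[OF kappa_regular] small_image[OF Ms]) auto
  then obtain k where k: "k \<in> K" "g ` M \<subseteq> underS \<kappa> k" by (elim bexE) (rule that)
  obtain j where j: "j \<in> X" "k \<in> underS \<kappa> j"
    by (rule not_subset_small[OF X(2) kappa_regular k(1) X(1)])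
  obtain q where q: "q \<in> bad" "r j \<subseteq>\<^sub>m q" using neg' r[OF j(1)] by blast
  obtain n where n: "n \<in> M" "agree q n"
    using M(3)[OF q(1)] agree_sym agree_refl by blast
  have "agree (r j) n" using agree_mono[OF n(2) q(2) map_le_refl] .
  moreover have "g n \<in> underS \<kappa> j"
    using k(2) n(1) j(2) underS_trans[OF kappa_wo] by blast
  ultimately show False using g n(1) j(1) by blast
qed

theorem red_or_green:
  assumes p: "p \<in> P" and no: "\<And>b q H. q \<in> P \<Longrightarrow> p \<subseteq>\<^sub>m q \<Longrightarrow> \<not> col.green_system b q H"
  shows "\<exists>p' H. p' \<in> P \<and> p \<subseteq>\<^sub>m p' \<and> red_system p' H"
proof -
  have "\<forall>k. \<exists>t. k \<in> K \<longrightarrow> thinned k (fst t) (fst (snd t)) (fst (snd (snd t)))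
      (fst (snd (snd (snd t)))) (snd (snd (snd (snd t)))) \<and> p \<subseteq>\<^sub>m fst (snd (snd t))"
    using ex_thinned[OF p no] by (metis fst_conv snd_conv)
  from choice[OF this] obtain t where t: "\<forall>k. k \<in> K \<longrightarrow> thinned k (fst (t k)) (fst (snd (t k)))
      (fst (snd (snd (t k)))) (fst (snd (snd (snd (t k))))) (snd (snd (snd (snd (t k))))) \<and>
      p \<subseteq>\<^sub>m fst (snd (snd (t k)))"
    by (elim exE) (rule that)
  define B where "B k = fst (t k)" for k
  define q where "q k = fst (snd (t k))" for k
  define r where "r k = fst (snd (snd (t k)))" for k
  define f1 where "f1 k = fst (snd (snd (snd (t k))))" for k
  define f2 where "f2 k = snd (snd (snd (snd (t k))))" for k
  have th: "thinned k (B k) (q k) (r k) (f1 k) (f2 k)" "p \<subseteq>\<^sub>m r k" if "k \<in> K" for k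
    using t that by (simp_all add: B_def q_def r_def f1_def f2_def)
  have BL: "|B k| =o L k" and BA: "B k \<subseteq> A k" if "k \<in> K" for k
    using th(1)[OF that] by (simp_all add: thinned_def)
  have Bst: "stuck k b (q k b) (f1 k) (f2 k)" "r k \<subseteq>\<^sub>m q k b" if "k \<in> K" "b \<in> B k" for k b
    using th(1)[OF that(1)] that(2) by (simp_all add: thinned_def)
  have Bdom: "dom (q k b) \<inter> dom (q k b') = dom (r k)"
    if "k \<in> K" "b \<in> B k" "b' \<in> B k" "b \<noteq> b'" for k b b'
    using th(1)[OF that(1)] that(2,3,4) by (simp add: thinned_def)
  have qP: "q k b \<in> P" if "k \<in> K" "b \<in> B k" for k b
    using Bst(1)[OF that] by (simp add: stuck_def)
  have Bne: "\<exists>b. b \<in> B k" if "k \<in> K" for k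
    using big_minus_small[OF BL[OF that] regular_small_singleton[OF L_regular[OF that]]] by metis
  have rP: "r k \<in> P" if k: "k \<in> K" for k
    using Bne[OF k] Bst(2)[OF k] qP[OF k] submap_in_P by metis
  have "f1 k \<subseteq> Zl k \<and> |f1 k| <o \<theta>" if k: "k \<in> K" for k
    using Bne[OF k] Bst(1)[OF k] unfolding stuck_def by metis
  then obtain X g where X: "X \<subseteq> K" "|X| =o \<kappa>" and g: "\<forall>k \<in> X. f1 k = g"
    using ex_common_clique[of f1] by metis
  have red: "\<not> Grm a b s"
    if ij: "i \<in> X" "j \<in> X" and ab: "a \<in> B i" "b \<in> B j" "a \<in> underS lam b"
      and s: "q i a \<subseteq>\<^sub>m s" "q j b \<subseteq>\<^sub>m s" for i j a b s
  proof -
    have "i \<in> K" "j \<in> K" using ij X(1) by auto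
    moreover have "thinned i (B i) (q i) (r i) g (f2 i)" "thinned j (B j) (q j) (r j) g (f2 j)"
      using th(1) calculation g ij by metis+
    ultimately show ?thesis
      using ab s by (intro red_pair[of i "B i" "q i" "r i" g "f2 i" j "B j" "q j" "r j" "f2 j"]) auto
  qed
  have "\<exists>p' \<in> P. p \<subseteq>\<^sub>m p' \<and> (\<forall>q \<in> P. p' \<subseteq>\<^sub>m q \<longrightarrow> (\<forall>k \<in> K. \<exists>j \<in> X. k \<in> underS \<kappa> j \<and> agree (r j) q))"
    using X(1) rP th(2) by (intro ex_generic_roots[OF X p]) auto
  then obtain p' where p': "p' \<in> P" "p \<subseteq>\<^sub>m p'"
      and gen: "\<And>q k. q \<in> P \<Longrightarrow> p' \<subseteq>\<^sub>m q \<Longrightarrow> k \<in> K \<Longrightarrow> \<exists>j \<in> X. k \<in> underS \<kappa> j \<and> agree (r j) q"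
    by (elim bexE conjE) (rule that, blast+)
  \<comment> \<open>Each \<open>x\<close> in \<open>D k\<close> gets \<open>\<sigma>\<close>
    candidates \<open>h k (x, z)\<close> in \<open>B k\<close>, and different \<open>x\<close> get
    different ones, so that no single condition can rule out all candidates for a value.\<close>
  have "\<forall>k. \<exists>h. k \<in> K \<longrightarrow> inj_on h (D k \<times> S) \<and> h ` (D k \<times> S) \<subseteq> B k"
  proof (intro allI, cases)
    fix k assume k: "k \<in> K"
    have "|D k \<times> S| \<le>o |D k|"
      by (intro card_of_Times_le D_inf k card_of_refl[THEN ordIso_imp_ordLeq] S_le)
    also have "|D k| <o L k"
      using card_of_Pow cardSuc_greater[OF card_of_Card_order] by (rule ordLess_transitive)
    finally have "|D k \<times> S| \<le>o |B k|"
      using BL[OF k] ordIso_symmetric ordLess_ordIso_trans ordLess_imp_ordLeq by metis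
    then show "\<exists>h. k \<in> K \<longrightarrow> inj_on h (D k \<times> S) \<and> h ` (D k \<times> S) \<subseteq> B k"
      by (metis card_of_ordLeq)
  qed simp
  from choice[OF this] obtain h where h: "\<forall>k. k \<in> K \<longrightarrow> inj_on (h k) (D k \<times> S) \<and> h k ` (D k \<times> S) \<subseteq> B k"
    by (elim exE) (rule that)
  have hB: "h k (x, z) \<in> B k" if "k \<in> K" "x \<in> D k" "z \<in> S" for k x z
    using h that by blast
  \<comment> \<open>The value at \<open>x\<close> may be any candidate from any piece in
    \<open>X\<close> whose cut point is beyond \<open>x\<close>, provided that the generic filter
    contains \<open>q k b\<close>; mixing then selects one value.\<close>
  define E where "E x b s \<longleftrightarrow> s \<in> P \<and> (\<exists>k \<in> X. x \<in> D k \<and> (\<exists>z \<in> S. b = h k (x, z) \<and> q k b \<subseteq>\<^sub>m s))" for x b s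
  have "\<forall>x. \<exists>H. (\<forall>b p q. H b p \<longrightarrow> q \<in> P \<longrightarrow> p \<subseteq>\<^sub>m q \<longrightarrow> H b q) \<and>
      (\<forall>b b' p. H b p \<longrightarrow> H b' p \<longrightarrow> b = b') \<and>
      (\<forall>b p. H b p \<longrightarrow> p \<in> P \<and> (\<exists>m \<in> P. E x b m \<and> m \<subseteq>\<^sub>m p)) \<and>
      (\<forall>p \<in> P. (\<exists>b q. E x b q \<and> p \<subseteq>\<^sub>m q) \<longrightarrow> (\<exists>b q. H b q \<and> p \<subseteq>\<^sub>m q))"
    by (intro allI mixing) (simp add: E_def)
  from choice[OF this] obtain H where H: "\<forall>x. (\<forall>b p q. H x b p \<longrightarrow> q \<in> P \<longrightarrow> p \<subseteq>\<^sub>m q \<longrightarrow> H x b q) \<and>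
      (\<forall>b b' p. H x b p \<longrightarrow> H x b' p \<longrightarrow> b = b') \<and>
      (\<forall>b p. H x b p \<longrightarrow> p \<in> P \<and> (\<exists>m \<in> P. E x b m \<and> m \<subseteq>\<^sub>m p)) \<and>
      (\<forall>p \<in> P. (\<exists>b q. E x b q \<and> p \<subseteq>\<^sub>m q) \<longrightarrow> (\<exists>b q. H x b q \<and> p \<subseteq>\<^sub>m q))"
    by (elim exE) (rule that)
  have HE: "s \<in> P \<and> E x b s" if Hs: "H x b s" for x b s
  proof -
    obtain n where "s \<in> P" "E x b n" "n \<subseteq>\<^sub>m s" using H Hs by blast
    then show ?thesis using map_le_trans unfolding E_def by blast
  qed
  \<comment> \<open>A point determines its piece, and hence, as \<open>h k\<close> is injective, the
    \<open>x\<close> for which it is a candidate.\<close>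
  have piece: "i = j" if "i \<in> K" "j \<in> K" "b \<in> B i" "b \<in> B j" for i j b
  proof -
    have aux: "False" if "i \<in> underS \<kappa> j" "j \<in> K" "b \<in> B i" "b \<in> B j" for i j
    proof -
      have "b \<in> I i" "b \<in> I j" using that underS_FieldD[OF that(1)] BA A_I by blast+
      then show False using I_below[OF that(1)] I_above[OF that(2)] by blast
    qed
    show ?thesis using underS_total[OF kappa_wo that(1,2)] aux that by blast
  qed
  have dense: "\<exists>s b. s0 \<subseteq>\<^sub>m s \<and> H x b s" if x: "x \<in> Field lam" and s0: "s0 \<in> P" "p' \<subseteq>\<^sub>m s0" for x s0
  proof -
    obtain k0 where k0: "k0 \<in> K" "x \<in> D k0" using d_cofinal[OF x] by blast
    obtain j where j: "j \<in> X" "k0 \<in> underS \<kappa> j" "agree (r j) s0" using gen[OF s0 k0(1)] by blast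
    have jK: "j \<in> K" using j(1) X(1) by blast
    have xD: "x \<in> D j" using k0(2) d_mono[OF j(2)] underS_trans[OF lam_wo] by blast
    \<comment> \<open>Outside the root the supports of the \<open>\<sigma>\<close> candidate
      conditions are disjoint. The support of \<open>s0\<close> is smaller than
      \<open>\<sigma>\<close>, so it misses one of them there, and on the root \<open>s0\<close>
      agrees with \<open>r j\<close>.\<close>
    have "\<exists>z \<in> S. agree (q j (h j (x, z))) s0"
    proof (rule ccontr)
      assume neg: "\<not> ?thesis"
      have "\<exists>n. n \<in> dom s0 \<inter> dom (q j (h j (x, z))) - dom (r j)" if z: "z \<in> S" for z
      proof -
        obtain n where n: "n \<in> dom (q j (h j (x, z))) \<inter> dom s0" "q j (h j (x, z)) n \<noteq> s0 n"
          using neg z unfolding agree_def by blast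
        have "n \<notin> dom (r j)"
        proof
          assume nr: "n \<in> dom (r j)"
          then have "r j n = s0 n" using j(3) n(1) unfolding agree_def by blast
          moreover have "r j n = q j (h j (x, z)) n"
            using Bst(2)[OF jK hB[OF jK xD z]] nr unfolding map_le_def by blast
          ultimately show False using n(2) by simp
        qed
        then show ?thesis using n(1) by blast
      qed
      then obtain n where n: "\<And>z. z \<in> S \<Longrightarrow> n z \<in> dom s0 \<inter> dom (q j (h j (x, z))) - dom (r j)"
        by metis
      have "inj_on n S"
      proof (rule inj_onI, rule ccontr)
        fix z z' assume zz: "z \<in> S" "z' \<in> S" "n z = n z'" "z \<noteq> z'"
        have "inj_on (h j) (D j \<times> S)" using h jK by blast
        then have "h j (x, z) \<noteq> h j (x, z')"
          using zz xD unfolding inj_on_def by blast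
        then have "dom (q j (h j (x, z))) \<inter> dom (q j (h j (x, z'))) = dom (r j)"
          by (intro Bdom jK hB xD zz)
        then show False using n[OF zz(1)] n[OF zz(2)] zz(3) by auto
      qed
      moreover have "n ` S \<subseteq> dom s0" using n by blast
      ultimately have "|S| \<le>o |dom s0|" by (intro card_of_ordLeqI) auto
      then have "|S| <o \<sigma>" using dom_small[OF s0(1)] by (rule ordLeq_ordLess_trans)
      then show False using card_of_Field_ordIso[OF sigma_card] not_ordLess_ordIso by metis
    qed
    then obtain z where z: "z \<in> S" "agree (q j (h j (x, z))) s0" by blast
    obtain s where s: "s \<in> P" "q j (h j (x, z)) \<subseteq>\<^sub>m s" "s0 \<subseteq>\<^sub>m s"
      by (rule common_extension[OF qP[OF jK hB[OF jK xD z(1)]] s0(1) z(2)])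
    have "E x (h j (x, z)) s" using s j(1) xD z(1) unfolding E_def by blast
    then show ?thesis using H s0(1) s(3) by blast
  qed
  have "red_system p' H"
    unfolding red_system_def
  proof (intro conjI allI impI ballI)
    fix x b s assume "H x b s"
    then have s: "s \<in> P" "E x b s" using HE by blast+
    then obtain k z where k: "k \<in> X" "x \<in> D k" "z \<in> S" "b = h k (x, z)" unfolding E_def by blast
    have kK: "k \<in> K" using k(1) X(1) by blast
    show "s \<in> P" by (rule s(1))
    show "x \<in> Field lam" using k(2) underS_FieldD by metis
    show "b \<in> Field lam" using hB[OF kK k(2,3)] k(4) BA[OF kK] A_I[OF kK] I_Field[OF kK] by blast
  next
    show "H x b r" if "H x b q" "r \<in> P" "q \<subseteq>\<^sub>m r" for x b q r
      using H that by blast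
    show "b = b'" if "H x b q" "H x b' q" for x b b' q
      using H that by blast
    show "\<exists>r b. q \<subseteq>\<^sub>m r \<and> H x b r" if "x \<in> Field lam" "q \<in> P" "p' \<subseteq>\<^sub>m q" for x q
      by (rule dense[OF that])
  next
    fix x y b s assume "H x b s" "H y b s"
    then have "E x b s" "E y b s" using HE by blast+
    then obtain k z l w where k: "k \<in> X" "x \<in> D k" "z \<in> S" "b = h k (x, z)"
        and l: "l \<in> X" "y \<in> D l" "w \<in> S" "b = h l (y, w)"
      unfolding E_def by blast
    have K: "k \<in> K" "l \<in> K" using k(1) l(1) X(1) by auto
    have "k = l" using piece[OF K] hB[OF K(1) k(2,3)] hB[OF K(2) l(2,3)] k(4) l(4) by simp
    then have "h k (x, z) = h k (y, w)" "inj_on (h k) (D k \<times> S)" "y \<in> D k" using k l h K by auto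
    then show "x = y" using k l unfolding inj_on_def by blast
  next
    fix x y a b s assume "H x a s" "H y b s" and ab: "a \<in> underS lam b"
    then have "E x a s" "E y b s" using HE by blast+
    then obtain k z l w where k: "k \<in> X" "x \<in> D k" "z \<in> S" "a = h k (x, z)" "q k a \<subseteq>\<^sub>m s"
        and l: "l \<in> X" "y \<in> D l" "w \<in> S" "b = h l (y, w)" "q l b \<subseteq>\<^sub>m s"
      unfolding E_def by blast
    have K: "k \<in> K" "l \<in> K" using k(1) l(1) X(1) by auto
    have "a \<in> B k" "b \<in> B l" using hB[OF K(1) k(2,3)] hB[OF K(2) l(2,3)] k(4) l(4) by auto
    then show "\<not> Grm a b s" using red[OF k(1) l(1)] ab k(5) l(5) by blast
  qed
  then show ?thesis using p' by blast
qed

end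

section \<open>The forcing language\<close>

lemma wf_option_top:
  assumes "wf s"
  shows "wf ({(Some a, Some b) | a b. (a, b) \<in> s} \<union> {(Some a, None) | a. True})"
proof -
  let ?f = "\<lambda>x. case x of None \<Rightarrow> (Suc 0, undefined) | Some a \<Rightarrow> (0, a)"
  have "wf (inv_image (less_than <*lex*> s) ?f)"
    by (intro wf_inv_image wf_lex_prod wf_less_than assms)
  then show ?thesis
    by (rule wf_subset) auto
qed

text \<open>\<open>None\<close> is the top point. All elements of \<open>succ_name\<close> are thus
  indexed by a single well-order, and \<open>ordinal_names\<close> applies to them
  uniformly.\<close>

definition order_succ :: "'t rel \<Rightarrow> 't option rel"
  where "order_succ r = {(Some a, Some b) | a b. (a, b) \<in> r} \<union> {(x, None) | x. x \<in> insert None (Some ` Field r)}"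

lemma Field_order_succ: "Field (order_succ r) = insert None (Some ` Field r)"
proof
  show "Field (order_succ r) \<subseteq> insert None (Some ` Field r)"
    by (auto simp: order_succ_def Field_def)
  show "insert None (Some ` Field r) \<subseteq> Field (order_succ r)"
  proof
    fix x assume "x \<in> insert None (Some ` Field r)"
    then have "(x, None) \<in> order_succ r" by (simp add: order_succ_def)
    then show "x \<in> Field (order_succ r)" by (rule FieldI1)
  qed
qed

lemma underS_order_succ:
  "underS (order_succ r) (Some a) = Some ` underS r a"
  "underS (order_succ r) None = Some ` Field r"
  by (auto simp: order_succ_def underS_def)

lemma Well_order_order_succ:
  assumes "Well_order r"
  shows "Well_order (order_succ r)"
proof -
  have r: "trans r" "antisym r" "refl_on (Field r) r" "total_on (Field r) r" "wf (r - Id)"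
    using assms by (auto simp: order_on_defs)
  have "refl_on (insert None (Some ` Field r)) (order_succ r)"
    using r(3) by (auto simp: order_succ_def refl_on_def)
  moreover have "trans (order_succ r)"
    by (rule transI) (use r(1) in \<open>auto simp: order_succ_def Field_def dest: transD\<close>)
  moreover have "antisym (order_succ r)"
    by (rule antisymI) (use r(2) in \<open>auto simp: order_succ_def dest: antisymD\<close>)
  moreover have "total_on (insert None (Some ` Field r)) (order_succ r)"
    using r(4) by (auto simp: order_succ_def total_on_def)
  moreover have "wf (order_succ r - Id)"
    by (rule wf_subset[OF wf_option_top[OF r(5)]]) (auto simp: order_succ_def)
  moreover have "order_succ r \<subseteq> insert None (Some ` Field r) \<times> insert None (Some ` Field r)"
    by (auto simp: order_succ_def Field_def)
  ultimately show ?thesis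
    unfolding Field_order_succ order_on_defs by blast
qed

section \<open>Regular open sentences and the connectives\<close>

locale forcing_names = forcing P le for P :: "'p set" and le :: "'p \<Rightarrow> 'p \<Rightarrow> bool" +
  fixes e :: 'p and ity :: "'i itself"
  assumes le_refl: "le p p" and le_trans: "le p q \<Longrightarrow> le q r \<Longrightarrow> le p r"
    and e_P: "e \<in> P" and le_e: "p \<in> P \<Longrightarrow> le p e"
    and infinite_i: "\<not> finite (UNIV :: 'i set)"
begin

declare fEq.simps [simp del]

text \<open>A regular open set of conditions: closed under extension, and containing every condition
  below which it is dense. Its use is \<open>reg_local\<close>: to force a sentence at
  \<open>p\<close> it suffices to force it densely often below \<open>p\<close>.\<close>

definition reg :: "('p \<Rightarrow> bool) \<Rightarrow> bool"
  where "reg A \<longleftrightarrow> (\<forall>p \<in> P. \<forall>q \<in> P. le q p \<longrightarrow> A p \<longrightarrow> A q) \<and> (\<forall>p \<in> P. dense_below p A \<longrightarrow> A p)"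

lemma regD: "reg A \<Longrightarrow> A p \<Longrightarrow> p \<in> P \<Longrightarrow> q \<in> P \<Longrightarrow> le q p \<Longrightarrow> A q"
  unfolding reg_def by blast

lemma reg_local: "reg A \<Longrightarrow> p \<in> P \<Longrightarrow> (\<And>q. q \<in> P \<Longrightarrow> le q p \<Longrightarrow> \<exists>r \<in> P. le r q \<and> A r) \<Longrightarrow> A p"
  unfolding reg_def dense_below_def by blast

lemma dense_belowD: "dense_below p A \<Longrightarrow> q \<in> P \<Longrightarrow> le q p \<Longrightarrow> \<exists>r \<in> P. le r q \<and> A r"
  unfolding dense_below_def by blast

lemma reg_dense_below: "reg (\<lambda>p. dense_below p A)"
  unfolding reg_def dense_below_def by (meson le_refl le_trans)

lemma dense_belowI_mono: "(\<And>q. q \<in> P \<Longrightarrow> le q p \<Longrightarrow> A q) \<Longrightarrow> dense_below p A"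
  unfolding dense_below_def using le_refl by blast

lemma reg_fNot: "reg A \<Longrightarrow> reg (\<^bold>\<not> A)"
  unfolding reg_def fNot_def dense_below_def by (meson le_refl le_trans)

lemma reg_conj:
  assumes "reg A" "reg B" shows "reg (\<lambda>p. A p \<and> B p)"
proof -
  have "dense_below p A" "dense_below p B" if "dense_below p (\<lambda>p. A p \<and> B p)" for p
    using that unfolding dense_below_def by blast+
  then show ?thesis using assms unfolding reg_def by blast
qed

lemma reg_fAnd: "reg A \<Longrightarrow> reg B \<Longrightarrow> reg (A \<^bold>\<and> B)"
  using reg_conj[of A B] by (simp add: fAnd_def[abs_def])

lemma reg_fEx: "reg (\<^bold>\<exists>x. A x)"
proof -
  have "(\<^bold>\<exists>x. A x) = (\<lambda>p. dense_below p (\<lambda>q. \<exists>x. is_name x \<and> A x q))"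
    by (simp add: fEx_def fun_eq_iff)
  then show ?thesis using reg_dense_below by simp
qed

lemma reg_fMem: "reg (x \<^bold>\<in> y)"
proof -
  have "(x \<^bold>\<in> y) = (\<lambda>p. dense_below p (\<lambda>q. \<exists>(z, s) \<in> elems y. le q s \<and> (x \<^bold>= z) q))"
    by (simp add: fMem_def fun_eq_iff)
  then show ?thesis using reg_dense_below by simp
qed

lemma reg_ball:
  assumes "\<And>x. x \<in> X \<Longrightarrow> reg (A x)" shows "reg (\<lambda>p. \<forall>x \<in> X. A x p)"
proof -
  have "dense_below p (A x)" if "dense_below p (\<lambda>p. \<forall>x \<in> X. A x p)" "x \<in> X" for p x
    using that unfolding dense_below_def by blast
  then show ?thesis using assms unfolding reg_def by blast
qed

lemma reg_fEq: "reg (x \<^bold>= y)"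
proof -
  have "(x \<^bold>= y) = (\<lambda>p. (\<forall>x' \<in> elems x. dense_below p (\<lambda>q. le q (snd x') \<longrightarrow>
      (\<exists>(w, t) \<in> elems y. le q t \<and> (fst x' \<^bold>= w) q))) \<and>
    (\<forall>y' \<in> elems y. dense_below p (\<lambda>q. le q (snd y') \<longrightarrow>
      (\<exists>(z, s) \<in> elems x. le q s \<and> (z \<^bold>= fst y') q))))"
    by (rule ext, subst fEq.simps) (simp add: split_beta)
  then show ?thesis by (simp only:) (intro reg_conj reg_ball reg_dense_below)
qed

lemma reg_fOr: "reg A \<Longrightarrow> reg B \<Longrightarrow> reg (A \<^bold>\<or> B)"
  unfolding fOr_def by (intro reg_fNot reg_fAnd)

lemma reg_fImp: "reg A \<Longrightarrow> reg B \<Longrightarrow> reg (A \<^bold>\<longrightarrow> B)"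
  unfolding fImp_def by (intro reg_fNot reg_fAnd)

lemma reg_fIff: "reg A \<Longrightarrow> reg B \<Longrightarrow> reg (A \<^bold>\<longleftrightarrow> B)"
  unfolding fIff_def by (intro reg_fImp reg_fAnd)

lemma reg_fAll: "reg (\<^bold>\<forall>x. A x)"
  unfolding fAll_def by (intro reg_fNot reg_fEx)

lemmas reg_rules = reg_fNot reg_fAnd reg_fEx reg_fMem reg_fEq reg_fOr reg_fImp reg_fIff reg_fAll

lemma fAnd_iff: "(A \<^bold>\<and> B) p \<longleftrightarrow> A p \<and> B p"
  by (simp add: fAnd_def)

lemma fNot_iff: "(\<^bold>\<not> A) p \<longleftrightarrow> (\<forall>q \<in> P. le q p \<longrightarrow> \<not> A q)"
  by (simp add: fNot_def)

text \<open>Implication is coded by negations, which by itself yields only that \<open>B\<close> is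
  forced densely below \<open>q\<close>; regularity of \<open>B\<close> removes the density.\<close>

lemma fImp_iff:
  assumes "reg A" "reg B" "p \<in> P"
  shows "(A \<^bold>\<longrightarrow> B) p \<longleftrightarrow> (\<forall>q \<in> P. le q p \<longrightarrow> A q \<longrightarrow> B q)"
proof
  assume l: "(A \<^bold>\<longrightarrow> B) p"
  show "\<forall>q \<in> P. le q p \<longrightarrow> A q \<longrightarrow> B q"
  proof (intro ballI impI)
    fix q assume q: "q \<in> P" "le q p" "A q"
    show "B q"
    proof (rule reg_local[OF assms(2) q(1)])
      fix r assume r: "r \<in> P" "le r q"
      have "A r" using regD[OF assms(1) q(3,1) r] .
      moreover have "\<not> (A r \<and> (\<^bold>\<not> B) r)"
        using l r q le_trans unfolding fImp_def fNot_def[of "A \<^bold>\<and> \<^bold>\<not> B"] fAnd_def by blast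
      ultimately show "\<exists>s \<in> P. le s r \<and> B s"
        unfolding fNot_def by blast
    qed
  qed
next
  assume "\<forall>q \<in> P. le q p \<longrightarrow> A q \<longrightarrow> B q"
  then show "(A \<^bold>\<longrightarrow> B) p"
    unfolding fImp_def fNot_def fAnd_def using le_refl by blast
qed

lemma fIff_iff:
  assumes "reg A" "reg B" "p \<in> P"
  shows "(A \<^bold>\<longleftrightarrow> B) p \<longleftrightarrow> (\<forall>q \<in> P. le q p \<longrightarrow> A q = B q)"
  using fImp_iff[OF assms] fImp_iff[OF assms(2,1,3)] unfolding fIff_def fAnd_iff by blast

lemma fOr_iff:
  assumes "reg A" "reg B" "p \<in> P"
  shows "(A \<^bold>\<or> B) p \<longleftrightarrow> dense_below p (\<lambda>q. A q \<or> B q)"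
proof
  assume "(A \<^bold>\<or> B) p"
  then show "dense_below p (\<lambda>q. A q \<or> B q)"
    using le_trans unfolding fOr_def fNot_def fAnd_def dense_below_def by blast
next
  assume d: "dense_below p (\<lambda>q. A q \<or> B q)"
  then show "(A \<^bold>\<or> B) p"
    unfolding fOr_def fNot_def fAnd_def dense_below_def using le_refl by blast
qed

lemma fAll_iff:
  assumes "\<And>x. reg (A x)" "p \<in> P"
  shows "(\<^bold>\<forall>x. A x) p \<longleftrightarrow> (\<forall>x. is_name x \<longrightarrow> A x p)"
proof
  assume l: "(\<^bold>\<forall>x. A x) p"
  show "\<forall>x. is_name x \<longrightarrow> A x p"
  proof (intro allI impI)
    fix x :: "('a, 'p) name" assume x: "is_name x"
    show "A x p"
    proof (rule reg_local[OF assms])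
      fix q assume q: "q \<in> P" "le q p"
      have "\<not> dense_below q (\<lambda>q. \<exists>x. is_name x \<and> (\<^bold>\<not> A x) q)"
        using l q unfolding fAll_def fNot_def[of "\<^bold>\<exists>x. \<^bold>\<not> A x"] fEx_def by blast
      then obtain r where r: "r \<in> P" "le r q" "\<And>s. s \<in> P \<Longrightarrow> le s r \<Longrightarrow> \<not> (\<^bold>\<not> A x) s"
        using x unfolding dense_below_def by blast
      then have "\<not> (\<^bold>\<not> A x) r" using le_refl by blast
      then show "\<exists>r \<in> P. le r q \<and> A x r"
        using r le_trans unfolding fNot_def by blast
    qed
  qed
next
  assume r: "\<forall>x. is_name x \<longrightarrow> A x p"
  show "(\<^bold>\<forall>x. A x) p"
    unfolding fAll_def fNot_def[of "\<^bold>\<exists>x. \<^bold>\<not> A x"]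
  proof (intro ballI impI notI)
    fix q assume q: "q \<in> P" "le q p" "(\<^bold>\<exists>x. \<^bold>\<not> A x) q"
    then obtain s x where s: "s \<in> P" "le s q" "is_name x" "(\<^bold>\<not> A x) s"
      unfolding fEx_def dense_below_def using le_refl by blast
    then have "A x s" using regD[OF assms(1) _ assms(2) s(1)] r le_trans q by blast
    then show False using s unfolding fNot_def using le_refl by blast
  qed
qed

lemma fEx_iff: "(\<^bold>\<exists>x. A x) p \<longleftrightarrow> dense_below p (\<lambda>q. \<exists>x. is_name x \<and> A x q)"
  by (simp add: fEx_def)

lemma fExI:
  assumes "is_name x" "A x p" "reg (A x)" "p \<in> P"
  shows "(\<^bold>\<exists>x. A x) p"
  unfolding fEx_iff by (rule dense_belowI_mono) (use assms regD in blast)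

lemma fExD:
  assumes "(\<^bold>\<exists>x. A x) p" "p \<in> P"
  shows "\<exists>q \<in> P. le q p \<and> (\<exists>x. is_name x \<and> A x q)"
  using assms le_refl unfolding fEx_iff dense_below_def by blast

subsection \<open>Equality and membership\<close>

lemma eq_refl: "(x \<^bold>= x) p"
proof (induction x arbitrary: p rule: wf_induct_rule[OF wf_name_less])
  case (1 x)
  have z: "(z \<^bold>= z) q" if "(z, s) \<in> elems x" for z s q
    using 1[of z q] that by (auto simp: name_less_def)
  have "dense_below p (\<lambda>q. le q s \<longrightarrow> (\<exists>(w, t) \<in> elems x. le q t \<and> (z \<^bold>= w) q))"
    "dense_below p (\<lambda>q. le q s \<longrightarrow> (\<exists>(w, t) \<in> elems x. le q t \<and> (w \<^bold>= z) q))"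
    if "(z, s) \<in> elems x" for z s
    using that z by (auto intro!: dense_belowI_mono)
  then show ?case
    by (subst fEq.simps) auto
qed

lemma eq_sym: "(x \<^bold>= y) p \<longleftrightarrow> (y \<^bold>= x) p"
proof (induction x arbitrary: y p rule: wf_induct_rule[OF wf_name_less])
  case (1 x)
  have z: "(z \<^bold>= w) q \<longleftrightarrow> (w \<^bold>= z) q" if "(z, s) \<in> elems x" for z s w q
    using 1[of z w q] that by (auto simp: name_less_def)
  have "(\<exists>(z, s) \<in> elems x. le q s \<and> (z \<^bold>= w) q) \<longleftrightarrow> (\<exists>(z, s) \<in> elems x. le q s \<and> (w \<^bold>= z) q)" for w q
    using z by blast
  moreover have "(\<forall>(z, s) \<in> elems x. dense_below p (\<lambda>q. le q s \<longrightarrow> (\<exists>(w, t) \<in> elems y. le q t \<and> (z \<^bold>= w) q)))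
      \<longleftrightarrow> (\<forall>(z, s) \<in> elems x. dense_below p (\<lambda>q. le q s \<longrightarrow> (\<exists>(w, t) \<in> elems y. le q t \<and> (w \<^bold>= z) q)))"
  proof (intro ball_cong refl, clarify)
    fix z s assume "(z, s) \<in> elems x"
    then have "(\<lambda>q. le q s \<longrightarrow> (\<exists>(w, t) \<in> elems y. le q t \<and> (z \<^bold>= w) q)) =
        (\<lambda>q. le q s \<longrightarrow> (\<exists>(w, t) \<in> elems y. le q t \<and> (w \<^bold>= z) q))"
      using z by (intro ext) blast
    then show "dense_below p (\<lambda>q. le q s \<longrightarrow> (\<exists>(w, t) \<in> elems y. le q t \<and> (z \<^bold>= w) q)) =
        dense_below p (\<lambda>q. le q s \<longrightarrow> (\<exists>(w, t) \<in> elems y. le q t \<and> (w \<^bold>= z) q))"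
      by simp
  qed
  ultimately show ?case
    by (subst (1 2) fEq.simps) auto
qed

lemma mem_dense:
  "(x \<^bold>\<in> y) p \<longleftrightarrow> dense_below p (\<lambda>q. \<exists>z s. (z, s) \<in> elems y \<and> le q s \<and> (x \<^bold>= z) q)"
  unfolding fMem_def by (simp add: split_beta Bex_def)

lemma memD:
  assumes "(x \<^bold>\<in> y) p" "q \<in> P" "le q p"
  obtains r z s where "r \<in> P" "le r q" "(z, s) \<in> elems y" "le r s" "(x \<^bold>= z) r"
  using assms unfolding mem_dense dense_below_def by blast

text \<open>Extensionality. It hides the recursion in \<open>fEq\<close>, so that transitivity and
  congruence can be argued as for sets.\<close>

lemma eq_mem:
  assumes p: "p \<in> P"
  shows "(x \<^bold>= y) p \<longleftrightarrow>
    (\<forall>z s q. (z, s) \<in> elems x \<longrightarrow> q \<in> P \<longrightarrow> le q p \<longrightarrow> le q s \<longrightarrow> (z \<^bold>\<in> y) q) \<and>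
    (\<forall>z s q. (z, s) \<in> elems y \<longrightarrow> q \<in> P \<longrightarrow> le q p \<longrightarrow> le q s \<longrightarrow> (z \<^bold>\<in> x) q)"
proof -
  have half: "dense_below p (\<lambda>q. le q s \<longrightarrow> (\<exists>(w, t) \<in> elems y. le q t \<and> (z \<^bold>= w) q)) \<longleftrightarrow>
    (\<forall>q \<in> P. le q p \<longrightarrow> le q s \<longrightarrow> (z \<^bold>\<in> y) q)" for z s y
  proof
    assume l: "dense_below p (\<lambda>q. le q s \<longrightarrow> (\<exists>(w, t) \<in> elems y. le q t \<and> (z \<^bold>= w) q))"
    show "\<forall>q \<in> P. le q p \<longrightarrow> le q s \<longrightarrow> (z \<^bold>\<in> y) q"
    proof (intro ballI impI)
      fix q assume q: "q \<in> P" "le q p" "le q s"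
      show "(z \<^bold>\<in> y) q"
        unfolding mem_dense dense_below_def
      proof (intro ballI impI)
        fix r assume r: "r \<in> P" "le r q"
        obtain u where u: "u \<in> P" "le u r" "le u s \<longrightarrow> (\<exists>(w, t) \<in> elems y. le u t \<and> (z \<^bold>= w) u)"
          using dense_belowD[OF l r(1) le_trans[OF r(2) q(2)]] by blast
        then have "le u s" using r(2) q(3) le_trans by blast
        then show "\<exists>u \<in> P. le u r \<and> (\<exists>w t. (w, t) \<in> elems y \<and> le u t \<and> (z \<^bold>= w) u)"
          using u by blast
      qed
    qed
  next
    assume r: "\<forall>q \<in> P. le q p \<longrightarrow> le q s \<longrightarrow> (z \<^bold>\<in> y) q"
    show "dense_below p (\<lambda>q. le q s \<longrightarrow> (\<exists>(w, t) \<in> elems y. le q t \<and> (z \<^bold>= w) q))"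
      unfolding dense_below_def
    proof (intro ballI impI)
      fix q assume q: "q \<in> P" "le q p"
      show "\<exists>r \<in> P. le r q \<and> (le r s \<longrightarrow> (\<exists>(w, t) \<in> elems y. le r t \<and> (z \<^bold>= w) r))"
      proof (cases "le q s")
        case True
        then have "(z \<^bold>\<in> y) q" using r q by blast
        then obtain u w t where "u \<in> P" "le u q" "(w, t) \<in> elems y" "le u t" "(z \<^bold>= w) u"
          using memD[OF _ q(1) le_refl] by metis
        then show ?thesis by blast
      next
        case False
        then show ?thesis using q le_refl by blast
      qed
    qed
  qed
  have "(\<lambda>q. le q t \<longrightarrow> (\<exists>(z, s) \<in> elems x. le q s \<and> (z \<^bold>= w) q)) =
      (\<lambda>q. le q t \<longrightarrow> (\<exists>(z, s) \<in> elems x. le q s \<and> (w \<^bold>= z) q))" for t w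
    using eq_sym by (intro ext) blast
  then show ?thesis
    by (subst fEq.simps) (auto simp: half)
qed

lemma eq_trans:
  assumes "p \<in> P" "(x \<^bold>= y) p" "(y \<^bold>= z) p"
  shows "(x \<^bold>= z) p"
  using assms
proof (induction x arbitrary: y z p rule: wf_induct_rule[OF wf_name_less])
  case (1 x)
  have IH: "(u \<^bold>= w) q" if "(u, s) \<in> elems x" "q \<in> P" "(u \<^bold>= v) q" "(v \<^bold>= w) q" for u s q v w
    using 1(1)[of u q v w] that by (auto simp: name_less_def)
  show ?case
    unfolding eq_mem[OF 1(2)]
  proof (intro conjI allI impI)
    fix u s q assume u: "(u, s) \<in> elems x" and q: "q \<in> P" "le q p" "le q s"
    have uy: "(u \<^bold>\<in> y) q" using 1(3) u q unfolding eq_mem[OF 1(2)] by blast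
    show "(u \<^bold>\<in> z) q"
    proof (rule reg_local[OF reg_fMem q(1)])
      fix r assume r: "r \<in> P" "le r q"
      obtain r1 v t where r1: "r1 \<in> P" "le r1 r" "(v, t) \<in> elems y" "le r1 t" "(u \<^bold>= v) r1"
        using memD[OF uy r] by metis
      have "le r1 p" using le_trans[OF r1(2) le_trans[OF r(2) q(2)]] .
      then have "(v \<^bold>\<in> z) r1" using 1(4) r1 unfolding eq_mem[OF 1(2)] by blast
      have "(u \<^bold>\<in> z) r1"
      proof (rule reg_local[OF reg_fMem r1(1)])
        fix r' assume r': "r' \<in> P" "le r' r1"
        obtain r2 w t' where r2: "r2 \<in> P" "le r2 r'" "(w, t') \<in> elems z" "le r2 t'" "(v \<^bold>= w) r2"
          using memD[OF \<open>(v \<^bold>\<in> z) r1\<close> r'] by metis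
        have "(u \<^bold>= v) r2" using regD[OF reg_fEq r1(5,1) r2(1)] le_trans[OF r2(2) r'(2)] by blast
        then have uw: "(u \<^bold>= w) r2" using IH[OF u r2(1) _ r2(5)] by blast
        have "(u \<^bold>\<in> z) r2"
          unfolding mem_dense
        proof (rule dense_belowI_mono)
          fix q assume "q \<in> P" "le q r2"
          then show "\<exists>w t. (w, t) \<in> elems z \<and> le q t \<and> (u \<^bold>= w) q"
            using r2(3) le_trans[OF _ r2(4)] regD[OF reg_fEq uw r2(1)] by blast
        qed
        then show "\<exists>r2 \<in> P. le r2 r' \<and> (u \<^bold>\<in> z) r2" using r2 by blast
      qed
      then show "\<exists>r1 \<in> P. le r1 r \<and> (u \<^bold>\<in> z) r1" using r1 by blast
    qed
  next
    fix w t q assume w: "(w, t) \<in> elems z" and q: "q \<in> P" "le q p" "le q t"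
    have wy: "(w \<^bold>\<in> y) q" using 1(4) w q unfolding eq_mem[OF 1(2)] by blast
    show "(w \<^bold>\<in> x) q"
    proof (rule reg_local[OF reg_fMem q(1)])
      fix r assume r: "r \<in> P" "le r q"
      obtain r1 v t where r1: "r1 \<in> P" "le r1 r" "(v, t) \<in> elems y" "le r1 t" "(w \<^bold>= v) r1"
        using memD[OF wy r] by metis
      have "le r1 p" using le_trans[OF r1(2) le_trans[OF r(2) q(2)]] .
      then have "(v \<^bold>\<in> x) r1" using 1(3) r1 unfolding eq_mem[OF 1(2)] by blast
      have "(w \<^bold>\<in> x) r1"
      proof (rule reg_local[OF reg_fMem r1(1)])
        fix r' assume r': "r' \<in> P" "le r' r1"
        obtain r2 u t' where r2: "r2 \<in> P" "le r2 r'" "(u, t') \<in> elems x" "le r2 t'" "(v \<^bold>= u) r2"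
          using memD[OF \<open>(v \<^bold>\<in> x) r1\<close> r'] by metis
        have "(w \<^bold>= v) r2" using regD[OF reg_fEq r1(5,1) r2(1)] le_trans[OF r2(2) r'(2)] by blast
        \<comment> \<open>The induction hypothesis applies only to an element of \<open>x\<close> on
          the left, hence the detour through the reversed equation.\<close>
        then have "(u \<^bold>= w) r2" using IH[OF r2(3,1)] r2(5) eq_sym by metis
        then have uw: "(w \<^bold>= u) r2" using eq_sym by metis
        have "(w \<^bold>\<in> x) r2"
          unfolding mem_dense
        proof (rule dense_belowI_mono)
          fix q assume "q \<in> P" "le q r2"
          then show "\<exists>u t. (u, t) \<in> elems x \<and> le q t \<and> (w \<^bold>= u) q"
            using r2(3) le_trans[OF _ r2(4)] regD[OF reg_fEq uw r2(1)] by blast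
        qed
        then show "\<exists>r2 \<in> P. le r2 r' \<and> (w \<^bold>\<in> x) r2" using r2 by blast
      qed
      then show "\<exists>r1 \<in> P. le r1 r \<and> (w \<^bold>\<in> x) r1" using r1 by blast
    qed
  qed
qed

lemma mem_elems: "(z, s) \<in> elems y \<Longrightarrow> p \<in> P \<Longrightarrow> le p s \<Longrightarrow> (z \<^bold>\<in> y) p"
  unfolding mem_dense by (rule dense_belowI_mono) (meson eq_refl le_trans)

lemma mem_cong_left:
  assumes "p \<in> P" "(x \<^bold>= x') p" "(x \<^bold>\<in> y) p"
  shows "(x' \<^bold>\<in> y) p"
  unfolding mem_dense dense_below_def
proof (intro ballI impI)
  fix q assume q: "q \<in> P" "le q p"
  obtain r z s where r: "r \<in> P" "le r q" "(z, s) \<in> elems y" "le r s" "(x \<^bold>= z) r"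
    using memD[OF assms(3) q] by metis
  have "(x' \<^bold>= x) r"
    using regD[OF reg_fEq assms(2,1) r(1)] le_trans[OF r(2) q(2)] eq_sym by metis
  then have "(x' \<^bold>= z) r" using eq_trans[OF r(1)] r(5) by metis
  then show "\<exists>r \<in> P. le r q \<and> (\<exists>z s. (z, s) \<in> elems y \<and> le r s \<and> (x' \<^bold>= z) r)"
    using r by blast
qed

lemma mem_cong_right:
  assumes "p \<in> P" "(y \<^bold>= y') p" "(x \<^bold>\<in> y) p"
  shows "(x \<^bold>\<in> y') p"
proof (rule reg_local[OF reg_fMem assms(1)])
  fix q assume q: "q \<in> P" "le q p"
  obtain r z s where r: "r \<in> P" "le r q" "(z, s) \<in> elems y" "le r s" "(x \<^bold>= z) r"
    using memD[OF assms(3) q] by metis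
  have "(z \<^bold>\<in> y') r"
    using assms(2) r le_trans[OF r(2) q(2)] unfolding eq_mem[OF assms(1)] by blast
  then have "(x \<^bold>\<in> y') r" using mem_cong_left[OF r(1)] r(5) eq_sym by metis
  then show "\<exists>r \<in> P. le r q \<and> (x \<^bold>\<in> y') r" using r by blast
qed

lemma eq_extI:
  assumes p: "p \<in> P" and n: "is_name x" "is_name y"
    and iff: "\<And>z q. is_name z \<Longrightarrow> q \<in> P \<Longrightarrow> le q p \<Longrightarrow> (z \<^bold>\<in> x) q \<longleftrightarrow> (z \<^bold>\<in> y) q"
  shows "(x \<^bold>= y) p"
proof -
  have "is_name z" if "(z, s) \<in> elems x \<or> (z, s) \<in> elems y" for z s
    using that n by (metis is_name.cases)
  then show ?thesis
    unfolding eq_mem[OF p] using mem_elems iff by blast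
qed

definition small :: "(('i, 'p) name \<times> 'p) set \<Rightarrow> bool"
  where "small X \<longleftrightarrow> |X| \<le>o |UNIV :: 'i set|"

lemma elems_name: "small X \<Longrightarrow> elems (name_of X) = X"
  unfolding small_def by (rule elems_name_of)

lemma is_name_name_of:
  assumes "small X" "\<And>y p. (y, p) \<in> X \<Longrightarrow> p \<in> P \<and> is_name y"
  shows "is_name (name_of X)"
  by (rule is_name.intros) (use assms elems_name in auto)

lemma small_finite: "finite X \<Longrightarrow> small X"
  unfolding small_def
  using finite_ordLess_infinite[of "|X|" "|UNIV :: 'i set|"] infinite_i
  by (simp add: Field_card_of card_of_well_order_on ordLess_imp_ordLeq)

lemma small_insert: "small X \<Longrightarrow> small (insert x X)"
proof -
  assume X: "small X"
  have "|{x} \<union> X| \<le>o |UNIV :: 'i set|"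
    using X small_finite[of "{x}"] infinite_i unfolding small_def
    by (intro Un_Cinfinite_bound) (auto simp: cinfinite_def Field_card_of card_of_card_order_on)
  then show ?thesis by (simp add: small_def)
qed

lemma small_name_image: "|X| \<le>o |UNIV :: 'i set| \<Longrightarrow> small (f ` X)"
  unfolding small_def using card_of_image ordLeq_transitive by metis

lemma mem_name_of:
  assumes "small X"
  shows "(w \<^bold>\<in> name_of X) p \<longleftrightarrow> dense_below p (\<lambda>q. \<exists>z s. (z, s) \<in> X \<and> le q s \<and> (w \<^bold>= z) q)"
  unfolding mem_dense elems_name[OF assms] ..

subsection \<open>Pairs\<close>

definition upair :: "('i, 'p) name \<Rightarrow> ('i, 'p) name \<Rightarrow> ('i, 'p) name"
  where "upair a b = name_of {(a, e), (b, e)}"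

definition opair :: "('i, 'p) name \<Rightarrow> ('i, 'p) name \<Rightarrow> ('i, 'p) name"
  where "opair a b = upair (upair a a) (upair a b)"

lemma is_name_upair: "is_name a \<Longrightarrow> is_name b \<Longrightarrow> is_name (upair a b)"
  unfolding upair_def by (rule is_name_name_of) (auto intro: small_finite e_P)

lemma is_name_opair: "is_name a \<Longrightarrow> is_name b \<Longrightarrow> is_name (opair a b)"
  unfolding opair_def by (intro is_name_upair)

lemma dense_below_cong:
  "(\<And>q. q \<in> P \<Longrightarrow> le q p \<Longrightarrow> A q = B q) \<Longrightarrow> dense_below p A = dense_below p B"
  unfolding dense_below_def by (meson le_trans)

lemma mem_upair: "(w \<^bold>\<in> upair a b) p \<longleftrightarrow> dense_below p (\<lambda>q. (w \<^bold>= a) q \<or> (w \<^bold>= b) q)"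
  unfolding upair_def mem_name_of[OF small_finite, of "{(a, e), (b, e)}", simplified]
  by (rule dense_below_cong) (use le_e in blast)

lemma mem_upairI:
  assumes "p \<in> P" "(w \<^bold>= a) p \<or> (w \<^bold>= b) p"
  shows "(w \<^bold>\<in> upair a b) p"
  unfolding mem_upair by (rule dense_belowI_mono) (use assms regD[OF reg_fEq] in blast)

text \<open>Trades the formula for equality with an explicit name. Through \<open>fOpair_iff\<close>
  and \<open>fApp_iff\<close> this eliminates all quantifiers over pairs from the later
  arguments.\<close>

lemma fPairset_iff:
  assumes "is_name u" "is_name a" "is_name b" "p \<in> P"
  shows "fPairset u a b p \<longleftrightarrow> (u \<^bold>= upair a b) p"
proof -
  have *: "fPairset u a b p \<longleftrightarrow> (\<forall>z :: ('i, 'p) name. is_name z \<longrightarrow> (\<forall>q \<in> P. le q p \<longrightarrow> (z \<^bold>\<in> u) q = (z \<^bold>\<in> upair a b) q))"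
  proof -
    have "((z \<^bold>= a \<^bold>\<or> z \<^bold>= b)) q \<longleftrightarrow> (z \<^bold>\<in> upair a b) q" if "q \<in> P" for z q
      unfolding mem_upair using fOr_iff[OF reg_fEq reg_fEq that] .
    then show ?thesis
      unfolding fPairset_def using assms(4)
      by (subst fAll_iff) (auto intro!: reg_rules simp: fIff_iff reg_rules)
  qed
  show ?thesis
  proof
    assume "fPairset u a b p"
    then show "(u \<^bold>= upair a b) p"
      unfolding * by (intro eq_extI assms is_name_upair) auto
  next
    assume eq: "(u \<^bold>= upair a b) p"
    have "(z \<^bold>\<in> u) q = (z \<^bold>\<in> upair a b) q" if "q \<in> P" "le q p" for z q
    proof -
      have "(u \<^bold>= upair a b) q" using regD[OF reg_fEq eq assms(4) that] .
      then show ?thesis using mem_cong_right[OF that(1)] eq_sym by metis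
    qed
    then show "fPairset u a b p" unfolding * by blast
  qed
qed

lemma reg_fPairset: "reg (fPairset u a b)"
  unfolding fPairset_def by (rule reg_rules)

lemma upair_cong:
  assumes "p \<in> P" "(a \<^bold>= a') p" "(b \<^bold>= b') p" "is_name a" "is_name a'" "is_name b" "is_name b'"
  shows "(upair a b \<^bold>= upair a' b') p"
proof (rule eq_extI[OF assms(1)])
  fix z q assume q: "q \<in> P" "le q p"
  have "(a \<^bold>= a') q" "(b \<^bold>= b') q" using assms(1-3) regD[OF reg_fEq] q by blast+
  then have "(z \<^bold>= a) r \<longleftrightarrow> (z \<^bold>= a') r" "(z \<^bold>= b) r \<longleftrightarrow> (z \<^bold>= b') r" if "r \<in> P" "le r q" for r
    using eq_trans[OF that(1)] regD[OF reg_fEq _ q(1) that] eq_sym by metis+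
  then show "(z \<^bold>\<in> upair a b) q \<longleftrightarrow> (z \<^bold>\<in> upair a' b') q"
    unfolding mem_upair by (intro dense_below_cong) blast
qed (intro is_name_upair assms)+

lemma opair_cong:
  assumes "p \<in> P" "(a \<^bold>= a') p" "(b \<^bold>= b') p" "is_name a" "is_name a'" "is_name b" "is_name b'"
  shows "(opair a b \<^bold>= opair a' b') p"
  unfolding opair_def by (intro upair_cong assms is_name_upair)

lemma upair_eqD1:
  assumes p: "p \<in> P" and eq: "(upair a b \<^bold>= upair c d) p"
  shows "dense_below p (\<lambda>q. (a \<^bold>= c) q \<or> (a \<^bold>= d) q)"
proof -
  have "(a \<^bold>\<in> upair c d) p"
    using mem_cong_right[OF p eq mem_upairI[OF p]] eq_refl by metis
  then show ?thesis unfolding mem_upair .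
qed

lemma upair_commute: "is_name a \<Longrightarrow> is_name b \<Longrightarrow> p \<in> P \<Longrightarrow> (upair a b \<^bold>= upair b a) p"
  by (rule eq_extI) (auto simp: is_name_upair mem_upair disj_commute)

lemma upair_singleton_eqD:
  assumes p: "p \<in> P" and eq: "(upair a a \<^bold>= upair c d) p"
  shows "(a \<^bold>= c) p" "(a \<^bold>= d) p"
proof -
  have "(c \<^bold>\<in> upair a a) p" "(d \<^bold>\<in> upair a a) p"
    using mem_cong_right[OF p _ mem_upairI[OF p]] eq_refl eq eq_sym by metis+
  then have "dense_below p (c \<^bold>= a)" "dense_below p (d \<^bold>= a)"
    unfolding mem_upair by simp_all
  then have "(c \<^bold>= a) p" "(d \<^bold>= a) p"
    using reg_fEq p unfolding reg_def by blast+
  then show "(a \<^bold>= c) p" "(a \<^bold>= d) p"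
    using eq_sym by metis+
qed

text \<open>The usual argument for Kuratowski pairs, except that every case distinction is decided
  only densely often. In the case that \<open>b\<close> equals \<open>c\<close>, exchanging the two
  pairs makes \<open>d\<close> equal to \<open>b\<close> or to \<open>a\<close>, and
  \<open>a\<close> and \<open>b\<close> both equal \<open>c\<close>.\<close>

lemma opair_eqD:
  assumes p: "p \<in> P" and eq: "(opair a b \<^bold>= opair c d) p"
    and n: "is_name a" "is_name b" "is_name c" "is_name d"
  shows "(a \<^bold>= c) p" "(b \<^bold>= d) p"
proof -
  have first: "(a \<^bold>= c) q" if q: "q \<in> P" and eq: "(opair a b \<^bold>= opair c d) q" for q a b c d
  proof (rule reg_local[OF reg_fEq q])
    fix r assume r: "r \<in> P" "le r q"
    obtain s where s: "s \<in> P" "le s r" "(upair a a \<^bold>= upair c c) s \<or> (upair a a \<^bold>= upair c d) s"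
      using dense_belowD[OF upair_eqD1[OF q eq[unfolded opair_def]] r] by blast
    then have "(a \<^bold>= c) s" using upair_singleton_eqD by metis
    then show "\<exists>s \<in> P. le s r \<and> (a \<^bold>= c) s" using s by blast
  qed
  show ac: "(a \<^bold>= c) p" by (rule first[OF p eq])
  have second: "\<exists>s \<in> P. le s r \<and> ((b \<^bold>= d) s \<or> (b \<^bold>= c) s)"
    if q: "q \<in> P" and eq: "(opair a b \<^bold>= opair c d) q" and r: "r \<in> P" "le r q"
      and n: "is_name a" "is_name b" "is_name c" "is_name d" for q r a b c d
  proof -
    have "(upair a b \<^bold>\<in> opair c d) q"
      using mem_cong_right[OF q eq[unfolded opair_def] mem_upairI[OF q]] eq_refl
      unfolding opair_def by metis
    then obtain s where s: "s \<in> P" "le s r" "(upair a b \<^bold>= upair c c) s \<or> (upair a b \<^bold>= upair c d) s"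
      unfolding opair_def mem_upair using dense_belowD[OF _ r] by blast
    then have "(upair b a \<^bold>= upair c c) s \<or> (upair b a \<^bold>= upair c d) s"
      using upair_commute[OF n(2,1) s(1)] eq_trans[OF s(1)] by blast
    then obtain t where "t \<in> P" "le t s" "(b \<^bold>= c) t \<or> (b \<^bold>= d) t"
      using upair_eqD1[OF s(1)] dense_belowD[OF _ s(1) le_refl] by blast
    then show ?thesis using s(2) le_trans by blast
  qed
  show "(b \<^bold>= d) p"
  proof (rule reg_local[OF reg_fEq p])
    fix r assume r: "r \<in> P" "le r p"
    obtain s where s: "s \<in> P" "le s r" "(b \<^bold>= d) s \<or> (b \<^bold>= c) s"
      using second[OF p eq r n] by blast
    have sp: "le s p" using le_trans[OF s(2) r(2)] .
    have eqs: "(opair c d \<^bold>= opair a b) s" using regD[OF reg_fEq eq p s(1) sp] eq_sym by metis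
    obtain t where t: "t \<in> P" "le t s" "(d \<^bold>= b) t \<or> (d \<^bold>= a) t"
      using second[OF s(1) eqs s(1) le_refl n(3,4,1,2)] by blast
    have tp: "le t p" using le_trans[OF t(2) sp] .
    have "(b \<^bold>= d) t"
    proof (cases "(b \<^bold>= d) s")
      case True
      then show ?thesis using regD[OF reg_fEq _ s(1) t(1,2)] by blast
    next
      case False
      then have "(b \<^bold>= c) t" using s(3) regD[OF reg_fEq _ s(1) t(1,2)] by blast
      moreover have "(a \<^bold>= c) t" using regD[OF reg_fEq ac p t(1) tp] .
      ultimately have "(b \<^bold>= a) t" using eq_trans[OF t(1)] eq_sym by metis
      then show ?thesis using t(3) eq_trans[OF t(1)] eq_sym by metis
    qed
    then show "\<exists>t \<in> P. le t r \<and> (b \<^bold>= d) t" using t le_trans[OF t(2) s(2)] by blast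
  qed
qed

lemma reg_fOpair: "reg (fOpair w a b)"
  unfolding fOpair_def by (rule reg_rules)

lemma fOpair_iff:
  assumes n: "is_name w" "is_name a" "is_name b" and p: "p \<in> P"
  shows "fOpair w a b p \<longleftrightarrow> (w \<^bold>= opair a b) p"
proof
  assume l: "fOpair w a b p"
  show "(w \<^bold>= opair a b) p"
  proof (rule reg_local[OF reg_fEq p])
    fix q assume q: "q \<in> P" "le q p"
    have "fOpair w a b q" using regD[OF reg_fOpair l p q] .
    then obtain r u where r: "r \<in> P" "le r q" "is_name u"
        "(\<^bold>\<exists>v. fPairset u a a \<^bold>\<and> fPairset v a b \<^bold>\<and> fPairset w u v) r"
      unfolding fOpair_def using fExD[OF _ q(1)] by blast
    then obtain s v where s: "s \<in> P" "le s r" "is_name v"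
        "fPairset u a a s" "fPairset v a b s" "fPairset w u v s"
      using fExD[OF r(4,1)] unfolding fAnd_iff by blast
    have "(u \<^bold>= upair a a) s" "(v \<^bold>= upair a b) s" "(w \<^bold>= upair u v) s"
      using fPairset_iff s r(3) n by blast+
    moreover have "(upair u v \<^bold>= opair a b) s"
      unfolding opair_def using calculation s(1,3) r(3) n by (intro upair_cong is_name_upair)
    ultimately have "(w \<^bold>= opair a b) s" using eq_trans[OF s(1)] by blast
    then show "\<exists>s \<in> P. le s q \<and> (w \<^bold>= opair a b) s" using s le_trans[OF s(2) r(2)] by blast
  qed
next
  assume "(w \<^bold>= opair a b) p"
  then have "fPairset w (upair a a) (upair a b) p"
    using fPairset_iff[OF n(1) is_name_upair is_name_upair p] n unfolding opair_def by blast
  moreover have "fPairset (upair a a) a a p" "fPairset (upair a b) a b p"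
    using fPairset_iff is_name_upair n p eq_refl by metis+
  ultimately have "(\<^bold>\<exists>v. fPairset (upair a a) a a \<^bold>\<and> fPairset v a b \<^bold>\<and> fPairset w (upair a a) v) p"
    by (intro fExI[of "upair a b"]) (auto simp: fAnd_iff n p is_name_upair intro!: reg_rules reg_fPairset)
  then show "fOpair w a b p"
    unfolding fOpair_def
    by (rule fExI[of "upair a a", rotated]) (auto simp: n p is_name_upair intro!: reg_rules)
qed

lemma reg_fApp: "reg (fApp f a b)"
  unfolding fApp_def by (rule reg_rules)

lemma fApp_iff:
  assumes n: "is_name a" "is_name b" and p: "p \<in> P"
  shows "fApp f a b p \<longleftrightarrow> (opair a b \<^bold>\<in> f) p"
proof
  assume l: "fApp f a b p"
  show "(opair a b \<^bold>\<in> f) p"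
  proof (rule reg_local[OF reg_fMem p])
    fix q assume q: "q \<in> P" "le q p"
    have "fApp f a b q" using regD[OF reg_fApp l p q] .
    then obtain r w where r: "r \<in> P" "le r q" "is_name w" "fOpair w a b r" "(w \<^bold>\<in> f) r"
      unfolding fApp_def using fExD[OF _ q(1)] unfolding fAnd_iff by blast
    then have "(opair a b \<^bold>\<in> f) r"
      using fOpair_iff[OF r(3) n r(1)] mem_cong_left[OF r(1)] by blast
    then show "\<exists>r \<in> P. le r q \<and> (opair a b \<^bold>\<in> f) r" using r by blast
  qed
next
  assume "(opair a b \<^bold>\<in> f) p"
  then show "fApp f a b p"
    unfolding fApp_def using fOpair_iff[OF is_name_opair n p] eq_refl n p
    by (intro fExI[of "opair a b"]) (auto simp: fAnd_iff is_name_opair intro!: reg_rules reg_fOpair)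
qed

lemma fApp_cong:
  fixes a b a' b' :: "('i, 'p) name"
  assumes p: "p \<in> P" and n: "is_name a" "is_name b" "is_name a'" "is_name b'"
    and eq: "(a \<^bold>= a') p" "(b \<^bold>= b') p" and app: "fApp f a b p"
  shows "fApp f a' b' p"
  using app mem_cong_left[OF p opair_cong[OF p eq]] fApp_iff n p by blast

subsection \<open>Ordinals\<close>

text \<open>Equality and order of ground model ordinals are absolute: each holds under every
  condition or under none. If \<open>n j\<close> and a later \<open>n i\<close> were forced equal,
  \<open>n j\<close> would be an element of itself, hence equal to an earlier \<open>n l\<close>
  under some condition, against the induction hypothesis.\<close>

lemma ordinal_names:
  assumes W: "Well_order r" and el: "\<And>k. k \<in> Field r \<Longrightarrow> elems (n k) = {(n j, e) | j. j \<in> underS r k}"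
    and k: "k \<in> Field r" "k' \<in> Field r" and p: "p \<in> P"
  shows "(n k \<^bold>= n k') p \<longleftrightarrow> k = k'" "(n k \<^bold>\<in> n k') p \<longleftrightarrow> k \<in> underS r k'"
proof -
  have mem: "\<exists>r' j. r' \<in> P \<and> le r' q \<and> j \<in> underS r i \<and> (w \<^bold>= n j) r'"
    if h: "(w \<^bold>\<in> n i) q" "q \<in> P" "i \<in> Field r" for w i q
  proof -
    obtain r' z s where r': "r' \<in> P" "le r' q" "(z, s) \<in> elems (n i)" "(w \<^bold>= z) r'"
      using memD[OF h(1,2) le_refl] by metis
    then obtain j where "j \<in> underS r i" "z = n j" using el[OF h(3)] by auto
    then show ?thesis using r' by blast
  qed
  have memI: "(n j \<^bold>\<in> n i) q" if "j \<in> underS r i" "q \<in> P" for i j q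
  proof -
    have "i \<in> Field r" using that(1) by (auto simp: underS_def Field_def)
    then show ?thesis using mem_elems[of "n j" e "n i" q] el that le_e by blast
  qed
  have ne: "\<not> (n j \<^bold>= n i) q" if "j \<in> underS r i" "i \<in> Field r" "q \<in> P" for i j q
  proof -
    have "wf (r - Id)" using W by (simp add: well_order_on_def)
    then show ?thesis using that
    proof (induction i arbitrary: j q rule: wf_induct_rule)
      case (less i)
      show ?case
      proof
        assume eq: "(n j \<^bold>= n i) q"
        then have "(n i \<^bold>= n j) q" using eq_sym by metis
        then have "(n j \<^bold>\<in> n j) q"
          using mem_cong_right[OF less(4) _ memI[OF less(2,4)]] by blast
        moreover have jF: "j \<in> Field r" using less(2) by (auto simp: underS_def Field_def)
        ultimately obtain q' l where "q' \<in> P" "l \<in> underS r j" "(n j \<^bold>= n l) q'"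
          using mem less(4) by blast
        moreover have "(j, i) \<in> r - Id" using less(2) by (auto simp: underS_def)
        ultimately show False using less(1) jF eq_sym by metis
      qed
    qed
  qed
  have tot: "k = k' \<or> k \<in> underS r k' \<or> k' \<in> underS r k" if "k \<in> Field r" "k' \<in> Field r" for k k'
    using W that by (auto simp: underS_def order_on_defs total_on_def)
  have eq: "(n k \<^bold>= n k') q \<longleftrightarrow> k = k'" if "k \<in> Field r" "k' \<in> Field r" "q \<in> P" for k k' q
    using tot[OF that(1,2)] ne that eq_refl eq_sym by metis
  show "(n k \<^bold>= n k') p \<longleftrightarrow> k = k'" using eq k p by blast
  show "(n k \<^bold>\<in> n k') p \<longleftrightarrow> k \<in> underS r k'"
  proof
    assume "(n k \<^bold>\<in> n k') p"
    then obtain q j where "q \<in> P" "j \<in> underS r k'" "(n k \<^bold>= n j) q" using mem k p by blast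
    moreover have "j \<in> Field r" using calculation(2) by (auto simp: underS_def Field_def)
    ultimately show "k \<in> underS r k'" using eq k(1) by blast
  qed (use memI p in blast)
qed

subsection \<open>Sets and bijections in the extension\<close>

text \<open>\<open>spans A R a p\<close>: below \<open>p\<close>, the name \<open>A\<close> denotes the set of all \<open>a x\<close> with \<open>R x y\<close>
  in the generic filter.\<close>

definition spans :: "('i, 'p) name \<Rightarrow> ('x \<Rightarrow> 'y \<Rightarrow> 'p \<Rightarrow> bool) \<Rightarrow> ('x \<Rightarrow> ('i, 'p) name) \<Rightarrow> 'p \<Rightarrow> bool"
  where "spans A R a p \<longleftrightarrow> is_name A \<and> (\<forall>w q. is_name w \<longrightarrow> q \<in> P \<longrightarrow> le q p \<longrightarrow>
    ((w \<^bold>\<in> A) q \<longleftrightarrow> dense_below q (\<lambda>r. \<exists>x y. R x y r \<and> (w \<^bold>= a x) r)))"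

definition graph_name :: "('x \<Rightarrow> 'y \<Rightarrow> 'p \<Rightarrow> bool) \<Rightarrow> ('x \<Rightarrow> ('i, 'p) name) \<Rightarrow> ('y \<Rightarrow> ('i, 'p) name) \<Rightarrow> ('i, 'p) name"
  where "graph_name R a c = name_of {(opair (a x) (c y), q) | x y q. R x y q}"

lemma dense_below_trans:
  assumes "dense_below p A" "\<And>q. q \<in> P \<Longrightarrow> le q p \<Longrightarrow> A q \<Longrightarrow> \<exists>r \<in> P. le r q \<and> B r"
  shows "dense_below p B"
  using assms le_trans unfolding dense_below_def by meson

lemma reg_dense_eq: "reg A \<Longrightarrow> p \<in> P \<Longrightarrow> dense_below p A \<Longrightarrow> A p"
  unfolding reg_def by blast

lemma fExI':
  assumes "is_name x" "A x p" "\<And>x. reg (A x)" "p \<in> P"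
  shows "(\<^bold>\<exists>x. A x) p"
  using fExI assms by metis

text \<open>As \<open>R\<close> is open, \<open>R x y s\<close> and \<open>le q s\<close> together
  give \<open>R x y q\<close>; this is how the conditions stored in the name disappear from the
  description of its elements.\<close>

lemma name_of_image:
  assumes s: "|{(x, y, q). R x y q}| \<le>o |UNIV :: 'i set|"
    and R: "\<And>x y q. R x y q \<Longrightarrow> q \<in> P \<and> is_name (g x y)"
    and R_open: "\<And>x y q r. R x y q \<Longrightarrow> r \<in> P \<Longrightarrow> le r q \<Longrightarrow> R x y r"
  shows "is_name (name_of {(g x y, q) | x y q. R x y q} :: ('i, 'p) name)"
    "(w \<^bold>\<in> (name_of {(g x y, q) | x y q. R x y q} :: ('i, 'p) name)) p \<longleftrightarrow>
      dense_below p (\<lambda>r. \<exists>x y. R x y r \<and> (w \<^bold>= g x y) r)"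
proof -
  have "{(g x y, q) | x y q. R x y q} \<subseteq> (\<lambda>(x, y, q). (g x y, q)) ` {(x, y, q). R x y q}"
  proof
    fix z assume "z \<in> {(g x y, q) | x y q. R x y q}"
    then obtain x y q where "z = (g x y, q)" "R x y q" by blast
    then show "z \<in> (\<lambda>(x, y, q). (g x y, q)) ` {(x, y, q). R x y q}"
      by (intro image_eqI[of _ _ "(x, y, q)"]) auto
  qed
  then have sm: "small {(g x y, q) | x y q. R x y q}"
    unfolding small_def
    by (rule ordLeq_transitive[OF card_of_mono1 small_name_image[OF s, unfolded small_def]])
  show "is_name (name_of {(g x y, q) | x y q. R x y q} :: ('i, 'p) name)"
    by (rule is_name_name_of[OF sm]) (use R in blast)
  show "(w \<^bold>\<in> (name_of {(g x y, q) | x y q. R x y q} :: ('i, 'p) name)) p \<longleftrightarrow>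
      dense_below p (\<lambda>r. \<exists>x y. R x y r \<and> (w \<^bold>= g x y) r)"
    unfolding mem_name_of[OF sm]
  proof (rule dense_below_cong)
    fix q assume q: "q \<in> P"
    show "(\<exists>z s. (z, s) \<in> {(g x y, q) | x y q. R x y q} \<and> le q s \<and> (w \<^bold>= z) q) \<longleftrightarrow>
        (\<exists>x y. R x y q \<and> (w \<^bold>= g x y) q)"
      using R_open[OF _ q] le_refl by blast
  qed
qed

lemma fApp_graph_name:
  assumes s: "|{(x, y, q). R x y q}| \<le>o |UNIV :: 'i set|"
    and R: "\<And>x y q. R x y q \<Longrightarrow> q \<in> P \<and> is_name (a x) \<and> is_name (c y)"
    and R_open: "\<And>x y q r. R x y q \<Longrightarrow> r \<in> P \<Longrightarrow> le r q \<Longrightarrow> R x y r"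
    and n: "is_name u" "is_name v" and p: "p \<in> P"
  shows "fApp (graph_name R a c) u v p \<longleftrightarrow>
    dense_below p (\<lambda>r. \<exists>x y. R x y r \<and> (u \<^bold>= a x) r \<and> (v \<^bold>= c y) r)"
proof -
  have "fApp (graph_name R a c) u v p \<longleftrightarrow> dense_below p (\<lambda>r. \<exists>x y. R x y r \<and> (opair u v \<^bold>= opair (a x) (c y)) r)"
    unfolding fApp_iff[OF n p] graph_name_def
    by (rule name_of_image(2)[OF s _ R_open]) (use R is_name_opair in auto)
  also have "\<dots> \<longleftrightarrow> dense_below p (\<lambda>r. \<exists>x y. R x y r \<and> (u \<^bold>= a x) r \<and> (v \<^bold>= c y) r)"
  proof (rule dense_below_cong)
    fix q assume q: "q \<in> P"
    have "(opair u v \<^bold>= opair (a x) (c y)) q \<longleftrightarrow> (u \<^bold>= a x) q \<and> (v \<^bold>= c y) q" if "R x y q" for x y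
      using opair_eqD[OF q _ n] opair_cong[OF q _ _ n(1) _ n(2)] R[OF that] by blast
    then show "(\<exists>x y. R x y q \<and> (opair u v \<^bold>= opair (a x) (c y)) q) \<longleftrightarrow>
        (\<exists>x y. R x y q \<and> (u \<^bold>= a x) q \<and> (v \<^bold>= c y) q)"
      by blast
  qed
  finally show ?thesis .
qed

text \<open>The two dense sets are met one after the other, and openness of \<open>R\<close> brings
  both pairs under the last condition.\<close>

lemma fApp_graph_name_two:
  assumes s: "|{(x, y, q). R x y q}| \<le>o |UNIV :: 'i set|"
    and R: "\<And>x y q. R x y q \<Longrightarrow> q \<in> P \<and> is_name (a x) \<and> is_name (c y)"
    and R_open: "\<And>x y q r. R x y q \<Longrightarrow> r \<in> P \<Longrightarrow> le r q \<Longrightarrow> R x y r"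
    and n: "is_name u" "is_name v" "is_name u'" "is_name v'" and q: "q \<in> P"
    and app: "fApp (graph_name R a c) u v q" "fApp (graph_name R a c) u' v' q"
    and r: "r \<in> P" "le r q"
  shows "\<exists>s x y x' y'. s \<in> P \<and> le s r \<and> R x y s \<and> (u \<^bold>= a x) s \<and> (v \<^bold>= c y) s \<and>
    R x' y' s \<and> (u' \<^bold>= a x') s \<and> (v' \<^bold>= c y') s"
proof -
  have App: "fApp (graph_name R a c) u v q \<longleftrightarrow>
      dense_below q (\<lambda>r. \<exists>x y. R x y r \<and> (u \<^bold>= a x) r \<and> (v \<^bold>= c y) r)"
    if "is_name u" "is_name v" "q \<in> P" for u v q
    by (rule fApp_graph_name[OF s R _ that]) (use R_open in blast)+
    obtain s x y where s: "s \<in> P" "le s r" "R x y s" "(u \<^bold>= a x) s" "(v \<^bold>= c y) s"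
      using dense_belowD[OF app(1)[unfolded App[OF n(1,2) q]] r] by blast
    obtain t x' y' where t: "t \<in> P" "le t s" "R x' y' t" "(u' \<^bold>= a x') t" "(v' \<^bold>= c y') t"
      using dense_belowD[OF app(2)[unfolded App[OF n(3,4) q]] s(1) le_trans[OF s(2) r(2)]] by blast
    have "R x y t" "(u \<^bold>= a x) t" "(v \<^bold>= c y) t"
      using R_open[OF s(3) t(1,2)] regD[OF reg_fEq s(4,1) t(1,2)] regD[OF reg_fEq s(5,1) t(1,2)] by auto
    then show ?thesis using t le_trans[OF t(2) s(2)] by blast
  qed

text \<open>\<open>A\<close> and \<open>B\<close> are spanned by the same relation as the graph,
  which makes the graph total and onto. The assumptions \<open>fn\<close> and \<open>inj\<close>
  make it single valued and injective up to forced equality of names.\<close>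

lemma fBij_graph_name:
  assumes s: "|{(x, y, q). R x y q}| \<le>o |UNIV :: 'i set|"
    and R: "\<And>x y q. R x y q \<Longrightarrow> q \<in> P \<and> is_name (a x) \<and> is_name (c y)"
    and R_open: "\<And>x y q r. R x y q \<Longrightarrow> r \<in> P \<Longrightarrow> le r q \<Longrightarrow> R x y r"
    and fn: "\<And>x y x' y' q. R x y q \<Longrightarrow> R x' y' q \<Longrightarrow> (a x \<^bold>= a x') q \<Longrightarrow> y = y'"
    and inj: "\<And>x y x' y' q. R x y q \<Longrightarrow> R x' y' q \<Longrightarrow> (c y \<^bold>= c y') q \<Longrightarrow> x = x'"
    and A: "spans A R a p" and B: "spans B (\<lambda>y x. R x y) c p" and p: "p \<in> P"
  shows "fBij (graph_name R a c) A B p"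
proof -
  let ?F = "graph_name R a c"
  have App: "fApp ?F u v q \<longleftrightarrow> dense_below q (\<lambda>r. \<exists>x y. R x y r \<and> (u \<^bold>= a x) r \<and> (v \<^bold>= c y) r)"
    if "is_name u" "is_name v" "q \<in> P" for u v q
    by (rule fApp_graph_name[OF s R _ that]) (use R_open in blast)+
  have memA: "(w \<^bold>\<in> A) q \<longleftrightarrow> dense_below q (\<lambda>r. \<exists>x y. R x y r \<and> (w \<^bold>= a x) r)"
    if "is_name w" "q \<in> P" "le q p" for w q
    using A that unfolding spans_def by blast
  have memB: "(w \<^bold>\<in> B) q \<longleftrightarrow> dense_below q (\<lambda>r. \<exists>y x. R x y r \<and> (w \<^bold>= c y) r)"
    if "is_name w" "q \<in> P" "le q p" for w q
    using B that unfolding spans_def by blast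
  have memF: "(w \<^bold>\<in> ?F) q \<longleftrightarrow> dense_below q (\<lambda>r. \<exists>x y. R x y r \<and> (w \<^bold>= opair (a x) (c y)) r)" for w q
    unfolding graph_name_def by (rule name_of_image(2)[OF s _ R_open]) (use R is_name_opair in auto)
  have AI: "(a x \<^bold>\<in> A) q" and BI: "(c y \<^bold>\<in> B) q" if "R x y q" "le q p" for x y q
  proof -
    have q: "q \<in> P" using R that by blast
    show "(a x \<^bold>\<in> A) q"
      unfolding memA[OF conjunct1[OF conjunct2[OF R[OF that(1)]]] q that(2)]
      by (rule dense_belowI_mono) (use R_open[OF that(1)] eq_refl in blast)
    show "(c y \<^bold>\<in> B) q"
      unfolding memB[OF conjunct2[OF conjunct2[OF R[OF that(1)]]] q that(2)]
      by (rule dense_belowI_mono) (use R_open[OF that(1)] eq_refl in blast)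
  qed
  have AppI: "fApp ?F (a x) (c y) q" if "R x y q" for x y q
  proof -
    have "q \<in> P" "is_name (a x)" "is_name (c y)" using R[OF that] by auto
    moreover have "dense_below q (\<lambda>r. \<exists>x' y'. R x' y' r \<and> (a x \<^bold>= a x') r \<and> (c y \<^bold>= c y') r)"
      by (rule dense_belowI_mono) (use R_open[OF that] eq_refl in blast)
    ultimately show ?thesis using App[of "a x" "c y" q] by simp
  qed
  have 1: "(\<^bold>\<forall>w. w \<^bold>\<in> ?F \<^bold>\<longrightarrow> (\<^bold>\<exists>u. \<^bold>\<exists>v. u \<^bold>\<in> A \<^bold>\<and> v \<^bold>\<in> B \<^bold>\<and> fOpair w u v)) p"
    unfolding fAll_iff[OF reg_fImp[OF reg_fMem reg_fEx] p] fImp_iff[OF reg_fMem reg_fEx p]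
  proof (intro allI impI ballI)
    fix w :: "('i, 'p) name" and q assume w: "is_name w" and q: "q \<in> P" "le q p" "(w \<^bold>\<in> ?F) q"
    show "(\<^bold>\<exists>u. \<^bold>\<exists>v. u \<^bold>\<in> A \<^bold>\<and> v \<^bold>\<in> B \<^bold>\<and> fOpair w u v) q"
    proof (rule reg_dense_eq[OF reg_fEx q(1)], rule dense_below_trans)
      show "dense_below q (\<lambda>r. \<exists>x y. R x y r \<and> (w \<^bold>= opair (a x) (c y)) r)"
        using q(3) memF by blast
      fix r assume r: "r \<in> P" "le r q" "\<exists>x y. R x y r \<and> (w \<^bold>= opair (a x) (c y)) r"
      then obtain x y where xy: "R x y r" "(w \<^bold>= opair (a x) (c y)) r" by blast
      have n: "is_name (a x)" "is_name (c y)" using R xy by auto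
      have "le r p" using le_trans r(2) q(2) by blast
      then have "(a x \<^bold>\<in> A \<^bold>\<and> c y \<^bold>\<in> B \<^bold>\<and> fOpair w (a x) (c y)) r"
        using AI BI xy fOpair_iff[OF w n r(1)] by (simp add: fAnd_iff)
      then have "(\<^bold>\<exists>v. a x \<^bold>\<in> A \<^bold>\<and> v \<^bold>\<in> B \<^bold>\<and> fOpair w (a x) v) r"
        by (rule fExI'[OF n(2) _ _ r(1)]) (intro reg_rules reg_fOpair)
      then have "(\<^bold>\<exists>u. \<^bold>\<exists>v. u \<^bold>\<in> A \<^bold>\<and> v \<^bold>\<in> B \<^bold>\<and> fOpair w u v) r"
        by (rule fExI'[OF n(1) _ _ r(1)]) (rule reg_fEx)
      then show "\<exists>s \<in> P. le s r \<and> (\<^bold>\<exists>u. \<^bold>\<exists>v. u \<^bold>\<in> A \<^bold>\<and> v \<^bold>\<in> B \<^bold>\<and> fOpair w u v) s"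
        using r(1) le_refl by blast
    qed
  qed
  have 2: "(\<^bold>\<forall>u. u \<^bold>\<in> A \<^bold>\<longrightarrow> (\<^bold>\<exists>v. fApp ?F u v)) p"
    unfolding fAll_iff[OF reg_fImp[OF reg_fMem reg_fEx] p] fImp_iff[OF reg_fMem reg_fEx p]
  proof (intro allI impI ballI)
    fix u :: "('i, 'p) name" and q assume u: "is_name u" and q: "q \<in> P" "le q p" "(u \<^bold>\<in> A) q"
    show "(\<^bold>\<exists>v. fApp ?F u v) q"
    proof (rule reg_dense_eq[OF reg_fEx q(1)], rule dense_below_trans)
      show "dense_below q (\<lambda>r. \<exists>x y. R x y r \<and> (u \<^bold>= a x) r)"
        using q memA u by blast
      fix r assume r: "r \<in> P" "le r q" "\<exists>x y. R x y r \<and> (u \<^bold>= a x) r"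
      then obtain x y where xy: "R x y r" "(u \<^bold>= a x) r" by blast
      have n: "is_name (a x)" "is_name (c y)" using R xy by auto
      have "fApp ?F u (c y) r"
        using fApp_cong[OF r(1) n u n(2) _ eq_refl AppI[OF xy(1)]] xy(2) eq_sym by metis
      then have "(\<^bold>\<exists>v. fApp ?F u v) r"
        by (rule fExI'[OF n(2) _ _ r(1)]) (rule reg_fApp)
      then show "\<exists>s \<in> P. le s r \<and> (\<^bold>\<exists>v. fApp ?F u v) s"
        using r(1) le_refl by blast
    qed
  qed
  have 4: "(\<^bold>\<forall>v. v \<^bold>\<in> B \<^bold>\<longrightarrow> (\<^bold>\<exists>u. fApp ?F u v)) p"
    unfolding fAll_iff[OF reg_fImp[OF reg_fMem reg_fEx] p] fImp_iff[OF reg_fMem reg_fEx p]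
  proof (intro allI impI ballI)
    fix v :: "('i, 'p) name" and q assume v: "is_name v" and q: "q \<in> P" "le q p" "(v \<^bold>\<in> B) q"
    show "(\<^bold>\<exists>u. fApp ?F u v) q"
    proof (rule reg_dense_eq[OF reg_fEx q(1)], rule dense_below_trans)
      show "dense_below q (\<lambda>r. \<exists>y x. R x y r \<and> (v \<^bold>= c y) r)"
        using q memB v by blast
      fix r assume r: "r \<in> P" "le r q" "\<exists>y x. R x y r \<and> (v \<^bold>= c y) r"
      then obtain x y where xy: "R x y r" "(v \<^bold>= c y) r" by blast
      have n: "is_name (a x)" "is_name (c y)" using R xy by auto
      have "fApp ?F (a x) v r"
        using fApp_cong[OF r(1) n n(1) v eq_refl _ AppI[OF xy(1)]] xy(2) eq_sym by metis
      then have "(\<^bold>\<exists>u. fApp ?F u v) r"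
        by (rule fExI'[OF n(1) _ _ r(1)]) (rule reg_fApp)
      then show "\<exists>s \<in> P. le s r \<and> (\<^bold>\<exists>u. fApp ?F u v) s"
        using r(1) le_refl by blast
    qed
  qed
  have two: "\<exists>s x y x' y'. s \<in> P \<and> le s r \<and> R x y s \<and> (u \<^bold>= a x) s \<and> (v \<^bold>= c y) s \<and>
      R x' y' s \<and> (u' \<^bold>= a x') s \<and> (v' \<^bold>= c y') s"
    if "is_name u" "is_name v" "is_name u'" "is_name v'" "q \<in> P"
      "fApp ?F u v q" "fApp ?F u' v' q" "r \<in> P" "le r q" for u v u' v' q r
    by (rule fApp_graph_name_two[OF s _ _ that]) (use R R_open in blast)+
  have 3: "(\<^bold>\<forall>u. \<^bold>\<forall>v. \<^bold>\<forall>v'. fApp ?F u v \<^bold>\<and> fApp ?F u v' \<^bold>\<longrightarrow> v \<^bold>= v') p"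
  proof -
    have "(v \<^bold>= v') q" if n: "is_name u" "is_name v" "is_name v'" and q: "q \<in> P" "le q p"
      and app: "fApp ?F u v q" "fApp ?F u v' q" for u v v' q
    proof (rule reg_local[OF reg_fEq q(1)])
      fix r assume r: "r \<in> P" "le r q"
      obtain s x y x' y' where s: "s \<in> P" "le s r" "R x y s" "(u \<^bold>= a x) s" "(v \<^bold>= c y) s"
          "R x' y' s" "(u \<^bold>= a x') s" "(v' \<^bold>= c y') s"
        using two[OF n(1,2,1,3) q(1) app r] by blast
      have "(a x \<^bold>= a x') s" using s(4,7) eq_trans[OF s(1)] eq_sym by metis
      then have "y = y'" using fn s(3,6) by blast
      then have "(v \<^bold>= v') s" using s(5,8) eq_trans[OF s(1)] eq_sym by metis
      then show "\<exists>s \<in> P. le s r \<and> (v \<^bold>= v') s" using s by blast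
    qed
    then show ?thesis
      using p by (simp add: fAll_iff fImp_iff fAnd_iff reg_rules reg_fApp)
  qed
  have 5: "(\<^bold>\<forall>u. \<^bold>\<forall>u'. \<^bold>\<forall>v. fApp ?F u v \<^bold>\<and> fApp ?F u' v \<^bold>\<longrightarrow> u \<^bold>= u') p"
  proof -
    have "(u \<^bold>= u') q" if n: "is_name u" "is_name u'" "is_name v" and q: "q \<in> P" "le q p"
      and app: "fApp ?F u v q" "fApp ?F u' v q" for u u' v q
    proof (rule reg_local[OF reg_fEq q(1)])
      fix r assume r: "r \<in> P" "le r q"
      obtain s x y x' y' where s: "s \<in> P" "le s r" "R x y s" "(u \<^bold>= a x) s" "(v \<^bold>= c y) s"
          "R x' y' s" "(u' \<^bold>= a x') s" "(v \<^bold>= c y') s"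
        using two[OF n(1,3,2,3) q(1) app r] by blast
      have "(c y \<^bold>= c y') s" using s(5,8) eq_trans[OF s(1)] eq_sym by metis
      then have "x = x'" using inj s(3,6) by blast
      then have "(u \<^bold>= u') s" using s(4,7) eq_trans[OF s(1)] eq_sym by metis
      then show "\<exists>s \<in> P. le s r \<and> (u \<^bold>= u') s" using s by blast
    qed
    then show ?thesis
      using p by (simp add: fAll_iff fImp_iff fAnd_iff reg_rules reg_fApp)
  qed
  show ?thesis
    unfolding fBij_def fFun_def by (intro fAnd_iff[THEN iffD2] conjI 1 2 3 4 5)
qed

lemma reg_fSubset: "reg (x \<^bold>\<subseteq> y)"
  unfolding fSubset_def by (rule reg_rules)

lemma fSubset_iff:
  "p \<in> P \<Longrightarrow> (x \<^bold>\<subseteq> y) p \<longleftrightarrow> (\<forall>z :: ('i, 'p) name. is_name z \<longrightarrow> (\<forall>q \<in> P. le q p \<longrightarrow> (z \<^bold>\<in> x) q \<longrightarrow> (z \<^bold>\<in> y) q))"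
  unfolding fSubset_def by (simp add: fAll_iff fImp_iff reg_rules)

lemma spansD:
  assumes "spans X R m p" "is_name w" "(w \<^bold>\<in> X) q" "q \<in> P" "le q p" "r \<in> P" "le r q"
  shows "\<exists>s x y. s \<in> P \<and> le s r \<and> R x y s \<and> (w \<^bold>= m x) s"
  using assms unfolding spans_def dense_below_def by blast

lemma spansI:
  assumes "spans X R m p" "R x y q" "q \<in> P" "le q p" "is_name (m x)"
    and "\<And>r. r \<in> P \<Longrightarrow> le r q \<Longrightarrow> R x y r"
  shows "(m x \<^bold>\<in> X) q"
proof -
  have "dense_below q (\<lambda>r. \<exists>x' y. R x' y r \<and> (m x \<^bold>= m x') r)"
    by (rule dense_belowI_mono) (use assms(6) eq_refl in blast)
  then show ?thesis using assms unfolding spans_def by blast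
qed

lemma spans_subset:
  assumes X: "spans X R m p" and p: "p \<in> P"
    and l: "\<And>x y q. R x y q \<Longrightarrow> q \<in> P \<Longrightarrow> (m x \<^bold>\<in> l) q"
  shows "(X \<^bold>\<subseteq> l) p"
  unfolding fSubset_iff[OF p]
proof (intro allI impI ballI)
  fix z :: "('i, 'p) name" and q assume z: "is_name z" and q: "q \<in> P" "le q p" "(z \<^bold>\<in> X) q"
  show "(z \<^bold>\<in> l) q"
  proof (rule reg_local[OF reg_fMem q(1)])
    fix r assume "r \<in> P" "le r q"
    then obtain s x y where s: "s \<in> P" "le s r" "R x y s" "(z \<^bold>= m x) s"
      using spansD[OF X z q(3,1,2)] by blast
    have "(z \<^bold>\<in> l) s"
      using mem_cong_left[OF s(1) _ l[OF s(3,1)]] s(4) eq_sym by metis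
    then show "\<exists>s \<in> P. le s r \<and> (z \<^bold>\<in> l) s" using s by blast
  qed
qed

definition in_pairs :: "('i, 'p) name \<Rightarrow> ('i, 'p) name \<Rightarrow> 'p \<Rightarrow> bool"
  where "in_pairs A u = (\<^bold>\<exists>a. \<^bold>\<exists>b. a \<^bold>\<in> A \<^bold>\<and> b \<^bold>\<in> A \<^bold>\<and> \<^bold>\<not> (a \<^bold>= b) \<^bold>\<and> fPairset u a b)"

lemma reg_in_pairs: "reg (in_pairs A u)"
  unfolding in_pairs_def by (rule reg_fEx)

lemma in_pairsI:
  assumes n: "is_name u" "is_name a" "is_name b" and p: "p \<in> P"
    and m: "(a \<^bold>\<in> A) p" "(b \<^bold>\<in> A) p" "\<And>q. q \<in> P \<Longrightarrow> le q p \<Longrightarrow> \<not> (a \<^bold>= b) q" "(u \<^bold>= upair a b) p"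
  shows "in_pairs A u p"
proof -
  have "(a \<^bold>\<in> A \<^bold>\<and> b \<^bold>\<in> A \<^bold>\<and> \<^bold>\<not> (a \<^bold>= b) \<^bold>\<and> fPairset u a b) p"
    using m fPairset_iff[OF n p] by (simp add: fAnd_iff fNot_iff)
  then have "(\<^bold>\<exists>b. a \<^bold>\<in> A \<^bold>\<and> b \<^bold>\<in> A \<^bold>\<and> \<^bold>\<not> (a \<^bold>= b) \<^bold>\<and> fPairset u a b) p"
    by (rule fExI'[OF n(3) _ _ p]) (intro reg_rules reg_fPairset)
  then show ?thesis
    unfolding in_pairs_def by (rule fExI'[OF n(2) _ _ p]) (rule reg_fEx)
qed

lemma in_pairsD:
  assumes n: "is_name u" and p: "p \<in> P" and i: "in_pairs A u p" and q: "q \<in> P" "le q p"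
  shows "\<exists>r a b. r \<in> P \<and> le r q \<and> is_name a \<and> is_name b \<and> (a \<^bold>\<in> A) r \<and> (b \<^bold>\<in> A) r \<and>
    (\<forall>s \<in> P. le s r \<longrightarrow> \<not> (a \<^bold>= b) s) \<and> (u \<^bold>= upair a b) r"
proof -
  have "in_pairs A u q" using regD[OF reg_in_pairs i p q] .
  from fExD[OF this[unfolded in_pairs_def] q(1)] obtain r a where r: "r \<in> P" "le r q" "is_name a"
      "(\<^bold>\<exists>b. a \<^bold>\<in> A \<^bold>\<and> b \<^bold>\<in> A \<^bold>\<and> \<^bold>\<not> (a \<^bold>= b) \<^bold>\<and> fPairset u a b) r"
    by blast
  from fExD[OF r(4,1)] obtain s b where s: "s \<in> P" "le s r" "is_name b"
      "(a \<^bold>\<in> A \<^bold>\<and> b \<^bold>\<in> A \<^bold>\<and> \<^bold>\<not> (a \<^bold>= b) \<^bold>\<and> fPairset u a b) s"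
    by blast
  have "le s q" using le_trans[OF s(2) r(2)] .
  then show ?thesis
    using s r(3) fPairset_iff[OF n r(3) s(3,1)] unfolding fAnd_iff fNot_iff by blast
qed

lemma fPairs_iff:
  assumes p: "p \<in> P"
  shows "fPairs D A p \<longleftrightarrow> (\<forall>u :: ('i, 'p) name. is_name u \<longrightarrow>
    (\<forall>q \<in> P. le q p \<longrightarrow> (u \<^bold>\<in> D) q = in_pairs A u q))"
  unfolding fPairs_def in_pairs_def[symmetric]
  by (simp add: fAll_iff[OF reg_fIff[OF reg_fMem reg_in_pairs] p] fIff_iff[OF reg_fMem reg_in_pairs p])

lemma reg_fPairs: "reg (fPairs D A)"
  unfolding fPairs_def by (rule reg_fAll)

lemma fHomogeneous_spans:
  assumes X: "spans X R m p" and p: "p \<in> P"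
    and s: "|{(x, x', q). (\<exists>y y'. R x y q \<and> R x' y' q) \<and> x \<noteq> x'}| \<le>o |UNIV :: 'i set|"
    and R: "\<And>x y q. R x y q \<Longrightarrow> q \<in> P \<and> is_name (m x)"
    and R_open: "\<And>x y q r. R x y q \<Longrightarrow> r \<in> P \<Longrightarrow> le r q \<Longrightarrow> R x y r"
    and inj: "\<And>x y x' y' q. R x y q \<Longrightarrow> R x' y' q \<Longrightarrow> (m x \<^bold>= m x') q \<Longrightarrow> x = x'"
    and i: "is_name i"
    and col: "\<And>x y x' y' q. R x y q \<Longrightarrow> R x' y' q \<Longrightarrow> x \<noteq> x' \<Longrightarrow> le q p \<Longrightarrow> fApp c (upair (m x) (m x')) i q"
  shows "fHomogeneous c X i p"
proof -
  \<comment> \<open>\<open>fHomogeneous\<close> asks for the set of pairs of \<open>X\<close> as an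
    object of the extension; \<open>R2\<close> is the relation from which its name \<open>D\<close>
    is built.\<close>
  define R2 where "R2 x x' q \<longleftrightarrow> (\<exists>y y'. R x y q \<and> R x' y' q) \<and> x \<noteq> x'" for x x' q
  define D where "D = (name_of {(upair (m x) (m x'), q) | x x' q. R2 x x' q} :: ('i, 'p) name)"
  have R2: "q \<in> P \<and> is_name (upair (m x) (m x'))" if "R2 x x' q" for x x' q
    using that R is_name_upair unfolding R2_def by blast
  have R2_open: "R2 x x' r" if "R2 x x' q" "r \<in> P" "le r q" for x x' q r
    using that R_open unfolding R2_def by blast
  have s2: "|{(x, x', q). R2 x x' q}| \<le>o |UNIV :: 'i set|"
    using s by (simp add: R2_def)
  have D: "is_name D"
    unfolding D_def by (rule name_of_image(1)[OF s2]) (use R2 R2_open in blast)+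
  have memD': "(w \<^bold>\<in> D) q \<longleftrightarrow> dense_below q (\<lambda>r. \<exists>x x'. R2 x x' r \<and> (w \<^bold>= upair (m x) (m x')) r)" for w q
    unfolding D_def by (rule name_of_image(2)[OF s2]) (use R2 R2_open in blast)+
  have "fPairs D X p"
    unfolding fPairs_iff[OF p]
  proof (intro allI impI ballI iffI)
    fix u :: "('i, 'p) name" and q
    assume u: "is_name u" and q: "q \<in> P" "le q p" "(u \<^bold>\<in> D) q"
    show "in_pairs X u q"
    proof (rule reg_local[OF reg_in_pairs q(1)])
      fix r assume r: "r \<in> P" "le r q"
      obtain t x x' where t: "t \<in> P" "le t r" "R2 x x' t" "(u \<^bold>= upair (m x) (m x')) t"
        using dense_belowD[OF q(3)[unfolded memD'] r] by blast
      have tp: "le t p" using le_trans[OF t(2) le_trans[OF r(2) q(2)]] .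
      obtain y y' where y: "R x y t" "R x' y' t" "x \<noteq> x'" using t(3) unfolding R2_def by blast
      have n: "is_name (m x)" "is_name (m x')" using R y by auto
      have "in_pairs X u t"
      proof (rule in_pairsI[OF u n t(1) _ _ _ t(4)])
        show "(m x \<^bold>\<in> X) t" "(m x' \<^bold>\<in> X) t"
          using spansI[OF X y(1) t(1) tp n(1) R_open[OF y(1)]]
            spansI[OF X y(2) t(1) tp n(2) R_open[OF y(2)]] by auto
        show "\<not> (m x \<^bold>= m x') q" if "q \<in> P" "le q t" for q
          using inj[OF R_open[OF y(1) that] R_open[OF y(2) that]] y(3) by blast
      qed
      then show "\<exists>t \<in> P. le t r \<and> in_pairs X u t" using t by blast
    qed
  next
    fix u :: "('i, 'p) name" and q
    assume u: "is_name u" and q: "q \<in> P" "le q p" "in_pairs X u q"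
    show "(u \<^bold>\<in> D) q"
    proof (rule reg_local[OF reg_fMem q(1)])
      fix r0 assume r0: "r0 \<in> P" "le r0 q"
      obtain r a b where r: "r \<in> P" "le r r0" and n: "is_name a" "is_name b"
          and ab: "(a \<^bold>\<in> X) r" "(b \<^bold>\<in> X) r" "\<forall>s \<in> P. le s r \<longrightarrow> \<not> (a \<^bold>= b) s" "(u \<^bold>= upair a b) r"
        using in_pairsD[OF u q(1,3) r0] by blast
      have rp: "le r p" using le_trans[OF r(2) le_trans[OF r0(2) q(2)]] .
      obtain t x y where t: "t \<in> P" "le t r" "R x y t" "(a \<^bold>= m x) t"
        using spansD[OF X n(1) ab(1) r(1) rp r(1) le_refl] by blast
      obtain v x' y' where v: "v \<in> P" "le v t" "R x' y' v" "(b \<^bold>= m x') v"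
        using spansD[OF X n(2) ab(2) r(1) rp t(1,2)] by blast
      have vr: "le v r" using le_trans[OF v(2) t(2)] .
      have xv: "R x y v" "(a \<^bold>= m x) v" using R_open[OF t(3) v(1,2)] regD[OF reg_fEq t(4,1) v(1,2)] by auto
      have nm: "is_name (m x)" "is_name (m x')" using R xv v by auto
      have "x \<noteq> x'"
      proof
        assume "x = x'"
        then have "(a \<^bold>= b) v" using xv(2) v(4) eq_trans[OF v(1)] eq_sym by metis
        then show False using ab(3) v(1) vr by blast
      qed
      then have R2v: "R2 x x' v" using xv v unfolding R2_def by blast
      have "(u \<^bold>= upair a b) v" using regD[OF reg_fEq ab(4) r(1) v(1) vr] .
      then have "(u \<^bold>= upair (m x) (m x')) v"
        using eq_trans[OF v(1) _ upair_cong[OF v(1) xv(2) v(4) n(1) nm(1) n(2) nm(2)]] by blast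
      moreover have "(upair (m x) (m x') \<^bold>\<in> D) v"
        unfolding memD' by (rule dense_belowI_mono) (use R2_open[OF R2v] eq_refl in blast)
      ultimately have "(u \<^bold>\<in> D) v" using mem_cong_left[OF v(1)] eq_sym by metis
      then show "\<exists>v \<in> P. le v r0 \<and> (u \<^bold>\<in> D) v" using v(1) le_trans[OF vr r(2)] by blast
    qed
  qed
  moreover have "(\<^bold>\<forall>u. u \<^bold>\<in> D \<^bold>\<longrightarrow> fApp c u i) p"
    unfolding fAll_iff[OF reg_fImp[OF reg_fMem reg_fApp] p] fImp_iff[OF reg_fMem reg_fApp p]
  proof (intro allI impI ballI)
    fix u :: "('i, 'p) name" and q
    assume u: "is_name u" and q: "q \<in> P" "le q p" "(u \<^bold>\<in> D) q"
    show "fApp c u i q"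
    proof (rule reg_local[OF reg_fApp q(1)])
      fix r assume r: "r \<in> P" "le r q"
      obtain t x x' where t: "t \<in> P" "le t r" "R2 x x' t" "(u \<^bold>= upair (m x) (m x')) t"
        using dense_belowD[OF q(3)[unfolded memD'] r] by blast
      have tp: "le t p" using le_trans[OF t(2) le_trans[OF r(2) q(2)]] .
      have "fApp c (upair (m x) (m x')) i t"
        using col tp t(3) unfolding R2_def by blast
      then have "fApp c u i t"
        using fApp_cong[OF t(1) _ i u i _ eq_refl] R2[OF t(3)] t(4) eq_sym by metis
      then show "\<exists>t \<in> P. le t r \<and> fApp c u i t" using t by blast
    qed
  qed
  ultimately have "(fPairs D X \<^bold>\<and> (\<^bold>\<forall>u. u \<^bold>\<in> D \<^bold>\<longrightarrow> fApp c u i)) p"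
    by (simp add: fAnd_iff)
  then show ?thesis
    unfolding fHomogeneous_def
    by (rule fExI'[OF D _ _ p]) (intro reg_fAnd reg_fPairs reg_fAll)
qed

lemma fOrdertype_graph_name:
  assumes s: "|{(x, y, q). R x y q}| \<le>o |UNIV :: 'i set|"
    and R: "\<And>x y q. R x y q \<Longrightarrow> q \<in> P \<and> is_name (a x) \<and> is_name (c y)"
    and R_open: "\<And>x y q r. R x y q \<Longrightarrow> r \<in> P \<Longrightarrow> le r q \<Longrightarrow> R x y r"
    and bij: "fBij (graph_name R a c) z Y p" and p: "p \<in> P"
    and ord: "\<And>x y x' y' q. R x y q \<Longrightarrow> R x' y' q \<Longrightarrow> (a x \<^bold>\<in> a x') q = (c y \<^bold>\<in> c y') q"
  shows "fOrdertype Y z p"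
proof -
  let ?F = "graph_name R a c"
  have F: "is_name ?F"
    unfolding graph_name_def by (rule name_of_image(1)[OF s]) (use R is_name_opair R_open in blast)+
  have "(u \<^bold>\<in> v \<^bold>\<longleftrightarrow> u' \<^bold>\<in> v') q"
    if n: "is_name u" "is_name v" "is_name u'" "is_name v'" and q: "q \<in> P"
      and app: "fApp ?F u u' q" "fApp ?F v v' q" for u v u' v' q
  proof (rule reg_local[OF reg_fIff[OF reg_fMem reg_fMem] q])
    fix r assume r: "r \<in> P" "le r q"
    have "\<exists>t x y x' y'. t \<in> P \<and> le t r \<and> R x y t \<and> (u \<^bold>= a x) t \<and> (u' \<^bold>= c y) t \<and>
        R x' y' t \<and> (v \<^bold>= a x') t \<and> (v' \<^bold>= c y') t"
      by (rule fApp_graph_name_two[OF s _ _ n(1,3,2,4) q app r]) (use R R_open in blast)+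
    then obtain t x y x' y' where t: "t \<in> P" "le t r" "R x y t" "(u \<^bold>= a x) t" "(u' \<^bold>= c y) t"
        "R x' y' t" "(v \<^bold>= a x') t" "(v' \<^bold>= c y') t"
      by blast
    have "(u \<^bold>\<in> v) w = (u' \<^bold>\<in> v') w" if w: "w \<in> P" "le w t" for w
    proof -
      note e = regD[OF reg_fEq _ t(1) w]
      have "(u \<^bold>\<in> v) w = (a x \<^bold>\<in> a x') w"
        using e[OF t(4)] e[OF t(7)] mem_cong_left[OF w(1)] mem_cong_right[OF w(1)] eq_sym by metis
      also have "\<dots> = (c y \<^bold>\<in> c y') w"
        using ord R_open[OF t(3) w] R_open[OF t(6) w] by blast
      also have "\<dots> = (u' \<^bold>\<in> v') w"
        using e[OF t(5)] e[OF t(8)] mem_cong_left[OF w(1)] mem_cong_right[OF w(1)] eq_sym by metis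
      finally show ?thesis .
    qed
    then have "(u \<^bold>\<in> v \<^bold>\<longleftrightarrow> u' \<^bold>\<in> v') t"
      by (simp add: fIff_iff[OF reg_fMem reg_fMem t(1)])
    then show "\<exists>t \<in> P. le t r \<and> (u \<^bold>\<in> v \<^bold>\<longleftrightarrow> u' \<^bold>\<in> v') t" using t by blast
  qed
  then have "(\<^bold>\<forall>u. \<^bold>\<forall>v. \<^bold>\<forall>u'. \<^bold>\<forall>v'. fApp ?F u u' \<^bold>\<and> fApp ?F v v' \<^bold>\<longrightarrow> (u \<^bold>\<in> v \<^bold>\<longleftrightarrow> u' \<^bold>\<in> v')) p"
    using p by (simp add: fAll_iff fImp_iff fAnd_iff reg_rules reg_fApp)
  with bij have "(fBij ?F z Y \<^bold>\<and>
      (\<^bold>\<forall>u. \<^bold>\<forall>v. \<^bold>\<forall>u'. \<^bold>\<forall>v'. fApp ?F u u' \<^bold>\<and> fApp ?F v v' \<^bold>\<longrightarrow> (u \<^bold>\<in> v \<^bold>\<longleftrightarrow> u' \<^bold>\<in> v'))) p"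
    by (simp add: fAnd_iff)
  then show ?thesis
    unfolding fOrdertype_def
    by (rule fExI'[OF F _ _ p]) (auto simp: fBij_def fFun_def intro!: reg_rules)
qed

text \<open>Since \<open>c\<close> is only a name, neither colour need be forced at
  \<open>q\<close>. Densely often, however, a value of \<open>c\<close> at the pair is found in
  \<open>C\<close>, and \<open>C\<close> is forced to have no other elements than the two
  colours.\<close>

lemma coloring_decided:
  assumes p: "p \<in> P" and n: "is_name red" "is_name green" "is_name C" "is_name x" "is_name y"
    and C: "fPairset C red green p" and D: "fPairs D l p" and c: "fFun c D C p"
    and q: "q \<in> P" "le q p"
    and xy: "(x \<^bold>\<in> l) q" "(y \<^bold>\<in> l) q" "\<And>r. r \<in> P \<Longrightarrow> le r q \<Longrightarrow> \<not> (x \<^bold>= y) r"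
  shows "dense_below q (\<lambda>r. fApp c (upair x y) red r \<or> fApp c (upair x y) green r)"
proof -
  let ?u = "upair x y"
  have u: "is_name ?u" by (intro is_name_upair n)
  have uD: "(?u \<^bold>\<in> D) q"
    using D[unfolded fPairs_iff[OF p]] u q in_pairsI[OF u n(4,5) q(1) xy eq_refl] by blast
  have tot: "(\<^bold>\<exists>b. fApp c ?u b) q"
  proof -
    have "(\<^bold>\<forall>a. a \<^bold>\<in> D \<^bold>\<longrightarrow> (\<^bold>\<exists>b. fApp c a b)) p"
      using c unfolding fFun_def fAnd_def by blast
    then show ?thesis
      unfolding fAll_iff[OF reg_fImp[OF reg_fMem reg_fEx] p] fImp_iff[OF reg_fMem reg_fEx p]
      using u q uD by blast
  qed
  have ran: "(\<^bold>\<exists>a. \<^bold>\<exists>b. a \<^bold>\<in> D \<^bold>\<and> b \<^bold>\<in> C \<^bold>\<and> fOpair w a b) r"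
    if "is_name w" "r \<in> P" "le r p" "(w \<^bold>\<in> c) r" for w :: "('i, 'p) name" and r
  proof -
    have "(\<^bold>\<forall>w. w \<^bold>\<in> c \<^bold>\<longrightarrow> (\<^bold>\<exists>a. \<^bold>\<exists>b. a \<^bold>\<in> D \<^bold>\<and> b \<^bold>\<in> C \<^bold>\<and> fOpair w a b)) p"
      using c unfolding fFun_def fAnd_def by blast
    then show ?thesis
      unfolding fAll_iff[OF reg_fImp[OF reg_fMem reg_fEx] p] fImp_iff[OF reg_fMem reg_fEx p]
      using that by blast
  qed
  show ?thesis
    unfolding dense_below_def
  proof (intro ballI impI)
    fix r0 assume r0: "r0 \<in> P" "le r0 q"
    from fExD[OF regD[OF reg_fEx tot q(1) r0] r0(1)]
    obtain r v where r: "r \<in> P" "le r r0" "is_name v" "fApp c ?u v r" by blast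
    have rp: "le r p" using le_trans[OF r(2) le_trans[OF r0(2) q(2)]] .
    have ov: "(opair ?u v \<^bold>\<in> c) r" using fApp_iff[OF u r(3,1)] r(4) by blast
    from fExD[OF ran[OF is_name_opair[OF u r(3)] r(1) rp ov] r(1)]
    obtain s a where s: "s \<in> P" "le s r" "is_name a"
        "(\<^bold>\<exists>b. a \<^bold>\<in> D \<^bold>\<and> b \<^bold>\<in> C \<^bold>\<and> fOpair (opair ?u v) a b) s" by blast
    from fExD[OF s(4,1)] obtain t b where t: "t \<in> P" "le t s" "is_name b"
        "(b \<^bold>\<in> C) t" "fOpair (opair ?u v) a b t"
      unfolding fAnd_iff by blast
    have "(opair ?u v \<^bold>= opair a b) t"
      using t(5) fOpair_iff[OF is_name_opair[OF u r(3)] s(3) t(3,1)] by blast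
    then have "(v \<^bold>= b) t" using opair_eqD(2)[OF t(1) _ u r(3) s(3) t(3)] by blast
    then have vC: "(v \<^bold>\<in> C) t" using mem_cong_left[OF t(1) _ t(4)] eq_sym by metis
    have tp: "le t p" using le_trans[OF t(2) le_trans[OF s(2) rp]] .
    have "(C \<^bold>= upair red green) p" using C fPairset_iff[OF n(3,1,2) p] by blast
    then have "(C \<^bold>= upair red green) t" using regD[OF reg_fEq _ p t(1) tp] by blast
    then have "(v \<^bold>\<in> upair red green) t" using mem_cong_right[OF t(1) _ vC] by blast
    then obtain w where w: "w \<in> P" "le w t" "(v \<^bold>= red) w \<or> (v \<^bold>= green) w"
      unfolding mem_upair using dense_belowD[OF _ t(1) le_refl] by blast
    have wr: "le w r" using le_trans[OF w(2) le_trans[OF t(2) s(2)]] .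
    have "fApp c ?u v w" using regD[OF reg_fApp r(4,1) w(1) wr] .
    then have "fApp c ?u red w \<or> fApp c ?u green w"
      using w(3) fApp_cong[OF w(1) u r(3) u _ eq_refl] n(1,2) by blast
    then show "\<exists>w \<in> P. le w r0 \<and> (fApp c ?u red w \<or> fApp c ?u green w)"
      using w(1) le_trans[OF wr r(2)] by blast
  qed
qed

subsection \<open>The partition relation\<close>

lemma elems_elem_name:
  assumes r: "Well_order r" "|Field r| \<le>o |UNIV :: 'i set|"
  shows "elems (elem_name e r a :: ('i, 'p) name) = {(elem_name e r b, e) | b. b \<in> underS r a}"
proof -
  have "{(elem_name e r b :: ('i, 'p) name, e) | b. b \<in> underS r a} = (\<lambda>b. (elem_name e r b, e)) ` underS r a"
    by blast
  moreover have "|underS r a| \<le>o |UNIV :: 'i set|"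
    by (rule card_of_subset_le[OF r(2)]) (auto simp: underS_def Field_def)
  ultimately have "small {(elem_name e r b :: ('i, 'p) name, e) | b. b \<in> underS r a}"
    using small_name_image by metis
  then show ?thesis
    by (subst elem_name_unfold[OF r(1)]) (rule elems_name)
qed

lemma elems_ord_name:
  assumes r: "|Field r| \<le>o |UNIV :: 'i set|"
  shows "elems (ord_name e r :: ('i, 'p) name) = {(elem_name e r a, e) | a. a \<in> Field r}"
proof -
  have "{(elem_name e r b :: ('i, 'p) name, e) | b. b \<in> Field r} = (\<lambda>b. (elem_name e r b, e)) ` Field r"
    by blast
  then have "small {(elem_name e r b :: ('i, 'p) name, e) | b. b \<in> Field r}"
    using small_name_image[OF r] by metis
  then show ?thesis
    unfolding ord_name_def by (rule elems_name)
qed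

lemma is_name_elem_name:
  assumes r: "Well_order r" "|Field r| \<le>o |UNIV :: 'i set|"
  shows "is_name (elem_name e r a :: ('i, 'p) name)"
proof (induction a rule: wf_induct_rule[OF wf_underS[OF r(1)]])
  case (1 a)
  then show ?case
    by (intro is_name.intros) (auto simp: elems_elem_name[OF r] e_P)
qed

lemma is_name_ord_name:
  assumes r: "Well_order r" "|Field r| \<le>o |UNIV :: 'i set|"
  shows "is_name (ord_name e r :: ('i, 'p) name)"
  by (intro is_name.intros) (auto simp: elems_ord_name[OF r(2)] is_name_elem_name[OF r] e_P)

lemma elems_succ_name:
  assumes "|Field r| \<le>o |UNIV :: 'i set|"
  shows "elems (succ_name e (ord_name e r) :: ('i, 'p) name) =
    insert (ord_name e r, e) {(elem_name e r a, e) | a. a \<in> Field r}"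
proof -
  have "{(elem_name e r b :: ('i, 'p) name, e) | b. b \<in> Field r} = (\<lambda>b. (elem_name e r b, e)) ` Field r"
    by blast
  then have "small {(elem_name e r b :: ('i, 'p) name, e) | b. b \<in> Field r}"
    using small_name_image[OF assms] by metis
  then show ?thesis
    unfolding succ_name_def elems_ord_name[OF assms] by (intro elems_name small_insert)
qed

text \<open>The elements of a ground model set are known, so a relation spans it once each of them
  is met densely often. This turns the density clauses for \<open>H\<close> into the statement that
  every element of \<open>lam\<close>, or of \<open>\<theta> + 1\<close>, is used.\<close>

lemma spans_ground:
  assumes A: "is_name A" "elems A = {(n k, e) | k. k \<in> J}"
    and R: "\<And>k y q. R k y q \<Longrightarrow> k \<in> J"
    and dense: "\<And>k q. k \<in> J \<Longrightarrow> q \<in> P \<Longrightarrow> le q p \<Longrightarrow> \<exists>r y. r \<in> P \<and> le r q \<and> R k y r"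
  shows "spans A R n p"
  unfolding spans_def
proof (intro conjI A(1) allI impI)
  fix w :: "('i, 'p) name" and q assume q: "q \<in> P" "le q p"
  show "(w \<^bold>\<in> A) q \<longleftrightarrow> dense_below q (\<lambda>r. \<exists>k y. R k y r \<and> (w \<^bold>= n k) r)"
  proof
    assume w: "(w \<^bold>\<in> A) q"
    show "dense_below q (\<lambda>r. \<exists>k y. R k y r \<and> (w \<^bold>= n k) r)"
      unfolding dense_below_def
    proof (intro ballI impI)
      fix r assume r: "r \<in> P" "le r q"
      obtain s z t where s: "s \<in> P" "le s r" "(z, t) \<in> elems A" "(w \<^bold>= z) s"
        using memD[OF w r] by metis
      obtain k where k: "k \<in> J" "z = n k" using s(3) A(2) by auto
      have "le s p" using le_trans[OF s(2) le_trans[OF r(2) q(2)]] .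
      then obtain u y where u: "u \<in> P" "le u s" "R k y u" using dense[OF k(1) s(1)] by blast
      have "(w \<^bold>= n k) u" using regD[OF reg_fEq s(4,1) u(1,2)] k(2) by simp
      then show "\<exists>u \<in> P. le u r \<and> (\<exists>k y. R k y u \<and> (w \<^bold>= n k) u)"
        using u le_trans[OF u(2) s(2)] by blast
    qed
  next
    assume d: "dense_below q (\<lambda>r. \<exists>k y. R k y r \<and> (w \<^bold>= n k) r)"
    show "(w \<^bold>\<in> A) q"
    proof (rule reg_local[OF reg_fMem q(1)])
      fix r assume r: "r \<in> P" "le r q"
      obtain s k y where s: "s \<in> P" "le s r" "R k y s" "(w \<^bold>= n k) s"
        using dense_belowD[OF d r] by blast
      have "(n k, e) \<in> elems A" using R[OF s(3)] A(2) by auto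
      then have "(n k \<^bold>\<in> A) s" using mem_elems[OF _ s(1) le_e[OF s(1)]] by blast
      then have "(w \<^bold>\<in> A) s" using mem_cong_left[OF s(1)] s(4) eq_sym by metis
      then show "\<exists>s \<in> P. le s r \<and> (w \<^bold>\<in> A) s" using s by blast
    qed
  qed
qed

lemma spans_name_of:
  assumes "|{(x, y, q). R x y q}| \<le>o |UNIV :: 'i set|"
    and "\<And>x y q. R x y q \<Longrightarrow> q \<in> P \<and> is_name (m x)"
    and "\<And>x y q r. R x y q \<Longrightarrow> r \<in> P \<Longrightarrow> le r q \<Longrightarrow> R x y r"
  shows "spans (name_of {(m x, q) | x y q. R x y q}) R m p"
  unfolding spans_def
proof (intro conjI allI impI)
  show "is_name (name_of {(m x, q) | x y q. R x y q} :: ('i, 'p) name)"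
    by (rule name_of_image(1)[OF assms(1), where g = "\<lambda>x y. m x"]) (use assms(2,3) in blast)+
  show "(w \<^bold>\<in> (name_of {(m x, q) | x y q. R x y q} :: ('i, 'p) name)) q \<longleftrightarrow>
      dense_below q (\<lambda>r. \<exists>x y. R x y r \<and> (w \<^bold>= m x) r)" for w q
    by (rule name_of_image(2)[OF assms(1), where g = "\<lambda>x y. m x"]) (use assms(2,3) in blast)+
qed

end

section \<open>From relations in the ground model to red and green sets in the extension\<close>

locale ground_names = forcing_names P le e ity
  for P :: "'p set" and le :: "'p \<Rightarrow> 'p \<Rightarrow> bool" and e :: 'p and ity :: "'i itself" +
  fixes lam :: "'l rel" and \<theta> :: "'t rel"
  assumes lam_wo: "Well_order lam" and theta_wo: "Well_order \<theta>"
    and P_small: "|P| \<le>o |UNIV :: 'i set|"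
    and lam_small: "|Field lam| \<le>o |UNIV :: 'i set|"
    and theta_small: "|Field \<theta>| \<le>o |UNIV :: 'i set|"
begin

abbreviation "m b \<equiv> (elem_name e lam b :: ('i, 'p) name)"
abbreviation "l \<equiv> (ord_name e lam :: ('i, 'p) name)"
abbreviation "z \<equiv> (succ_name e (ord_name e \<theta>) :: ('i, 'p) name)"

lemma Times_small:
  "|A| \<le>o |UNIV :: 'i set| \<Longrightarrow> |B| \<le>o |UNIV :: 'i set| \<Longrightarrow> |A \<times> B| \<le>o |UNIV :: 'i set|"
  by (rule card_of_Times_le[OF infinite_i])

lemma elems_m: "elems (m b) = {(m a, e) | a. a \<in> underS lam b}"
  by (rule elems_elem_name[OF lam_wo lam_small])

lemma elems_l: "elems l = {(m a, e) | a. a \<in> Field lam}"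
  by (rule elems_ord_name[OF lam_small])

lemma is_name_m: "is_name (m b)" and is_name_l: "is_name l"
  using is_name_elem_name[OF lam_wo lam_small] is_name_ord_name[OF lam_wo lam_small] by blast+

lemma m_eq: "a \<in> Field lam \<Longrightarrow> b \<in> Field lam \<Longrightarrow> p \<in> P \<Longrightarrow> (m a \<^bold>= m b) p \<longleftrightarrow> a = b"
  and m_mem: "a \<in> Field lam \<Longrightarrow> b \<in> Field lam \<Longrightarrow> p \<in> P \<Longrightarrow> (m a \<^bold>\<in> m b) p \<longleftrightarrow> a \<in> underS lam b"
  using ordinal_names[OF lam_wo elems_m] by blast+

lemma m_l: "a \<in> Field lam \<Longrightarrow> p \<in> P \<Longrightarrow> (m a \<^bold>\<in> l) p"
  by (rule mem_elems[where s = e]) (auto simp: elems_l le_e)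

definition n :: "'t option \<Rightarrow> ('i, 'p) name"
  where "n k = (case k of Some a \<Rightarrow> elem_name e \<theta> a | None \<Rightarrow> ord_name e \<theta>)"

abbreviation "J \<equiv> insert None (Some ` Field \<theta>)"

lemma n_Some_set: "{(n j, e) | j. j \<in> Some ` X} = {(elem_name e \<theta> a, e) | a. a \<in> X}"
proof -
  have "{(n j, e) | j. j \<in> Some ` X} = {(n (Some a), e) | a. a \<in> X}"
    by blast
  then show ?thesis by (simp add: n_def)
qed

lemma elems_n: "elems (n k) = {(n j, e) | j. j \<in> underS (order_succ \<theta>) k}"
proof (cases k)
  case None
  then show ?thesis
    unfolding underS_order_succ(2) n_Some_set None
    by (simp add: n_def elems_ord_name[OF theta_small])
next
  case (Some a)
  then show ?thesis
    unfolding underS_order_succ(1) n_Some_set Some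
    by (simp add: n_def elems_elem_name[OF theta_wo theta_small])
qed

lemma n_eq: "j \<in> J \<Longrightarrow> k \<in> J \<Longrightarrow> p \<in> P \<Longrightarrow> (n j \<^bold>= n k) p \<longleftrightarrow> j = k"
  and n_mem: "j \<in> J \<Longrightarrow> k \<in> J \<Longrightarrow> p \<in> P \<Longrightarrow> (n j \<^bold>\<in> n k) p \<longleftrightarrow> j \<in> underS (order_succ \<theta>) k"
  using ordinal_names[OF Well_order_order_succ[OF theta_wo] elems_n] unfolding Field_order_succ by blast+

lemma is_name_n: "is_name (n k)"
  using is_name_elem_name[OF theta_wo theta_small] is_name_ord_name[OF theta_wo theta_small]
  by (auto simp: n_def split: option.split)

lemma elems_z: "elems z = {(n k, e) | k. k \<in> J}"
proof -
  have "{(n k, e) | k. k \<in> J} = insert (n None, e) {(n k, e) | k. k \<in> Some ` Field \<theta>}"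
    by blast
  then show ?thesis
    unfolding elems_succ_name[OF theta_small] n_Some_set by (simp add: n_def)
qed

lemma is_name_z: "is_name z"
  by (intro is_name.intros) (auto simp: elems_z is_name_n e_P)

lemma J_small: "|J| \<le>o |UNIV :: 'i set|"
proof -
  have "|{None} \<union> Some ` Field \<theta>| \<le>o |UNIV :: 'i set|"
    using infinite_i
    by (intro card_of_Un_le card_of_image_le theta_small)
      (auto simp: infinite_i Field_card_of card_of_well_order_on
        intro!: ordLess_imp_ordLeq finite_ordLess_infinite)
  then show ?thesis by simp
qed

lemma relation_small:
  assumes "\<And>x y q. R x y q \<Longrightarrow> x \<in> A \<and> y \<in> B \<and> q \<in> P"
    and "|A| \<le>o |UNIV :: 'i set|" "|B| \<le>o |UNIV :: 'i set|"
  shows "|{(x, y, q). R x y q}| \<le>o |UNIV :: 'i set|"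
proof -
  have "|A \<times> B \<times> P| \<le>o |UNIV :: 'i set|"
    by (intro Times_small assms P_small)
  then show ?thesis
    by (rule card_of_subset_le) (use assms(1) in auto)
qed

lemma red_conclusion:
  assumes p: "p \<in> P" and red: "is_name red"
    and H: "\<And>x b q. H x b q \<Longrightarrow> q \<in> P \<and> x \<in> Field lam \<and> b \<in> Field lam"
    and H_open: "\<And>x b q r. H x b q \<Longrightarrow> r \<in> P \<Longrightarrow> le r q \<Longrightarrow> H x b r"
    and H_fun: "\<And>x b b' q. H x b q \<Longrightarrow> H x b' q \<Longrightarrow> b = b'"
    and H_inj: "\<And>x y b q. H x b q \<Longrightarrow> H y b q \<Longrightarrow> x = y"
    and H_dense: "\<And>x q. x \<in> Field lam \<Longrightarrow> q \<in> P \<Longrightarrow> le q p \<Longrightarrow> \<exists>r b. le r q \<and> H x b r"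
    and col: "\<And>x y a b q. H x a q \<Longrightarrow> H y b q \<Longrightarrow> a \<noteq> b \<Longrightarrow> le q p \<Longrightarrow> fApp c (upair (m a) (m b)) red q"
  shows "(\<^bold>\<exists>X. X \<^bold>\<subseteq> l \<^bold>\<and> fEquipotent X l \<^bold>\<and> fHomogeneous c X red) p"
proof -
  \<comment> \<open>The arguments are exchanged because the bijection runs from the red set
    \<open>X\<close> to \<open>lam\<close>, while \<open>H\<close> runs the other way.\<close>
  define R where "R b x q \<longleftrightarrow> H x b q" for b x q
  have R: "q \<in> P" "x \<in> Field lam" "b \<in> Field lam" if "R b x q" for b x q
    using H that unfolding R_def by blast+
  have R_open: "R b x r" if "R b x q" "r \<in> P" "le r q" for b x q r
    using H_open that unfolding R_def by blast
  have sR: "|{(b, x, q). R b x q}| \<le>o |UNIV :: 'i set|"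
    by (rule relation_small[OF _ lam_small lam_small]) (use R in blast)
  define X where "X = (name_of {(m b, q) | b x q. R b x q} :: ('i, 'p) name)"
  have X: "spans X R m p"
    unfolding X_def by (rule spans_name_of[OF sR]) (use R is_name_m R_open in blast)+
  have L: "spans l (\<lambda>x b. R b x) m p"
  proof (rule spans_ground[OF is_name_l elems_l])
    fix x q assume "x \<in> Field lam" "q \<in> P" "le q p"
    then obtain r b where "le r q" "H x b r" using H_dense by blast
    then show "\<exists>r y. r \<in> P \<and> le r q \<and> R y x r"
      using H unfolding R_def by blast
  qed (use R in blast)
  have Xn: "is_name X" using X unfolding spans_def by blast
  have sub: "(X \<^bold>\<subseteq> l) p"
    by (rule spans_subset[OF X p]) (use m_l R in blast)
  have bij: "fBij (graph_name R m m) X l p"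
  proof (rule fBij_graph_name[OF sR _ R_open _ _ X L p])
    show "q \<in> P \<and> is_name (m b) \<and> is_name (m x)" if "R b x q" for b x q
      using R(1)[OF that] is_name_m by blast
    show "x = x'" if "R b x q" "R b' x' q" "(m b \<^bold>= m b') q" for b x b' x' q
    proof -
      have "b = b'" using that m_eq R by blast
      then show ?thesis using H_inj that unfolding R_def by blast
    qed
    show "b = b'" if "R b x q" "R b' x' q" "(m x \<^bold>= m x') q" for b x b' x' q
    proof -
      have "x = x'" using that m_eq R by blast
      then show ?thesis using H_fun that unfolding R_def by blast
    qed
  qed
  have Fn: "is_name (graph_name R m m)"
    unfolding graph_name_def
  proof (rule name_of_image(1)[OF sR])
    show "q \<in> P \<and> is_name (opair (m b) (m x))" if "R b x q" for b x q
      using R(1)[OF that] is_name_opair is_name_m by blast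
  qed (rule R_open)
  have equi: "fEquipotent X l p"
    unfolding fEquipotent_def
    by (rule fExI'[OF Fn _ _ p], rule bij) (auto simp: fBij_def fFun_def intro!: reg_rules)
  have hom: "fHomogeneous c X red p"
  proof (rule fHomogeneous_spans[OF X p _ _ R_open _ red])
    show "|{(x, x', q). (\<exists>y y'. R x y q \<and> R x' y' q) \<and> x \<noteq> x'}| \<le>o |UNIV :: 'i set|"
      by (rule relation_small[OF _ lam_small lam_small]) (use R in blast)
    show "q \<in> P \<and> is_name (m b)" if "R b x q" for b x q
      using R(1)[OF that] is_name_m by blast
    show "b = b'" if "R b x q" "R b' x' q" "(m b \<^bold>= m b') q" for b x b' x' q
      using that m_eq R by blast
    show "fApp c (upair (m b) (m b')) red q"
      if "R b x q" "R b' x' q" "b \<noteq> b'" "le q p" for b x b' x' q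
      using col that unfolding R_def by blast
  qed
  have "(X \<^bold>\<subseteq> l \<^bold>\<and> fEquipotent X l \<^bold>\<and> fHomogeneous c X red) p"
    using sub equi hom by (simp add: fAnd_iff)
  then show ?thesis
    by (rule fExI'[OF Xn _ _ p])
      (auto simp: fEquipotent_def fHomogeneous_def intro!: reg_rules reg_fSubset)
qed

lemma green_conclusion:
  assumes p: "p \<in> P" and green: "is_name green" and b: "b \<in> Field lam"
    and H: "\<And>x a q. H x a q \<Longrightarrow> q \<in> P \<and> a \<in> underS lam b"
    and H_open: "\<And>x a q r. H x a q \<Longrightarrow> r \<in> P \<Longrightarrow> le r q \<Longrightarrow> H x a r"
    and H_fun: "\<And>x a a' q. H x a q \<Longrightarrow> H x a' q \<Longrightarrow> a = a'"
    and H_dense: "\<And>x q. x \<in> Field \<theta> \<Longrightarrow> q \<in> P \<Longrightarrow> le q p \<Longrightarrow> \<exists>r a. le r q \<and> H x a r"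
    and H_less: "\<And>x y a a' q. H x a q \<Longrightarrow> H y a' q \<Longrightarrow> x \<in> underS \<theta> y \<Longrightarrow> a \<in> underS lam a'"
    and top: "\<And>x a q. H x a q \<Longrightarrow> fApp c (upair (m a) (m b)) green q"
    and col: "\<And>x y a a' q. H x a q \<Longrightarrow> H y a' q \<Longrightarrow> x \<in> underS \<theta> y \<Longrightarrow>
      fApp c (upair (m a) (m a')) green q"
  shows "(\<^bold>\<exists>Y. Y \<^bold>\<subseteq> l \<^bold>\<and> fOrdertype Y z \<^bold>\<and> fHomogeneous c Y green) p"
proof -
  \<comment> \<open>The top point \<open>b\<close> becomes the entry at \<open>None\<close> and is
    decided by every condition.\<close>
  define R where "R k a q \<longleftrightarrow> q \<in> P \<and> (case k of Some x \<Rightarrow> x \<in> Field \<theta> \<and> H x a q | None \<Rightarrow> a = b)" for k a q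
  have R: "q \<in> P" "k \<in> J" "a \<in> Field lam" if "R k a q" for k a q
    using that H b underS_FieldD[of a lam b] unfolding R_def by (auto split: option.splits)
  have R_open: "R k a r" if "R k a q" "r \<in> P" "le r q" for k a q r
    using H_open that unfolding R_def by (auto split: option.splits)
  have R_fun: "a = a'" if "R k a q" "R k a' q" for k a a' q
    using that H_fun unfolding R_def by (auto split: option.splits)
  have R_less: "a \<in> underS lam a' \<and> fApp c (upair (m a) (m a')) green q"
    if r: "R k a q" "R k' a' q" and less: "k \<in> underS (order_succ \<theta>) k'" for k a k' a' q
  proof (cases k')
    case None
    then obtain x where "k = Some x" using less by (auto simp: underS_order_succ)
    then show ?thesis using r None H top unfolding R_def by auto
  next
    case (Some y)
    then obtain x where "k = Some x" "x \<in> underS \<theta> y" using less by (auto simp: underS_order_succ)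
    then show ?thesis using r Some H_less col unfolding R_def by auto
  qed
  have tot: "k = k' \<or> k \<in> underS (order_succ \<theta>) k' \<or> k' \<in> underS (order_succ \<theta>) k"
    if "k \<in> J" "k' \<in> J" for k k'
    using underS_total[OF Well_order_order_succ[OF theta_wo]] that unfolding Field_order_succ .
  have R_iff: "k \<in> underS (order_succ \<theta>) k' \<longleftrightarrow> a \<in> underS lam a'"
    if r: "R k a q" "R k' a' q" for k a k' a' q
    using tot[OF R(2)[OF r(1)] R(2)[OF r(2)]] R_less r R_fun underS_irrefl underS_asym[OF lam_wo] by metis
  have R_inj: "k = k'" if r: "R k a q" "R k' a q" for k a k' q
    using tot[OF R(2)[OF r(1)] R(2)[OF r(2)]] R_less r underS_irrefl by metis
  have sR: "|{(k, a, q). R k a q}| \<le>o |UNIV :: 'i set|"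
    by (rule relation_small[OF _ J_small lam_small]) (use R in blast)
  have sR': "|{(a, k, q). R k a q}| \<le>o |UNIV :: 'i set|"
    by (rule relation_small[OF _ lam_small J_small]) (use R in blast)
  define Y where "Y = (name_of {(m a, q) | a k q. R k a q} :: ('i, 'p) name)"
  have Y: "spans Y (\<lambda>a k. R k a) m p"
    unfolding Y_def by (rule spans_name_of[OF sR']) (use R is_name_m R_open in blast)+
  have Z: "spans z R n p"
  proof (rule spans_ground[OF is_name_z elems_z])
    fix k q assume k: "k \<in> J" and q: "q \<in> P" "le q p"
    show "\<exists>r a. r \<in> P \<and> le r q \<and> R k a r"
    proof (cases k)
      case None
      then show ?thesis using q le_refl unfolding R_def by auto
    next
      case (Some x)
      then have x: "x \<in> Field \<theta>" using k by auto
      then obtain r a where "le r q" "H x a r" using H_dense q by blast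
      then have "r \<in> P \<and> le r q \<and> R k a r" using x H Some unfolding R_def by auto
      then show ?thesis by blast
    qed
  qed (use R in blast)
  have Yn: "is_name Y" using Y unfolding spans_def by blast
  have sub: "(Y \<^bold>\<subseteq> l) p"
    by (rule spans_subset[OF Y p]) (use m_l R in blast)
  have Rn: "q \<in> P \<and> is_name (n k) \<and> is_name (m a)" if "R k a q" for k a q
    using R(1)[OF that] is_name_m is_name_n by blast
  have bij: "fBij (graph_name R n m) z Y p"
  proof (rule fBij_graph_name[OF sR Rn R_open _ _ Z Y p])
    show "a = a'" if r: "R k a q" "R k' a' q" and eq: "(n k \<^bold>= n k') q" for k a k' a' q
    proof -
      have "k = k'"
        using n_eq[OF R(2)[OF r(1)] R(2)[OF r(2)] R(1)[OF r(1)]] eq by simp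
      then show ?thesis using R_fun r by blast
    qed
    show "k = k'" if r: "R k a q" "R k' a' q" and eq: "(m a \<^bold>= m a') q" for k a k' a' q
    proof -
      have "a = a'"
        using m_eq[OF R(3)[OF r(1)] R(3)[OF r(2)] R(1)[OF r(1)]] eq by simp
      then show ?thesis using R_inj r by blast
    qed
  qed
  have ord: "fOrdertype Y z p"
  proof (rule fOrdertype_graph_name[OF sR Rn R_open bij p])
    show "(n k \<^bold>\<in> n k') q = (m a \<^bold>\<in> m a') q" if r: "R k a q" "R k' a' q" for k a k' a' q
      using n_mem[OF R(2)[OF r(1)] R(2)[OF r(2)] R(1)[OF r(1)]]
        m_mem[OF R(3)[OF r(1)] R(3)[OF r(2)] R(1)[OF r(1)]] R_iff[OF r] by simp
  qed
  have hom: "fHomogeneous c Y green p"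
  proof (rule fHomogeneous_spans[OF Y p _ _ R_open _ green])
    show "|{(a, a', q). (\<exists>k k'. R k a q \<and> R k' a' q) \<and> a \<noteq> a'}| \<le>o |UNIV :: 'i set|"
      by (rule relation_small[OF _ lam_small lam_small]) (use R in blast)
    show "q \<in> P \<and> is_name (m a)" if "R k a q" for a k q
      using R(1)[OF that] is_name_m by blast
    show "a = a'" if "R k a q" "R k' a' q" "(m a \<^bold>= m a') q" for a k a' k' q
      using that m_eq R by blast
    show "fApp c (upair (m a) (m a')) green q"
      if r: "R k a q" "R k' a' q" and ne: "a \<noteq> a'" and "le q p" for a k a' k' q
    proof -
      have "k \<noteq> k'" using r ne R_fun by blast
      then consider "k \<in> underS (order_succ \<theta>) k'" | "k' \<in> underS (order_succ \<theta>) k"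
        using tot[OF R(2)[OF r(1)] R(2)[OF r(2)]] by blast
      then show ?thesis
      proof cases
        case 1
        then show ?thesis using R_less r by blast
      next
        case 2
        then have "fApp c (upair (m a') (m a)) green q" using R_less r by blast
        then show ?thesis
          using fApp_cong[OF R(1)[OF r(1)] is_name_upair green is_name_upair green
              upair_commute[OF is_name_m is_name_m R(1)[OF r(1)]] eq_refl] is_name_m by blast
      qed
    qed
  qed
  have "(Y \<^bold>\<subseteq> l \<^bold>\<and> fOrdertype Y z \<^bold>\<and> fHomogeneous c Y green) p"
    using sub ord hom by (simp add: fAnd_iff)
  then show ?thesis
    by (rule fExI'[OF Yn _ _ p])
      (auto simp: fOrdertype_def fHomogeneous_def intro!: reg_rules reg_fSubset)
qed

text \<open>Together with \<open>green_alternative\<close> this is the interface between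
  combinatorics and forcing language: it mentions points of the ground model and conditions, but no
  names.\<close>

definition red_alternative :: "('l \<Rightarrow> 'l \<Rightarrow> 'p \<Rightarrow> bool) \<Rightarrow> 'p \<Rightarrow> bool"
  where "red_alternative Gr p \<longleftrightarrow> (\<exists>H.
    (\<forall>x b q. H x b q \<longrightarrow> q \<in> P \<and> x \<in> Field lam \<and> b \<in> Field lam) \<and>
    (\<forall>x b q r. H x b q \<longrightarrow> r \<in> P \<longrightarrow> le r q \<longrightarrow> H x b r) \<and>
    (\<forall>x b b' q. H x b q \<longrightarrow> H x b' q \<longrightarrow> b = b') \<and>
    (\<forall>x y b q. H x b q \<longrightarrow> H y b q \<longrightarrow> x = y) \<and>
    (\<forall>x \<in> Field lam. \<forall>q \<in> P. le q p \<longrightarrow> (\<exists>r b. le r q \<and> H x b r)) \<and>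
    (\<forall>x y a b q. H x a q \<longrightarrow> H y b q \<longrightarrow> a \<in> underS lam b \<longrightarrow> \<not> Gr a b q))"

definition green_alternative :: "('l \<Rightarrow> 'l \<Rightarrow> 'p \<Rightarrow> bool) \<Rightarrow> 'p \<Rightarrow> bool"
  where "green_alternative Gr p \<longleftrightarrow> (\<exists>b \<in> Field lam. \<exists>H.
    (\<forall>x a q. H x a q \<longrightarrow> q \<in> P \<and> a \<in> underS lam b \<and> Gr a b q) \<and>
    (\<forall>x a q r. H x a q \<longrightarrow> r \<in> P \<longrightarrow> le r q \<longrightarrow> H x a r) \<and>
    (\<forall>x a a' q. H x a q \<longrightarrow> H x a' q \<longrightarrow> a = a') \<and>
    (\<forall>x \<in> Field \<theta>. \<forall>q \<in> P. le q p \<longrightarrow> (\<exists>r a. le r q \<and> H x a r)) \<and>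
    (\<forall>x y a a' q. H x a q \<longrightarrow> H y a' q \<longrightarrow> x \<in> underS \<theta> y \<longrightarrow> a \<in> underS lam a' \<and> Gr a a' q))"

lemma reg_fFun: "reg (fFun f A B)"
  unfolding fFun_def by (intro reg_rules)

text \<open>A disjunction need only be forced densely, so it suffices that every condition has an
  extension with one of the two alternatives. The colouring enters as the relation \<open>Gr\<close>
  of being forced green, which is open.\<close>

lemma fArrowI:
  assumes p: "p \<in> P"
    and alt: "\<And>Gr q. (\<And>a b r. Gr a b r \<Longrightarrow> r \<in> P) \<Longrightarrow>
      (\<And>a b r s. Gr a b r \<Longrightarrow> s \<in> P \<Longrightarrow> le s r \<Longrightarrow> Gr a b s) \<Longrightarrow> q \<in> P \<Longrightarrow>
      \<exists>r \<in> P. le r q \<and> (red_alternative Gr r \<or> green_alternative Gr r)"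
  shows "fArrow l z p"
proof -
  have main: "((\<^bold>\<exists>X. X \<^bold>\<subseteq> l \<^bold>\<and> fEquipotent X l \<^bold>\<and> fHomogeneous c X red) \<^bold>\<or>
      (\<^bold>\<exists>Y. Y \<^bold>\<subseteq> l \<^bold>\<and> fOrdertype Y z \<^bold>\<and> fHomogeneous c Y green)) q"
    if nm: "is_name red" "is_name green" "is_name C" "is_name D" "is_name c"
      and q: "q \<in> P" and C: "fPairset C red green q" and D: "fPairs D l q" and c: "fFun c D C q"
    for red green C D c q
    unfolding fOr_iff[OF reg_fEx reg_fEx q] dense_below_def
  proof (intro ballI impI)
    fix q0 assume q0: "q0 \<in> P" "le q0 q"
    define Gr where "Gr a b r \<longleftrightarrow> r \<in> P \<and> fApp c (upair (m a) (m b)) green r" for a b r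
    have Gr_open: "Gr a b s" if "Gr a b r" "s \<in> P" "le s r" for a b r s
      using that regD[OF reg_fApp] unfolding Gr_def by blast
    obtain r where r: "r \<in> P" "le r q0" "red_alternative Gr r \<or> green_alternative Gr r"
      using alt[of Gr q0] Gr_open q0(1) unfolding Gr_def by blast
    have rq: "le r q" using le_trans[OF r(2) q0(2)] .
    from r(3) have "(\<^bold>\<exists>X. X \<^bold>\<subseteq> l \<^bold>\<and> fEquipotent X l \<^bold>\<and> fHomogeneous c X red) r \<or>
        (\<^bold>\<exists>Y. Y \<^bold>\<subseteq> l \<^bold>\<and> fOrdertype Y z \<^bold>\<and> fHomogeneous c Y green) r"
    proof
      assume "red_alternative Gr r"
      then obtain H where h:
    "(\<forall>x b q. H x b q \<longrightarrow> q \<in> P \<and> x \<in> Field lam \<and> b \<in> Field lam) \<and>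
    (\<forall>x b q r. H x b q \<longrightarrow> r \<in> P \<longrightarrow> le r q \<longrightarrow> H x b r) \<and>
    (\<forall>x b b' q. H x b q \<longrightarrow> H x b' q \<longrightarrow> b = b') \<and>
    (\<forall>x y b q. H x b q \<longrightarrow> H y b q \<longrightarrow> x = y) \<and>
    (\<forall>x \<in> Field lam. \<forall>q \<in> P. le q r \<longrightarrow> (\<exists>r b. le r q \<and> H x b r)) \<and>
    (\<forall>x y a b q. H x a q \<longrightarrow> H y b q \<longrightarrow> a \<in> underS lam b \<longrightarrow> \<not> Gr a b q)"
        unfolding red_alternative_def by (elim exE) (rule that)
      note H = conjunct1[OF h, rule_format]
      note h2 = conjunct2[OF h]
      note H_open = conjunct1[OF h2, rule_format]
      note h3 = conjunct2[OF h2]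
      note H_fun = conjunct1[OF h3, rule_format]
      note h4 = conjunct2[OF h3]
      note H_inj = conjunct1[OF h4, rule_format]
      note h5 = conjunct2[OF h4]
      note H_dense = conjunct1[OF h5, rule_format]
      note H_red = conjunct2[OF h5, rule_format]
      \<comment> \<open>No extension of \<open>s\<close> forces the pair to be green, while its
        colour is decided densely often. So red is forced densely below \<open>s\<close>, and by
        regularity at \<open>s\<close> itself.\<close>
      have less: "fApp c (upair (m a) (m b)) red s"
        if h: "H x a s" "H y b s" and ab: "a \<in> underS lam b" and sr: "le s r" for x y a b s
      proof (rule reg_local[OF reg_fApp])
        show s: "s \<in> P" using H h(1) by blast
        have F: "a \<in> Field lam" "b \<in> Field lam" using H h by blast+
        have ne: "\<not> (m a \<^bold>= m b) t" if "t \<in> P" "le t s" for t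
          using m_eq[OF F that(1)] ab underS_irrefl by metis
        have dec: "dense_below s (\<lambda>t. fApp c (upair (m a) (m b)) red t \<or> fApp c (upair (m a) (m b)) green t)"
          by (rule coloring_decided[OF q nm(1-3) is_name_m is_name_m C D c s
                le_trans[OF sr rq] m_l[OF F(1) s] m_l[OF F(2) s] ne])
        fix t assume t: "t \<in> P" "le t s"
        obtain u where u: "u \<in> P" "le u t"
            "fApp c (upair (m a) (m b)) red u \<or> fApp c (upair (m a) (m b)) green u"
          using dense_belowD[OF dec t] by blast
        have us: "le u s" using le_trans[OF u(2) t(2)] .
        have "\<not> Gr a b u"
          by (rule H_red[OF H_open[OF h(1) u(1) us] H_open[OF h(2) u(1) us] ab])
        then show "\<exists>u \<in> P. le u t \<and> fApp c (upair (m a) (m b)) red u"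
          using u unfolding Gr_def by blast
      qed
      have "(\<^bold>\<exists>X. X \<^bold>\<subseteq> l \<^bold>\<and> fEquipotent X l \<^bold>\<and> fHomogeneous c X red) r"
      proof (rule red_conclusion[OF r(1) nm(1) H H_open H_fun H_inj H_dense])
        fix x y a b s assume h: "H x a s" "H y b s" and ne: "a \<noteq> b" and sr: "le s r"
        have s: "s \<in> P" and F: "a \<in> Field lam" "b \<in> Field lam" using H h by blast+
        consider "a \<in> underS lam b" | "b \<in> underS lam a"
          using underS_total[OF lam_wo F] ne by blast
        then show "fApp c (upair (m a) (m b)) red s"
        proof cases
          case 1
          then show ?thesis using less h sr by blast
        next
          case 2
          then have "fApp c (upair (m b) (m a)) red s" using less h sr by blast
          then show ?thesis
            using fApp_cong[OF s is_name_upair nm(1) is_name_upair nm(1)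
                upair_commute[OF is_name_m is_name_m s] eq_refl] is_name_m by blast
        qed
      qed
      then show ?thesis ..
    next
      assume "green_alternative Gr r"
      then obtain b H where b: "b \<in> Field lam" and h:
    "(\<forall>x a q. H x a q \<longrightarrow> q \<in> P \<and> a \<in> underS lam b \<and> Gr a b q) \<and>
    (\<forall>x a q r. H x a q \<longrightarrow> r \<in> P \<longrightarrow> le r q \<longrightarrow> H x a r) \<and>
    (\<forall>x a a' q. H x a q \<longrightarrow> H x a' q \<longrightarrow> a = a') \<and>
    (\<forall>x \<in> Field \<theta>. \<forall>q \<in> P. le q r \<longrightarrow> (\<exists>r a. le r q \<and> H x a r)) \<and>
    (\<forall>x y a a' q. H x a q \<longrightarrow> H y a' q \<longrightarrow> x \<in> underS \<theta> y \<longrightarrow> a \<in> underS lam a' \<and> Gr a a' q)"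
        unfolding green_alternative_def by (elim bexE exE) (rule that)
      note H = conjunct1[OF h, rule_format]
      note h2 = conjunct2[OF h]
      note H_open = conjunct1[OF h2, rule_format]
      note h3 = conjunct2[OF h2]
      note H_fun = conjunct1[OF h3, rule_format]
      note h4 = conjunct2[OF h3]
      note H_dense = conjunct1[OF h4, rule_format]
      note H_less = conjunct2[OF h4, rule_format]
      have "(\<^bold>\<exists>Y. Y \<^bold>\<subseteq> l \<^bold>\<and> fOrdertype Y z \<^bold>\<and> fHomogeneous c Y green) r"
        by (rule green_conclusion[OF r(1) nm(2) b _ H_open H_fun H_dense])
          (use H H_less in \<open>unfold Gr_def, blast+\<close>)
      then show ?thesis ..
    qed
    then show "\<exists>r \<in> P. le r q0 \<and>
        ((\<^bold>\<exists>X. X \<^bold>\<subseteq> l \<^bold>\<and> fEquipotent X l \<^bold>\<and> fHomogeneous c X red) r \<or>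
        (\<^bold>\<exists>Y. Y \<^bold>\<subseteq> l \<^bold>\<and> fOrdertype Y z \<^bold>\<and> fHomogeneous c Y green) r)"
      using r by blast
  qed
  have reg_hyp: "reg (\<^bold>\<not> (red \<^bold>= green) \<^bold>\<and> fPairset C red green \<^bold>\<and> fPairs D l \<^bold>\<and> fFun c D C)"
    for red green C D c
    by (intro reg_fAnd reg_fNot reg_fEq reg_fPairset reg_fPairs reg_fFun)
  have imp: "(\<^bold>\<not> (red \<^bold>= green) \<^bold>\<and> fPairset C red green \<^bold>\<and> fPairs D l \<^bold>\<and> fFun c D C \<^bold>\<longrightarrow>
      (\<^bold>\<exists>X. X \<^bold>\<subseteq> l \<^bold>\<and> fEquipotent X l \<^bold>\<and> fHomogeneous c X red) \<^bold>\<or>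
      (\<^bold>\<exists>Y. Y \<^bold>\<subseteq> l \<^bold>\<and> fOrdertype Y z \<^bold>\<and> fHomogeneous c Y green)) p"
    if "is_name red" "is_name green" "is_name C" "is_name D" "is_name c" for red green C D c
    unfolding fImp_iff[OF reg_hyp reg_fOr[OF reg_fEx reg_fEx] p]
    using main[OF that] by (auto simp: fAnd_def)
  show ?thesis
    unfolding fArrow_def
    by (simp only: fAll_iff[OF reg_fAll p] fAll_iff[OF reg_fImp[OF reg_hyp reg_fOr[OF reg_fEx reg_fEx]] p])
      (use imp in blast)
qed

end

theorem theorem3:
  fixes \<theta> :: "'t rel" and \<sigma> :: "'s rel" and \<kappa> :: "'k rel" and lam :: "'l rel" and \<nu> :: "'n rel"
  assumes "Card_order \<theta>" and "Card_order \<sigma>" and "Card_order \<kappa>" and "Card_order lam"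
    and "Card_order \<nu>"
    and "natLeq \<le>o \<theta>" and "\<theta> \<le>o \<sigma>" and "\<sigma> =o cexp_less \<sigma> \<sigma>" and "\<sigma> <o \<kappa>"
    and "has_cofinality lam \<kappa>" and "\<kappa> <o lam" and "lam \<le>o \<nu>"
    and "strong_limit lam"
    and "\<forall>\<mu> :: 'k rel. Card_order \<mu> \<and> \<mu> <o \<kappa> \<longrightarrow> cexp_less \<mu> \<theta> <o \<kappa>"
    and "|cohen \<nu> \<sigma>| \<le>o |UNIV :: 'i set|"
  shows "forcing.holds (cohen \<nu> \<sigma>)
    (forcing.fArrow (cohen \<nu> \<sigma>) extends
      (ord_name Map.empty lam :: ('i, 'n \<times> 's \<rightharpoonup> bool) name)
      (succ_name Map.empty (ord_name Map.empty \<theta>)))"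
proof -
  note [simp] = extends_def
  have \<sigma>_inf: "natLeq \<le>o \<sigma>" using assms(6,7) by (rule ordLeq_transitive)
  interpret cohen_forcing \<sigma> \<nu>
    by unfold_locales (rule assms \<sigma>_inf)+
  have \<kappa>_inf: "natLeq \<le>o \<kappa>"
    using \<sigma>_inf assms(9) ordLeq_ordLess_trans ordLess_imp_ordLeq by metis
  have kreg: "regular_card \<kappa>"
    by (rule regular_card_cofinality[OF assms(4,3) \<kappa>_inf assms(10)])
  have \<theta>_ne: "Field \<theta> \<noteq> {}"
  proof
    assume "Field \<theta> = {}"
    then have "\<theta> = {}" by (auto simp: Field_def)
    then show False
      using assms(6) card_of_mono2[OF assms(6)] Field_natLeq
      by (metis Field_empty card_of_empty3 UNIV_not_empty)
  qed
  obtain s0 where s0: "s0 \<in> Field \<sigma>"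
    using sigma_regular unfolding regular_card_def by (metis ex_in_conv finite.emptyI)
  have E: "Map.empty \<in> P"
    using small_subset[OF regular_small_singleton[OF sigma_regular], of "{}"] by (simp add: cohen_def)
  \<comment> \<open>One-point conditions embed \<open>\<nu>\<close> into the set of conditions.
    Hence \<open>lam\<close> and \<open>\<theta>\<close> fit into the index type of the names as
    soon as the conditions do.\<close>
  have "|Field lam| \<le>o |P|"
  proof -
    have "|Field lam| \<le>o |Field \<nu>|" using assms(12) by (rule card_of_mono2)
    moreover have "|Field \<nu>| \<le>o |P|"
    proof (rule card_of_ordLeqI)
      show "inj_on (\<lambda>x. [(x, s0) \<mapsto> True]) (Field \<nu>)"
        by (rule inj_onI) (metis domI dom_eq_singleton_conv fun_upd_same prod.inject singletonD)
      show "[(x, s0) \<mapsto> True] \<in> P" if "x \<in> Field \<nu>" for x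
        using that s0 regular_small_singleton[OF sigma_regular] by (simp add: cohen_def)
    qed
    ultimately show ?thesis by (rule ordLeq_transitive)
  qed
  then have lam_small: "|Field lam| \<le>o |UNIV :: 'i set|"
    using assms(15) by (rule ordLeq_transitive)
  have "natLeq \<le>o lam"
    using \<kappa>_inf assms(11) ordLeq_ordLess_trans ordLess_imp_ordLeq by metis
  then have "|UNIV :: nat set| \<le>o |Field lam|"
    using card_of_mono2 Field_natLeq by metis
  then have i_inf: "\<not> finite (UNIV :: 'i set)"
    using card_of_ordLeq_infinite ordLeq_transitive[OF _ lam_small] infinite_UNIV_nat by metis
  have "\<theta> \<le>o lam"
    using assms(7,9,11) ordLeq_ordLess_trans ordLess_transitive ordLess_imp_ordLeq by metis
  then have theta_small: "|Field \<theta>| \<le>o |UNIV :: 'i set|"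
    using ordLeq_transitive[OF card_of_mono2 lam_small] by blast
  interpret G: ground_names P extends "Map.empty" "TYPE('i)" lam \<theta>
  proof
    show "extends p r" if "extends p q" "extends q r" for p q r :: "'n \<times> 's \<rightharpoonup> bool"
      using that map_le_trans by auto
  qed (use assms E i_inf lam_small theta_small in \<open>auto simp: card_order_on_def\<close>)
  have "forcing.fArrow P extends G.l G.z p" if p: "p \<in> P" for p
  proof (rule G.fArrowI[OF p])
    fix Gr :: "'l \<Rightarrow> 'l \<Rightarrow> ('n \<times> 's \<rightharpoonup> bool) \<Rightarrow> bool" and q
    assume Gr_P: "\<And>a b r. Gr a b r \<Longrightarrow> r \<in> P"
      and Gr_open: "\<And>a b r s. Gr a b r \<Longrightarrow> s \<in> P \<Longrightarrow> extends s r \<Longrightarrow> Gr a b s" and q: "q \<in> P"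
    have "\<forall>ab. \<exists>t :: bool \<times> ('s \<Rightarrow> 'n \<times> 's \<rightharpoonup> bool). (\<forall>z. snd t z \<in> P) \<and>
        (fst t \<longrightarrow> (\<forall>z. Gr (fst ab) (snd ab) (snd t z))) \<and>
        (\<forall>p. Gr (fst ab) (snd ab) p \<longrightarrow> fst t \<and> (\<exists>z \<in> Field \<sigma>. agree p (snd t z)))"
    proof
      fix ab
      from enumerated_antichain[of "Gr (fst ab) (snd ab)", OF Gr_P]
      show "\<exists>t :: bool \<times> ('s \<Rightarrow> 'n \<times> 's \<rightharpoonup> bool). (\<forall>z. snd t z \<in> P) \<and>
          (fst t \<longrightarrow> (\<forall>z. Gr (fst ab) (snd ab) (snd t z))) \<and>
          (\<forall>p. Gr (fst ab) (snd ab) p \<longrightarrow> fst t \<and> (\<exists>z \<in> Field \<sigma>. agree p (snd t z)))"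
        by simp
    qed
    from choice[OF this] obtain t where t: "\<forall>ab. (\<forall>z. snd (t ab) z \<in> P) \<and>
        (fst (t ab) \<longrightarrow> (\<forall>z. Gr (fst ab) (snd ab) (snd (t ab) z))) \<and>
        (\<forall>p. Gr (fst ab) (snd ab) p \<longrightarrow> fst (t ab) \<and> (\<exists>z \<in> Field \<sigma>. agree p (snd (t ab) z)))"
      by (elim exE) (rule that)
    define ok where "ok a b = fst (t (a, b))" for a b
    define m where "m a b = snd (t (a, b))" for a b
    have m_P: "m a b z \<in> P" for a b z using t by (simp add: m_def)
    have m_Gr: "Gr a b (m a b z)" if "ok a b" for a b z
      using t[rule_format, of "(a, b)"] that by (simp add: m_def ok_def)
    have m_dense: "ok a b \<and> (\<exists>z \<in> Field \<sigma>. agree p (m a b z))" if "Gr a b p" for a b p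
      using t[rule_format, of "(a, b)"] that by (simp add: m_def ok_def)
    obtain d I where dI: "(\<forall>k \<in> Field \<kappa>. d k \<in> Field lam \<and> \<kappa> \<le>o |underS lam (d k)| \<and> I k \<subseteq> Field lam \<and>
        |I k| =o cardSuc |Pow (underS lam (d k))| \<and>
        (\<forall>a \<in> I k. |I k \<inter> underS lam a| <o cardSuc |Pow (underS lam (d k))| ) \<and>
        I k \<inter> underS lam (d k) = {} \<and>
        (\<forall>j \<in> underS \<kappa> k. I j \<subseteq> underS lam (d k) \<and> d j \<in> underS lam (d k))) \<and>
        (\<forall>x \<in> Field lam. \<exists>k \<in> Field \<kappa>. x \<in> underS lam (d k))"
      using pieces_exist[OF assms(4,13) kreg assms(11,10)] by (elim exE) (rule that)
    interpret core \<sigma> \<nu> lam \<kappa> \<theta> m ok d I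
    proof
      show "I j \<subseteq> underS lam (d k)" "d j \<in> underS lam (d k)" if "j \<in> underS \<kappa> k" for j k
        using dI underS_FieldD[OF that] that by blast+
    qed (use assms(1-14) kreg m_P dI in simp_all)
    have Grm_Gr: "Gr a b r" if "Grm a b r" for a b r
      using that unfolding Grm_def by (elim conjE bexE) (rule Gr_open[OF m_Gr], auto)
    show "\<exists>r \<in> P. extends r q \<and> (G.red_alternative Gr r \<or> G.green_alternative Gr r)"
    proof (cases "\<exists>b q' H. q' \<in> P \<and> q \<subseteq>\<^sub>m q' \<and> col.green_system b q' H")
      case True
      then obtain b q' H where q': "q' \<in> P" "q \<subseteq>\<^sub>m q'" and g: "col.green_system b q' H" by blast
      \<comment> \<open>\<open>green_system\<close> does not itself place \<open>b\<close> in
        \<open>lam\<close>; an entry of the sequence, lying below \<open>b\<close>, does.\<close>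
      obtain x where "x \<in> Field \<theta>" using \<theta>_ne by blast
      then obtain r a where "H x a r" using g q'(1) map_le_refl[of q'] unfolding col.green_system_def by blast
      then have "a \<in> underS lam b" using g unfolding col.green_system_def by blast
      then have b: "b \<in> Field lam" using underS_FieldD by metis
      note g1 = g[unfolded col.green_system_def]
      note g2 = conjunct2[OF g1]
      note g3 = conjunct2[OF g2]
      note g4 = conjunct2[OF g3]
      have "G.green_alternative Gr q'"
        unfolding G.green_alternative_def extends_def
      proof (rule bexI[OF _ b], rule exI[of _ H], intro conjI)
        show "\<forall>x a q. H x a q \<longrightarrow> q \<in> P \<and> a \<in> underS lam b \<and> Gr a b q"
          using conjunct1[OF g1] Grm_Gr by metis
        show "\<forall>x y a a' q. H x a q \<longrightarrow> H y a' q \<longrightarrow> x \<in> underS \<theta> y \<longrightarrow>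
            a \<in> underS lam a' \<and> Gr a a' q"
          using conjunct2[OF g4] Grm_Gr by metis
      qed (rule conjunct1[OF g2] conjunct1[OF g3] conjunct1[OF g4])+
      then show ?thesis using q' by auto
    next
      case False
      then obtain p' H where p': "p' \<in> P" "q \<subseteq>\<^sub>m p'" and r: "red_system p' H"
        using red_or_green[OF q] by blast
      note r1 = r[unfolded red_system_def]
      note r2 = conjunct2[OF r1]
      note r3 = conjunct2[OF r2]
      note r4 = conjunct2[OF r3]
      note r5 = conjunct2[OF r4]
      \<comment> \<open>A condition that forces green agrees with a listed one. In a common
        extension \<open>u\<close> both points are still in the red range, and \<open>Grm\<close>
        holds, which the red system excludes.\<close>
      have notGr: "\<not> Gr a b s" if h: "H x a s" "H y b s" and ab: "a \<in> underS lam b" for x y a b s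
      proof
        assume "Gr a b s"
        then obtain z where z: "ok a b" "z \<in> Field \<sigma>" "agree s (m a b z)" using m_dense by blast
        have "s \<in> P" using conjunct1[OF r1, rule_format, OF h(1)] by simp
        then obtain u where u: "u \<in> P" "s \<subseteq>\<^sub>m u" "m a b z \<subseteq>\<^sub>m u"
          using common_extension[OF _ m_P z(3)] by metis
        have "H x a u" "H y b u"
          using conjunct1[OF r2, rule_format, OF h(1) u(1,2)] conjunct1[OF r2, rule_format, OF h(2) u(1,2)] .
        then have "\<not> Grm a b u" using conjunct2[OF r5, rule_format] ab by metis
        then show False using u z unfolding Grm_def by blast
      qed
      have "G.red_alternative Gr p'"
        unfolding G.red_alternative_def extends_def
      proof (intro exI[of _ H] conjI)
        show "\<forall>x y a b q. H x a q \<longrightarrow> H y b q \<longrightarrow> a \<in> underS lam b \<longrightarrow> \<not> Gr a b q"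
          using notGr by metis
      qed (rule conjunct1[OF r1] conjunct1[OF r2] conjunct1[OF r3] conjunct1[OF r4] conjunct1[OF r5])+
      then show ?thesis using p' by auto
    qed
  qed
  then show ?thesis
    unfolding forcing.holds_def by blast
qed

end
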